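(* Let $q$ be a fixed positive integer. For each positive integer $p$, suppose that $(X_p,Y)\sim\mathcal N_{p+q}(\mu_p,\Sigma_p)$, where $X_p\in\mathbb{R}^p$, $Y\in\mathbb{R}^q$ and $$\Sigma_p=\begin{pmatrix}\Sigma_{X,p}&\Sigma_{XY,p}\\ \Sigma_{YX,p}&\Sigma_{Y}\end{pmatrix}$$ with $\Sigma_{X,p}\in\mathbb{R}^{p\times p}$ and $\Sigma_{Y}\in\mathbb{R}^{q\times q}$ positive definite and such that $$\Lambda_p=\Sigma_{Y}^{-1/2}\,\Sigma_{YX,p}\,\Sigma_{X,p}^{-1}\,\Sigma_{XY,p}\,\Sigma_{Y}^{-1/2}\ne0 .$$ Then $$\lim_{p\to\infty}\frac{\sqrt p}{\operatorname{tr}(\Lambda_p)}\,\widetilde{\mathcal V}^2(X_p,Y)=\sqrt{\frac{\pi}{2}}\;\frac{c_{q-1}}{q\,c_q}$$ and $$\lim_{p\to\infty}\frac{\sqrt p}{\operatorname{tr}(\Lambda_p)}\,\widetilde{\mathcal R}^2(X_p,Y)=\frac{1}{2q\sqrt{A(q)}},$$ where $$A(q)=\frac{\Gamma(\frac12q)\,\Gamma(\frac12q+1)}{\bigl[\Gamma\bigl(\frac12(q+1)\bigr)\bigr]^2}-2\,{}_2F_1\bigl(-\tfrac12,-\tfrac12;\tfrac12q;\tfrac14\bigr)+1 .$$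
   Context: $|\cdot|_p$ and $\langle\cdot,\cdot\rangle_p$ denote the Euclidean norm and scalar product on $\mathbb{R}^p$; $c_p=\pi^{(p+1)/2}/\Gamma((p+1)/2)$ (for integers $p\ge0$); ${}_2F_1$ is the Gaussian hypergeometric function. For jointly distributed random vectors $X\in\mathbb{R}^p$, $Y\in\mathbb{R}^q$ let $f_{X,Y}(s,t)=\mathbb{E}\exp[\mathrm{i}\langle s,X\rangle_p+\mathrm{i}\langle t,Y\rangle_q]$, $f_X(s)=f_{X,Y}(s,0)$, $f_Y(t)=f_{X,Y}(0,t)$. The distance covariance $\mathcal V(X,Y)\ge0$ is defined by $$\mathcal V^2(X,Y)=\frac{1}{c_pc_q}\int_{\mathbb{R}^{p+q}}\frac{|f_{X,Y}(s,t)-f_X(s)f_Y(t)|^2}{|s|_p^{p+1}|t|_q^{q+1}}\,ds\,dt .$$ For $X,Y$ with finite second moments and nonsingular covariance matrices $\Sigma_X,\Sigma_Y$, the affinely invariant distance covariance $\widetilde{\mathcal V}(X,Y)\ge0$ is defined by $\widetilde{\mathcal V}^2(X,Y)=\mathcal V^2(\Sigma_X^{-1/2}X,\Sigma_Y^{-1/2}Y)$ (and $\widetilde{\mathcal V}(X,X)$, $\widetilde{\mathcal V}(Y,Y)$ are obtained by taking both arguments to be the same random vector). The affinely invariant distance correlation is $$\widetilde{\mathcal R}(X,Y)=\frac{\widetilde{\mathcal V}(X,Y)}{\sqrt{\widetilde{\mathcal V}(X,X)\,\widetilde{\mathcal V}(Y,Y)}}$$ if both factors in the denominator are strictly positive,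 and $0$ otherwise; $\widetilde{\mathcal R}^2$ is its square. $\mathcal N_{m}(\mu,\Sigma)$ is the multivariate normal distribution with mean $\mu\in\mathbb{R}^{m}$ and covariance matrix $\Sigma$ (possibly singular); $\Sigma_{YX,p}=\Sigma_{XY,p}'$, where $'$ denotes transpose. *)

theory Defs
  imports
    "HOL-Probability.Probability"
    "Jordan_Normal_Form.Gauss_Jordan_Elimination"
begin

unbundle no vec_syntax and no inner_syntax

(* The dimension p tends to infinity, so Euclidean space R^n is the carrier carrier_vec n of
   list-like vectors rather than a type indexed by its dimension. *)

definition eucl_norm :: "real vec \<Rightarrow> real" where
  "eucl_norm v = sqrt (v \<bullet> v)"

(* Lebesgue measure on the Borel sets of carrier_vec n, transported from the n-fold product of
   lborel along vec n, which is a bijection from the extensional functions on {..<n} onto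
   carrier_vec n. An n-dimensional random vector is a measurable map into lborel_vec n. *)
definition lborel_vec :: "nat \<Rightarrow> real vec measure" where
  "lborel_vec n = embed_measure (\<Pi>\<^sub>M i\<in>{..<n}. lborel) (vec n)"

definition pos_def_mat :: "nat \<Rightarrow> real mat \<Rightarrow> bool" where
  "pos_def_mat n A \<longleftrightarrow> A \<in> carrier_mat n n \<and> transpose_mat A = A \<and>
     (\<forall>v\<in>carrier_vec n. v \<noteq> 0\<^sub>v n \<longrightarrow> v \<bullet> (A *\<^sub>v v) > 0)"

definition pos_semidef_mat :: "nat \<Rightarrow> real mat \<Rightarrow> bool" where
  "pos_semidef_mat n A \<longleftrightarrow> A \<in> carrier_mat n n \<and> transpose_mat A = A \<and>
     (\<forall>v\<in>carrier_vec n. v \<bullet> (A *\<^sub>v v) \<ge> 0)"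

definition mat_trace :: "real mat \<Rightarrow> real" where
  "mat_trace A = (\<Sum>i<dim_row A. A $$ (i, i))"

(* Unspecified for singular matrices. *)
definition mat_inv :: "real mat \<Rightarrow> real mat" where
  "mat_inv A = the (mat_inverse A)"

(* The unique positive semidefinite square root; unspecified unless A is positive semidefinite. *)
definition mat_sqrt :: "real mat \<Rightarrow> real mat" where
  "mat_sqrt A = (THE S. pos_semidef_mat (dim_row A) S \<and> S * S = A)"

definition mat_inv_sqrt :: "real mat \<Rightarrow> real mat" where
  "mat_inv_sqrt A = mat_inv (mat_sqrt A)"

definition std_normal_vec :: "nat \<Rightarrow> real vec measure" where
  "std_normal_vec n = embed_measure (\<Pi>\<^sub>M i\<in>{..<n}. density lborel std_normal_density) (vec n)"

(* The law of mu + Sigma^(1/2) Z with Z standard normal; for positive semidefinite, possibly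
   singular, Sigma this is the normal distribution with mean mu and covariance matrix Sigma. *)
definition multivariate_normal :: "nat \<Rightarrow> real vec \<Rightarrow> real mat \<Rightarrow> real vec measure" where
  "multivariate_normal n \<mu> \<Sigma> =
     distr (std_normal_vec n) (lborel_vec n) (\<lambda>z. \<mu> + mat_sqrt \<Sigma> *\<^sub>v z)"

definition covariance_mat :: "'a measure \<Rightarrow> nat \<Rightarrow> ('a \<Rightarrow> real vec) \<Rightarrow> real mat" where
  "covariance_mat M n X = mat n n (\<lambda>(i, j).
     LINT \<omega>|M. (X \<omega> $ i - (LINT \<eta>|M. X \<eta> $ i)) * (X \<omega> $ j - (LINT \<eta>|M. X \<eta> $ j)))"

definition dcov_const :: "nat \<Rightarrow> real" where
  "dcov_const p = pi powr ((real p + 1) / 2) / Gamma ((real p + 1) / 2)"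

definition joint_char ::
  "'a measure \<Rightarrow> ('a \<Rightarrow> real vec) \<Rightarrow> ('a \<Rightarrow> real vec) \<Rightarrow> real vec \<Rightarrow> real vec \<Rightarrow> complex" where
  "joint_char M X Y s t = (CLINT \<omega>|M. iexp (s \<bullet> X \<omega> + t \<bullet> Y \<omega>))"

(* X and Y are random vectors of dimensions p and q. The integrand is undefined only on the null
   set where s = 0 or t = 0 (there the quotient is 0 by convention). The integral is a Bochner
   integral; it is finite whenever X and Y have finite first moments. *)
definition dist_cov ::
  "'a measure \<Rightarrow> nat \<Rightarrow> nat \<Rightarrow> ('a \<Rightarrow> real vec) \<Rightarrow> ('a \<Rightarrow> real vec) \<Rightarrow> real" where
  "dist_cov M p q X Y = sqrt (1 / (dcov_const p * dcov_const q) *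
     (LINT (s, t)|(lborel_vec p \<Otimes>\<^sub>M lborel_vec q).
        (cmod (joint_char M X Y s t - joint_char M X Y s (0\<^sub>v q) * joint_char M X Y (0\<^sub>v p) t))\<^sup>2
        / (eucl_norm s ^ (p + 1) * eucl_norm t ^ (q + 1))))"

definition ai_dist_cov ::
  "'a measure \<Rightarrow> nat \<Rightarrow> nat \<Rightarrow> ('a \<Rightarrow> real vec) \<Rightarrow> ('a \<Rightarrow> real vec) \<Rightarrow> real" where
  "ai_dist_cov M p q X Y = dist_cov M p q
     (\<lambda>\<omega>. mat_inv_sqrt (covariance_mat M p X) *\<^sub>v X \<omega>)
     (\<lambda>\<omega>. mat_inv_sqrt (covariance_mat M q Y) *\<^sub>v Y \<omega>)"

definition ai_dist_corr ::
  "'a measure \<Rightarrow> nat \<Rightarrow> nat \<Rightarrow> ('a \<Rightarrow> real vec) \<Rightarrow> ('a \<Rightarrow> real vec) \<Rightarrow> real" where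
  "ai_dist_corr M p q X Y =
     (if ai_dist_cov M p p X X > 0 \<and> ai_dist_cov M q q Y Y > 0
      then ai_dist_cov M p q X Y / sqrt (ai_dist_cov M p p X X * ai_dist_cov M q q Y Y)
      else 0)"

(* The Gaussian hypergeometric series, for \<bar>z\<bar> < 1. *)
definition hyp2F1 :: "real \<Rightarrow> real \<Rightarrow> real \<Rightarrow> real \<Rightarrow> real" where
  "hyp2F1 a b c z = eval_fps (fps_hypergeo [a, b] [c] 1) z"

definition A_const :: "nat \<Rightarrow> real" where
  "A_const q = Gamma (real q / 2) * Gamma (real q / 2 + 1) / (Gamma ((real q + 1) / 2))\<^sup>2
     - 2 * hyp2F1 (- 1 / 2) (- 1 / 2) (real q / 2) (1 / 4) + 1"

end

theory Submission
  imports Defs "HOL-Real_Asymp.Real_Asymp" "Jordan_Normal_Form.Char_Poly"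
begin

text \<open>
  Standardised, the two vectors are Gaussian with identity covariances and cross-covariance
  matrix \<open>L = \<Sigma>X^(-1/2) \<Sigma>XY \<Sigma>Y^(-1/2)\<close>, so that \<open>\<Lambda> = L\<^sup>T L\<close>, and the
  integrand of the distance covariance is
  \<open>exp (- |s|\<^sup>2 - |t|\<^sup>2) (1 - exp (- \<langle>s, L t\<rangle>))\<^sup>2 / (|s|^(p+1) |t|^(q+1))\<close>.

  The singular weight \<open>|s|^(-(p+1))\<close> is a mixture over \<open>r > 0\<close> of the functions \<open>exp (- r |s|\<^sup>2)\<close>
  (\<open>inverse_norm_power_mixture\<close>). After exchanging the integrations, only Gaussian integrals over
  \<open>s\<close> remain, and these factorise over the coordinates. With \<open>phi x = e\<^sup>x - 2 e^(x/4) + 1\<close> the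
  \<open>s\<close>-integral becomes a multiple of
  \<open>\<integral> r^((p-1)/2) (1 + r)^(-p/2) phi (|L t|\<^sup>2 / (1 + r)) dr\<close>, a Beta integral in each positive
  power of \<open>1 / (1 + r)\<close>.

  For the first limit, \<open>x / 2 \<le> phi x \<le> x / 2 + x\<^sup>2 e\<^sup>x / 2\<close>. The linear term contributes exactly
  \<open>tr \<Lambda>\<close> times a constant depending on \<open>q\<close> times \<open>B(1/2, (p + 1) / 2)\<close>, which is of order
  \<open>p^(-1/2)\<close>. Since the joint covariance matrix is positive semidefinite, \<open>|L t| \<le> |t|\<close>; hence the
  remainder is at most \<open>tr \<Lambda>\<close> times a multiple of \<open>B(3/2, (p - 2) / 2)\<close>, of order \<open>p^(-3/2)\<close>. This is
  \<open>gauss_dcov_bounds\<close>; it is uniform over all admissible sequences of covariance matrices because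
  both bounds are proportional to \<open>tr \<Lambda>\<close>.

  For the second limit the denominators are distance variances of standard normal vectors, the
  case \<open>L = 1\<close>. Writing both weights as mixtures and expanding by the binomial series gives a power
  series in \<open>1 / ((1 + r) (1 + r'))\<close> with nonnegative coefficients, and termwise integration yields
  \<open>4 (\<Gamma>((n + 1) / 2) / \<Gamma>(n / 2))\<^sup>2 A(n)\<close> in dimension \<open>n\<close> (\<open>gauss_dcov_id\<close>). The closed
  form of \<open>A\<close> uses the value at \<open>1\<close> of the hypergeometric series with parameters \<open>- 1/2, - 1/2; c\<close>
  (\<open>gauss_sum\<close>). As \<open>n\<close> grows only the first term of the series matters, \<open>A(n)\<close> behaves like
  \<open>1 / (4 n)\<close>, and the squared distance variance of \<open>X\<close> tends to \<open>1 / 2\<close>.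
\<close>

section \<open>Gamma mixtures and one-dimensional Gaussian integrals\<close>

lemma nn_integral_Gamma_rate:
  fixes c y :: real
  assumes "c > 0" "y > 0"
  shows "(\<integral>\<^sup>+r. ennreal (indicator {0<..} r * (r powr (y - 1) * exp (- (c * r)))) \<partial>lborel)
           = ennreal (Gamma y * c powr (- y))"
proof -
  let ?g = "\<lambda>t::real. ennreal (indicator {0..} t * t powr (y - 1) / exp t)"
  have "ennreal (Gamma y) = (\<integral>\<^sup>+t. ?g t \<partial>lborel)"
    using assms by (intro Gamma_conv_nn_integral_real)
  also have "\<dots> = ennreal c * (\<integral>\<^sup>+r. ?g (0 + c * r) \<partial>lborel)"
    using assms by (subst nn_integral_real_affine[of _ c 0]) auto
  also have "(\<integral>\<^sup>+r. ?g (0 + c * r) \<partial>lborel) =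
      (\<integral>\<^sup>+r. ennreal (c powr (y - 1)) *
         ennreal (indicator {0<..} r * (r powr (y - 1) * exp (- (c * r)))) \<partial>lborel)"
    using assms by (intro nn_integral_cong)
      (auto simp: indicator_def zero_le_mult_iff powr_mult exp_minus field_simps
            simp flip: ennreal_mult')
  also have "\<dots> = ennreal (c powr (y - 1)) *
      (\<integral>\<^sup>+r. ennreal (indicator {0<..} r * (r powr (y - 1) * exp (- (c * r)))) \<partial>lborel)"
    by (rule nn_integral_cmult) auto
  finally have *: "ennreal (Gamma y) = ennreal (c powr y) *
      (\<integral>\<^sup>+r. ennreal (indicator {0<..} r * (r powr (y - 1) * exp (- (c * r)))) \<partial>lborel)"
    using assms by (simp add: mult.assoc[symmetric] powr_diff flip: ennreal_mult')
  have "ennreal (c powr (- y)) * ennreal (Gamma y) = 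
    (\<integral>\<^sup>+r. ennreal (indicator {0<..} r * (r powr (y - 1) * exp (- (c * r)))) \<partial>lborel)"
    unfolding * using assms
    by (simp add: mult.assoc[symmetric] powr_minus flip: ennreal_mult')
  then show ?thesis using assms by (simp add: mult.commute flip: ennreal_mult')
qed

text \<open>
  With \<open>\<Gamma>(x + y) (\<delta> + r)^(-(x+y))\<close> written as a Gamma integral over \<open>t\<close> at rate \<open>\<delta> + r\<close>, exchanging the
  integrations leaves Gamma integrals, first in \<open>r\<close> at rate \<open>t\<close> and then in \<open>t\<close> at rate \<open>\<delta>\<close>.
\<close>

lemma nn_integral_beta_prime:
  fixes x y \<delta> :: real
  assumes "x > 0" "y > 0" "\<delta> > 0"
  shows "(\<integral>\<^sup>+r. ennreal (indicator {0<..} r * (r powr (y - 1) * (\<delta> + r) powr (- (x + y)))) \<partial>lborel)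
           = ennreal (\<delta> powr (- x) * Beta x y)"
proof -
  have pos: "Gamma (x + y) > 0" using assms by (intro Gamma_real_pos) auto
  then have nz: "Gamma (x + y) \<noteq> 0" by linarith
  let ?h = "\<lambda>r t::real. ennreal (indicator {0<..} r * r powr (y - 1)) *
     ennreal (indicator {0<..} t * (t powr (x + y - 1) * exp (- ((\<delta> + r) * t))))"
  have "ennreal (Gamma (x + y)) *
     (\<integral>\<^sup>+r. ennreal (indicator {0<..} r * (r powr (y - 1) * (\<delta> + r) powr (- (x + y)))) \<partial>lborel)
    = (\<integral>\<^sup>+r. ennreal (indicator {0<..} r * r powr (y - 1)) *
         ennreal (Gamma (x + y) * (\<delta> + r) powr (- (x + y))) \<partial>lborel)"
    using assms by (subst nn_integral_cmult[symmetric])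
      (auto intro!: nn_integral_cong simp: indicator_def mult_ac simp flip: ennreal_mult')
  also have "\<dots> = (\<integral>\<^sup>+r. \<integral>\<^sup>+t. ?h r t \<partial>lborel \<partial>lborel)"
  proof (intro nn_integral_cong)
    fix r :: real
    show "ennreal (indicator {0<..} r * r powr (y - 1)) *
         ennreal (Gamma (x + y) * (\<delta> + r) powr (- (x + y))) = (\<integral>\<^sup>+t. ?h r t \<partial>lborel)"
      using assms nn_integral_Gamma_rate[of "\<delta> + r" "x + y"]
      by (cases "r > 0") (auto simp: nn_integral_cmult)
  qed
  also have "\<dots> = (\<integral>\<^sup>+t. \<integral>\<^sup>+r. ?h r t \<partial>lborel \<partial>lborel)"
    by (rule lborel_pair.Fubini') measurable
  also have "\<dots> = (\<integral>\<^sup>+t. ennreal (Gamma y) *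
       ennreal (indicator {0<..} t * (t powr (x - 1) * exp (- (\<delta> * t)))) \<partial>lborel)"
  proof (intro nn_integral_cong)
    fix t :: real
    show "(\<integral>\<^sup>+r. ?h r t \<partial>lborel) = ennreal (Gamma y) *
       ennreal (indicator {0<..} t * (t powr (x - 1) * exp (- (\<delta> * t))))"
    proof (cases "t > 0")
      case True
      have "(\<integral>\<^sup>+r. ?h r t \<partial>lborel) = (\<integral>\<^sup>+r. ennreal (t powr (x + y - 1) * exp (- (\<delta> * t))) *
          ennreal (indicator {0<..} r * (r powr (y - 1) * exp (- (t * r)))) \<partial>lborel)"
        using True by (intro nn_integral_cong)
          (auto simp: indicator_def algebra_simps exp_add exp_diff exp_minus divide_inverse simp flip: ennreal_mult')
      also have "\<dots> = ennreal (t powr (x + y - 1) * exp (- (\<delta> * t))) * ennreal (Gamma y * t powr (- y))"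
        using True assms by (subst nn_integral_cmult) (auto simp: nn_integral_Gamma_rate)
      also have "\<dots> = ennreal (Gamma y) * ennreal (t powr (x + y - 1 + (- y)) * exp (- (\<delta> * t)))"
        using True assms unfolding powr_add by (simp add: mult_ac flip: ennreal_mult')
      finally show ?thesis using True by simp
    qed simp
  qed
  also have "\<dots> = ennreal (Gamma y) * ennreal (Gamma x * \<delta> powr (- x))"
    using assms by (subst nn_integral_cmult) (auto simp: nn_integral_Gamma_rate)
  also have "\<dots> = ennreal (Gamma (x + y)) * ennreal (\<delta> powr (- x) * Beta x y)"
    using assms nz by (simp add: Beta_def mult_ac flip: ennreal_mult')
  finally show ?thesis
    using pos by (simp add: ennreal_mult_cancel_left)
qed

text \<open>
  Completing the square turns the integrand into a multiple of the normal density with mean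
  \<open>w / (2 a)\<close> and variance \<open>1 / (2 a)\<close>.
\<close>

lemma gaussian_integral_linear:
  fixes a w :: real
  assumes "a > 0"
  shows "has_bochner_integral lborel (\<lambda>x. exp (- (a * x\<^sup>2) + w * x)) (sqrt (pi / a) * exp (w\<^sup>2 / (4 * a)))"
proof -
  define \<sigma> where "\<sigma> = sqrt (1 / (2 * a))"
  have \<sigma>: "\<sigma> > 0" "\<sigma>\<^sup>2 = 1 / (2 * a)" using assms by (auto simp: \<sigma>_def)
  have "has_bochner_integral lborel (\<lambda>x. (sqrt (pi / a) * exp (w\<^sup>2 / (4 * a))) * normal_density (w / (2 * a)) \<sigma> x)
     ((sqrt (pi / a) * exp (w\<^sup>2 / (4 * a))) * 1)"
    using \<sigma> by (intro has_bochner_integral_mult_right)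
      (simp add: has_bochner_integral_iff integral_normal_density integrable_normal_density)
  moreover have "(sqrt (pi / a) * exp (w\<^sup>2 / (4 * a))) * normal_density (w / (2 * a)) \<sigma> x
      = exp (- (a * x\<^sup>2) + w * x)" for x
  proof -
    have 1: "2 * pi * (1 / (2 * a)) = pi / a" by simp
    have 2: "w\<^sup>2 / (4 * a) + - (x - w / (2 * a))\<^sup>2 / (2 * (1 / (2 * a))) = - (a * x\<^sup>2) + w * x"
      using assms by (simp add: field_simps power2_eq_square)
    show ?thesis unfolding normal_density_def \<sigma>(2) 1
      unfolding 2[symmetric] exp_add using assms by simp
  qed
  ultimately show ?thesis by simp
qed

lemma gaussian_moments:
  fixes a :: real
  assumes "a > 0"
  shows "has_bochner_integral lborel (\<lambda>x. x * exp (- (a * x\<^sup>2))) 0"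
    and "has_bochner_integral lborel (\<lambda>x. x\<^sup>2 * exp (- (a * x\<^sup>2))) (sqrt (pi / a) / (2 * a))"
proof -
  define \<sigma> where "\<sigma> = sqrt (1 / (2 * a))"
  have \<sigma>: "\<sigma> > 0" "\<sigma>\<^sup>2 = 1 / (2 * a)" using assms by (auto simp: \<sigma>_def)
  have eq: "sqrt (pi / a) * normal_density 0 \<sigma> x = exp (- (a * x\<^sup>2))" for x
    unfolding normal_density_def \<sigma>(2) using assms by (simp add: field_simps)
  have "has_bochner_integral lborel (\<lambda>x. sqrt (pi / a) * (normal_density 0 \<sigma> x * (x - 0) ^ (2 * 0 + 1))) (sqrt (pi / a) * 0)"
    using \<sigma> by (intro has_bochner_integral_mult_right normal_moment_odd)
  then show "has_bochner_integral lborel (\<lambda>x. x * exp (- (a * x\<^sup>2))) 0"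
    unfolding eq[symmetric] by (simp add: mult_ac)
  have "has_bochner_integral lborel (\<lambda>x. sqrt (pi / a) * (normal_density 0 \<sigma> x * (x - 0) ^ (2 * 1)))
     (sqrt (pi / a) * (fact (2 * 1) / ((2 / \<sigma>\<^sup>2) ^ 1 * fact 1)))"
    using \<sigma> by (intro has_bochner_integral_mult_right normal_moment_even)
  then show "has_bochner_integral lborel (\<lambda>x. x\<^sup>2 * exp (- (a * x\<^sup>2))) (sqrt (pi / a) / (2 * a))"
    unfolding eq[symmetric] \<sigma>(2) using assms by (simp add: mult_ac)
qed

section \<open>Gaussian integrals over products of the real line\<close>

abbreviation lborel_fun :: "nat \<Rightarrow> (nat \<Rightarrow> real) measure" where
  "lborel_fun n \<equiv> \<Pi>\<^sub>M i\<in>{..<n}. lborel"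

abbreviation sqsum :: "nat \<Rightarrow> (nat \<Rightarrow> real) \<Rightarrow> real" where
  "sqsum n x \<equiv> \<Sum>i<n. (x i)\<^sup>2"

lemma product_sigma_finite_lborel: "product_sigma_finite (\<lambda>i::nat. lborel :: real measure)"
  by (simp add: product_sigma_finite_def lborel.sigma_finite_measure_axioms)

lemma sigma_finite_lborel_fun: "sigma_finite_measure (lborel_fun n)"
  by (intro product_sigma_finite.sigma_finite[OF product_sigma_finite_lborel]) simp

lemma powr_half_nat: "b > 0 \<Longrightarrow> sqrt b ^ n = b powr (real n / 2)"
  by (simp add: powr_half_sqrt[symmetric] powr_powr powr_realpow[symmetric])

lemma has_bochner_integral_PiM_prod:
  fixes f :: "nat \<Rightarrow> 'a \<Rightarrow> 'b :: {real_normed_field, banach, second_countable_topology}"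
  assumes "product_sigma_finite M" "\<And>i. i < n \<Longrightarrow> has_bochner_integral (M i) (f i) (c i)"
  shows "has_bochner_integral (\<Pi>\<^sub>M i\<in>{..<n}. M i) (\<lambda>x. \<Prod>i<n. f i (x i)) (\<Prod>i<n. c i)"
  using assms product_sigma_finite.product_integrable_prod[OF assms(1), of "{..<n}" f]
    product_sigma_finite.product_integral_prod[OF assms(1), of "{..<n}" f]
  by (auto simp: has_bochner_integral_iff intro!: prod.cong)

text \<open>
  The weight \<open>g\<close> is a Gaussian when \<open>N\<close> is Lebesgue measure and constant when \<open>N\<close> is the standard
  normal distribution; both moment computations below are instances.
\<close>

lemma has_bochner_integral_PiM_second_moment:
  fixes N :: "real measure" and g :: "real \<Rightarrow> real"
  assumes N: "sigma_finite_measure N"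
    and 0: "has_bochner_integral N g m"
    and 1: "has_bochner_integral N (\<lambda>x. x * g x) 0"
    and 2: "has_bochner_integral N (\<lambda>x. x\<^sup>2 * g x) (v * m)"
    and "k < n" "l < n"
  shows "has_bochner_integral (\<Pi>\<^sub>M i\<in>{..<n}. N) (\<lambda>x. x k * x l * (\<Prod>i<n. g (x i)))
           (if k = l then v * m ^ n else 0)"
proof -
  \<comment> \<open>exponent of the coordinate \<open>i\<close> in the monomial \<open>x k * x l\<close>\<close>
  define e where "e i = (if i = k then 1 else 0) + (if i = l then 1 else 0 :: nat)" for i
  define c where "c i = (if e i = 0 then m else if e i = 1 then 0 else v * m)" for i
  have psf: "product_sigma_finite (\<lambda>i::nat. N)"
    using N by (simp add: product_sigma_finite_def)
  have "has_bochner_integral (\<Pi>\<^sub>M i\<in>{..<n}. N) (\<lambda>x. \<Prod>i<n. x i ^ e i * g (x i)) (\<Prod>i<n. c i)"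
  proof (rule has_bochner_integral_PiM_prod[OF psf])
    fix i
    show "has_bochner_integral N (\<lambda>x. x ^ e i * g x) (c i)"
      using 0 1 2 by (auto simp: e_def c_def power2_eq_square)
  qed
  moreover have "(\<Prod>i<n. x i ^ e i) = x k * x l" for x :: "nat \<Rightarrow> real"
  proof -
    have "(\<Prod>i<n. x i ^ e i) = (\<Prod>i<n. (if i = k then x i else 1) * (if i = l then x i else 1))"
      by (intro prod.cong) (auto simp: e_def)
    also have "\<dots> = x k * x l" using assms by (simp add: prod.distrib)
    finally show ?thesis .
  qed
  moreover have "(\<Prod>i<n. c i) = (if k = l then v * m ^ n else 0)"
  proof (cases "k = l")
    case True
    have "(\<Prod>i<n. c i) = (\<Prod>i<n. (if i = k then v else 1) * m)"
      using True by (intro prod.cong) (auto simp: c_def e_def)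
    then show ?thesis using assms True by (simp add: prod.distrib)
  next
    case False
    then have "c k = 0" by (auto simp: c_def e_def)
    then show ?thesis using assms False by (auto intro!: prod_zero)
  qed
  ultimately show ?thesis by (simp add: prod.distrib)
qed

lemma exp_sqsum_prod: "exp (- (a * sqsum n x)) = (\<Prod>i<n. exp (- (a * (x i)\<^sup>2)))"
  by (simp add: exp_sum[symmetric] sum_distrib_left sum_negf)

lemma gaussian_integral_linear_lborel_fun:
  fixes a :: real
  assumes "a > 0"
  shows "has_bochner_integral (lborel_fun n) (\<lambda>x. exp (- (a * sqsum n x) + (\<Sum>i<n. w i * x i)))
     ((pi / a) powr (real n / 2) * exp (sqsum n w / (4 * a)))"
proof -
  have "has_bochner_integral (lborel_fun n) (\<lambda>x. \<Prod>i<n. exp (- (a * (x i)\<^sup>2) + w i * x i))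
      (\<Prod>i<n. sqrt (pi / a) * exp ((w i)\<^sup>2 / (4 * a)))"
    using assms by (intro has_bochner_integral_PiM_prod product_sigma_finite_lborel gaussian_integral_linear)
  moreover have "(\<Prod>i<n. sqrt (pi / a) * exp ((w i)\<^sup>2 / (4 * a))) = (pi / a) powr (real n / 2) * exp (sqsum n w / (4 * a))"
    using assms powr_half_nat[of "pi / a" n]
    by (simp add: prod.distrib exp_sum[symmetric] sum_divide_distrib)
  ultimately show ?thesis
    by (simp add: exp_sum[symmetric] sum_subtractf sum_distrib_left)
qed

lemma gaussian_second_moment_lborel_fun:
  fixes a :: real
  assumes "a > 0" "k < n" "l < n"
  shows "has_bochner_integral (lborel_fun n) (\<lambda>x. x k * x l * exp (- (a * sqsum n x)))
     (if k = l then 1 / (2 * a) * (pi / a) powr (real n / 2) else 0)"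
proof -
  have "has_bochner_integral lborel (\<lambda>x. exp (- (a * x\<^sup>2))) (sqrt (pi / a))"
    using gaussian_integral_linear[of a 0] assms by simp
  from has_bochner_integral_PiM_second_moment[OF lborel.sigma_finite_measure_axioms this
      gaussian_moments(1)[OF assms(1)] _ assms(2,3), of "1 / (2 * a)"]
    gaussian_moments(2)[OF assms(1)] assms powr_half_nat[of "pi / a" n]
  show ?thesis unfolding exp_sqsum_prod by (auto simp: mult_ac)
qed

text \<open>
  Expanding the squares, mixed terms vanish because first moments do, and each diagonal term
  contributes the same variance; only the sum of the squared coefficients of \<open>L\<close> survives.
\<close>

lemma nn_integral_gaussian_quadratic:
  fixes a :: real and L :: "nat \<Rightarrow> nat \<Rightarrow> real"
  assumes "a > 0"
  shows "(\<integral>\<^sup>+t. ennreal (sqsum p (\<lambda>i. \<Sum>j<q. L i j * t j) * exp (- (a * sqsum q t))) \<partial>lborel_fun q)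
     = ennreal ((\<Sum>i<p. sqsum q (L i)) * (1 / (2 * a) * (pi / a) powr (real q / 2)))"
proof -
  let ?c = "1 / (2 * a) * (pi / a) powr (real q / 2)"
  have "has_bochner_integral (lborel_fun q)
     (\<lambda>t. \<Sum>i<p. \<Sum>j<q. \<Sum>k<q. L i j * L i k * (t j * t k * exp (- (a * sqsum q t))))
     (\<Sum>i<p. \<Sum>j<q. \<Sum>k<q. L i j * L i k * (if j = k then ?c else 0))"
    using assms by (intro has_bochner_integral_sum has_bochner_integral_mult_right
       gaussian_second_moment_lborel_fun) auto
  moreover have "(\<Sum>i<p. \<Sum>j<q. \<Sum>k<q. L i j * L i k * (t j * t k * exp (- (a * sqsum q t)))) =
     sqsum p (\<lambda>i. \<Sum>j<q. L i j * t j) * exp (- (a * sqsum q t))" for t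
    by (simp add: power2_eq_square sum_product sum_distrib_right sum_distrib_left mult_ac)
  moreover have "(\<Sum>i<p. \<Sum>j<q. \<Sum>k<q. L i j * L i k * (if j = k then ?c else 0)) = (\<Sum>i<p. sqsum q (L i)) * ?c"
    by (simp add: power2_eq_square sum_distrib_right sum_divide_distrib if_distrib cong: if_cong)
  ultimately have "has_bochner_integral (lborel_fun q)
     (\<lambda>t. sqsum p (\<lambda>i. \<Sum>j<q. L i j * t j) * exp (- (a * sqsum q t))) ((\<Sum>i<p. sqsum q (L i)) * ?c)" 
    by simp
  then show ?thesis
    by (subst nn_integral_eq_integral) (auto simp: has_bochner_integral_iff sum_nonneg)
qed

section \<open>Removing the singular weights\<close>

text \<open>
  The origin is the one point where the division in the weight \<open>1 / |x|^(n+1)\<close> returns \<open>0\<close> instead of the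
  infinite value of the mixture.
\<close>

lemma AE_lborel_fun_nonzero:
  assumes "n \<ge> 1"
  shows "AE x in lborel_fun n. sqsum n x > 0"
proof -
  interpret product_sigma_finite "\<lambda>i::nat. lborel :: real measure"
    by (rule product_sigma_finite_lborel)
  have "emeasure (lborel_fun n) (\<Pi>\<^sub>E i\<in>{..<n}. {0}) = (\<Prod>i<n. emeasure lborel {0::real})"
    by (subst emeasure_PiM) auto
  also have "\<dots> = 0" using assms by simp
  finally have null: "(\<Pi>\<^sub>E i\<in>{..<n}. {0::real}) \<in> null_sets (lborel_fun n)"
    by (intro null_setsI sets_PiM_I_finite) auto
  have "{x \<in> space (lborel_fun n). \<not> 0 < sqsum n x} \<subseteq> (\<Pi>\<^sub>E i\<in>{..<n}. {0})"
  proof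
    fix x assume "x \<in> {x \<in> space (lborel_fun n). \<not> 0 < sqsum n x}"
    then have x: "x \<in> space (lborel_fun n)" "\<not> 0 < sqsum n x" by auto
    then have "sqsum n x = 0" by (meson dual_order.order_iff_strict sum_nonneg zero_le_power2)
    then have "\<forall>i<n. x i = 0" by (subst (asm) sum_nonneg_eq_0_iff) auto
    with x show "x \<in> (\<Pi>\<^sub>E i\<in>{..<n}. {0})"
      by (auto simp: space_PiM PiE_def extensional_def)
  qed
  then show ?thesis by (rule AE_I'[OF null])
qed

text \<open>
  Density on the rates \<open>r > 0\<close> that represents \<open>|x|^(-(n+1))\<close> as a mixture of the functions
  \<open>exp (- r |x|\<^sup>2)\<close>.
\<close>

definition mix_density :: "nat \<Rightarrow> real \<Rightarrow> real" where
  "mix_density n r = indicator {0<..} r * (r powr ((real n - 1) / 2) / Gamma ((real n + 1) / 2))"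

lemma mix_density_nonneg: "mix_density n r \<ge> 0"
  by (auto simp: mix_density_def indicator_def intro!: divide_nonneg_pos Gamma_real_pos)

lemma mix_density_measurable [measurable]: "mix_density n \<in> borel_measurable borel"
  unfolding mix_density_def by measurable

lemma inverse_norm_power_mixture:
  fixes x :: real
  assumes "x > 0"
  shows "ennreal (1 / sqrt x ^ (n + 1)) = (\<integral>\<^sup>+r. ennreal (mix_density n r * exp (- (r * x))) \<partial>lborel)"
proof -
  have pos: "Gamma ((real n + 1) / 2) > 0" by (intro Gamma_real_pos) auto
  then have nz: "Gamma ((real n + 1) / 2) \<noteq> 0" by linarith
  have "(\<integral>\<^sup>+r. ennreal (mix_density n r * exp (- (r * x))) \<partial>lborel) =
     (\<integral>\<^sup>+r. ennreal (1 / Gamma ((real n + 1) / 2)) *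
        ennreal (indicator {0<..} r * (r powr ((real n + 1) / 2 - 1) * exp (- (x * r)))) \<partial>lborel)"
    using pos by (intro nn_integral_cong)
      (auto simp: mix_density_def indicator_def mult_ac diff_divide_distrib add_divide_distrib
         simp flip: ennreal_mult')
  also have "\<dots> = ennreal (1 / Gamma ((real n + 1) / 2)) * ennreal (Gamma ((real n + 1) / 2) * x powr (- ((real n + 1) / 2)))"
    using assms by (subst nn_integral_cmult, measurable) (subst nn_integral_Gamma_rate, simp_all)
  also have "\<dots> = ennreal (x powr (- ((real n + 1) / 2)))"
    using nz by (simp flip: ennreal_mult')
  also have "x powr (- ((real n + 1) / 2)) = 1 / sqrt x ^ (n + 1)"
    using assms powr_half_nat[of x "n + 1"] by (simp add: powr_minus_divide add_ac)
  finally show ?thesis by simp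
qed

text \<open>
  The purpose of the mixture: a singular radial weight is traded for Gaussian weights, against
  which integrals factorise over the coordinates.
\<close>

lemma nn_integral_norm_weight:
  fixes h :: "(nat \<Rightarrow> real) \<Rightarrow> real"
  assumes n: "n \<ge> 1" and [measurable]: "h \<in> borel_measurable (lborel_fun n)"
    and h: "\<And>x. h x \<ge> 0"
  shows "(\<integral>\<^sup>+x. ennreal (h x / sqrt (sqsum n x) ^ (n + 1)) \<partial>lborel_fun n) =
    (\<integral>\<^sup>+r. ennreal (mix_density n r) * (\<integral>\<^sup>+x. ennreal (h x * exp (- (r * sqsum n x))) \<partial>lborel_fun n) \<partial>lborel)"
proof -
  interpret pair_sigma_finite "lborel_fun n" "lborel :: real measure"
    by (intro pair_sigma_finite.intro sigma_finite_lborel_fun lborel.sigma_finite_measure_axioms)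
  have "(\<integral>\<^sup>+x. ennreal (h x / sqrt (sqsum n x) ^ (n + 1)) \<partial>lborel_fun n) =
     (\<integral>\<^sup>+x. \<integral>\<^sup>+r. ennreal (h x) * ennreal (mix_density n r * exp (- (r * sqsum n x))) \<partial>lborel \<partial>lborel_fun n)"
  proof (rule nn_integral_cong_AE, use AE_lborel_fun_nonzero[OF n] in eventually_elim)
    case (elim x)
    then have "ennreal (h x / sqrt (sqsum n x) ^ (n + 1)) = ennreal (h x) * ennreal (1 / sqrt (sqsum n x) ^ (n + 1))"
      using h by (simp flip: ennreal_mult')
    then show ?case unfolding inverse_norm_power_mixture[OF elim]
      by (subst nn_integral_cmult) auto
  qed
  also have "\<dots> = (\<integral>\<^sup>+r. \<integral>\<^sup>+x. ennreal (h x) * ennreal (mix_density n r * exp (- (r * sqsum n x))) \<partial>lborel_fun n \<partial>lborel)"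
    by (rule Fubini'[symmetric]) measurable
  also have "\<dots> = (\<integral>\<^sup>+r. \<integral>\<^sup>+x. ennreal (mix_density n r) * ennreal (h x * exp (- (r * sqsum n x))) \<partial>lborel_fun n \<partial>lborel)"
    using h mix_density_nonneg by (simp add: mult_ac flip: ennreal_mult')
  also have "\<dots> = (\<integral>\<^sup>+r. ennreal (mix_density n r) * (\<integral>\<^sup>+x. ennreal (h x * exp (- (r * sqsum n x))) \<partial>lborel_fun n) \<partial>lborel)"
    by (intro nn_integral_cong nn_integral_cmult) auto
  finally show ?thesis .
qed

text \<open>
  Under a Gaussian weight with rate \<open>a\<close>, the mean of \<open>(1 - exp (- \<langle>w, x\<rangle>))\<^sup>2\<close> is \<open>phi (|w|\<^sup>2 / a)\<close>.
\<close>

definition phi :: "real \<Rightarrow> real" where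
  "phi x = exp x - 2 * exp (x / 4) + 1"

lemma phi_measurable [measurable]: "phi \<in> borel_measurable borel"
  unfolding phi_def by measurable

text \<open>
  With \<open>y = exp (x / 4)\<close>, the polynomial \<open>y\<^sup>4 - 2 y + 1\<close> has the factor \<open>y - 1 \<ge> x / 4\<close>, and the
  cofactor is at least \<open>2\<close> for \<open>y \<ge> 1\<close>.
\<close>

lemma phi_lower: assumes "x \<ge> 0" shows "phi x \<ge> x / 2"
proof -
  define y where "y = exp (x / 4)"
  have y: "y \<ge> 1 + x / 4" unfolding y_def by simp
  then have y1: "y \<ge> 1" using assms by simp
  have "exp x = y ^ 4" unfolding y_def by (simp flip: exp_of_nat_mult)
  then have "phi x = (y - 1) * (y ^ 3 + y ^ 2 + y - 1)"
    unfolding phi_def y_def[symmetric] by (simp add: algebra_simps power_numeral_reduce)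
  also have "\<dots> \<ge> (y - 1) * 2"
    using y1 one_le_power[OF y1, of 3] one_le_power[OF y1, of 2] by (intro mult_left_mono) linarith+
  finally have "(y - 1) * 2 \<le> phi x" .
  moreover have "x / 2 \<le> (y - 1) * 2" using y by simp
  ultimately show ?thesis by linarith
qed

lemma phi_nonneg: "x \<ge> 0 \<Longrightarrow> phi x \<ge> 0"
  using phi_lower[of x] by linarith

lemma phi_upper: assumes "x \<ge> 0" shows "phi x \<le> x / 2 + x\<^sup>2 / 2 * exp x"
proof -
  have "exp x \<le> 1 + x + x\<^sup>2 / 2 * exp x"
  proof (cases "x = 0")
    case False
    with assms have "x > 0" by simp
    obtain t where t: "\<bar>t\<bar> \<le> \<bar>x\<bar>" "exp x = (\<Sum>m<2. x ^ m / fact m) + exp t / fact 2 * x ^ 2"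
      using Maclaurin_exp_le[of x 2] by blast
    have "exp t / fact 2 * x ^ 2 \<le> exp x / 2 * x ^ 2"
      using t(1) \<open>x > 0\<close> by (intro mult_right_mono) (auto simp: fact_numeral)
    with t(2) show ?thesis by (simp add: numeral_2_eq_2 mult_ac)
  qed simp
  moreover have "exp (x / 4) \<ge> 1 + x / 4" by simp
  ultimately show ?thesis unfolding phi_def by linarith
qed

text \<open>
  Expanding the square gives three Gaussian integrals with linear exponents \<open>0\<close>, \<open>- w\<close> and \<open>- 2 w\<close>.
\<close>

lemma nn_integral_gaussian_square:
  assumes "a > 0"
  shows "(\<integral>\<^sup>+x. ennreal ((1 - exp (- (\<Sum>i<n. w i * x i)))\<^sup>2 * exp (- (a * sqsum n x))) \<partial>lborel_fun n)
     = ennreal ((pi / a) powr (real n / 2) * phi (sqsum n w / a))"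
proof -
  have "has_bochner_integral (lborel_fun n) (\<lambda>x. exp (- (a * sqsum n x) + (\<Sum>i<n. 0 * x i))
       - 2 * exp (- (a * sqsum n x) + (\<Sum>i<n. (- w i) * x i))
       + exp (- (a * sqsum n x) + (\<Sum>i<n. (- 2 * w i) * x i)))
     ((pi / a) powr (real n / 2) * exp (sqsum n (\<lambda>_. 0) / (4 * a))
      - 2 * ((pi / a) powr (real n / 2) * exp (sqsum n (\<lambda>i. - w i) / (4 * a)))
      + (pi / a) powr (real n / 2) * exp (sqsum n (\<lambda>i. - 2 * w i) / (4 * a)))"
    using assms by (intro has_bochner_integral_add has_bochner_integral_diff
        has_bochner_integral_mult_right gaussian_integral_linear_lborel_fun)
  moreover have "exp (- (a * sqsum n x) + (\<Sum>i<n. 0 * x i))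
       - 2 * exp (- (a * sqsum n x) + (\<Sum>i<n. (- w i) * x i))
       + exp (- (a * sqsum n x) + (\<Sum>i<n. (- 2 * w i) * x i)) =
      (1 - exp (- (\<Sum>i<n. w i * x i)))\<^sup>2 * exp (- (a * sqsum n x))" for x
  proof -
    have "(\<Sum>i<n. (- 2 * w i) * x i) = - (\<Sum>i<n. w i * x i) + - (\<Sum>i<n. w i * x i)"
      by (simp add: sum_negf sum_distrib_left mult.assoc)
    moreover have "(\<Sum>i<n. (- w i) * x i) = - (\<Sum>i<n. w i * x i)" by (simp add: sum_negf)
    ultimately show ?thesis
      by (simp only: exp_add) (simp add: power2_eq_square algebra_simps)
  qed
  moreover have "(pi / a) powr (real n / 2) * exp (sqsum n (\<lambda>_. 0) / (4 * a))
      - 2 * ((pi / a) powr (real n / 2) * exp (sqsum n (\<lambda>i. - w i) / (4 * a)))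
      + (pi / a) powr (real n / 2) * exp (sqsum n (\<lambda>i. - 2 * w i) / (4 * a)) =
     (pi / a) powr (real n / 2) * phi (sqsum n w / a)"
    by (simp add: phi_def power_mult_distrib sum_distrib_left[symmetric] algebra_simps)
  ultimately have "has_bochner_integral (lborel_fun n) (\<lambda>x. (1 - exp (- (\<Sum>i<n. w i * x i)))\<^sup>2 * exp (- (a * sqsum n x)))
     ((pi / a) powr (real n / 2) * phi (sqsum n w / a))" by simp
  then show ?thesis
    by (subst nn_integral_eq_integral) (auto simp: has_bochner_integral_iff)
qed

text \<open>
  The weight left on \<open>r\<close> once the Gaussian with rate \<open>1 + r\<close> has been integrated out, stripped of
  the constant \<open>dcov_const n / sqrt pi\<close>. In the variable \<open>1 / (1 + r)\<close> it is an unnormalised,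
  improper Beta density; one factor \<open>1 / (1 + r)\<close> makes it integrable.
\<close>

definition beta_weight :: "nat \<Rightarrow> real \<Rightarrow> real" where
  "beta_weight n r = indicator {0<..} r * (r powr ((real n - 1) / 2) * (1 + r) powr (- (real n / 2)))"

lemma beta_weight_nonneg: "beta_weight n r \<ge> 0"
  by (simp add: beta_weight_def)

lemma beta_weight_measurable [measurable]: "beta_weight n \<in> borel_measurable borel"
  unfolding beta_weight_def by measurable

lemma dcov_const_pos: "dcov_const n > 0"
  unfolding dcov_const_def by (intro divide_pos_pos Gamma_real_pos) auto

lemma mix_density_gaussian:
  assumes "r > 0"
  shows "mix_density n r * (pi / (1 + r)) powr (real n / 2) = dcov_const n / sqrt pi * beta_weight n r"
proof -
  have "pi powr ((real n + 1) / 2) = pi powr (real n / 2) * sqrt pi"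
    by (simp add: add_divide_distrib powr_add powr_half_sqrt)
  then show ?thesis using assms
    by (simp add: mix_density_def beta_weight_def dcov_const_def powr_divide powr_minus_divide)
qed

lemma nn_integral_weighted_square:
  assumes "n \<ge> 1"
  shows "(\<integral>\<^sup>+x. ennreal ((1 - exp (- (\<Sum>i<n. w i * x i)))\<^sup>2 * exp (- sqsum n x)
             / sqrt (sqsum n x) ^ (n + 1)) \<partial>lborel_fun n)
     = (\<integral>\<^sup>+r. ennreal (dcov_const n / sqrt pi * beta_weight n r * phi (sqsum n w / (1 + r))) \<partial>lborel)"
proof -
  have "(\<integral>\<^sup>+x. ennreal ((1 - exp (- (\<Sum>i<n. w i * x i)))\<^sup>2 * exp (- sqsum n x)
             / sqrt (sqsum n x) ^ (n + 1)) \<partial>lborel_fun n) =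
     (\<integral>\<^sup>+r. ennreal (mix_density n r) * (\<integral>\<^sup>+x. ennreal ((1 - exp (- (\<Sum>i<n. w i * x i)))\<^sup>2 * exp (- sqsum n x)
          * exp (- (r * sqsum n x))) \<partial>lborel_fun n) \<partial>lborel)"
    by (rule nn_integral_norm_weight[OF assms]) auto
  also have "\<dots> = (\<integral>\<^sup>+r. ennreal (dcov_const n / sqrt pi * beta_weight n r * phi (sqsum n w / (1 + r))) \<partial>lborel)"
  proof (rule nn_integral_cong)
    fix r :: real
    show "ennreal (mix_density n r) * (\<integral>\<^sup>+x. ennreal ((1 - exp (- (\<Sum>i<n. w i * x i)))\<^sup>2 * exp (- sqsum n x)
          * exp (- (r * sqsum n x))) \<partial>lborel_fun n) =
       ennreal (dcov_const n / sqrt pi * beta_weight n r * phi (sqsum n w / (1 + r)))"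
    proof (cases "r > 0")
      case True
      have "exp (- sqsum n x) * exp (- (r * sqsum n x)) = exp (- ((1 + r) * sqsum n x))" for x
        by (simp add: exp_add[symmetric] algebra_simps)
      then have "(\<integral>\<^sup>+x. ennreal ((1 - exp (- (\<Sum>i<n. w i * x i)))\<^sup>2 * exp (- sqsum n x)
          * exp (- (r * sqsum n x))) \<partial>lborel_fun n) = ennreal ((pi / (1 + r)) powr (real n / 2) * phi (sqsum n w / (1 + r)))"
        using True by (simp add: mult.assoc nn_integral_gaussian_square)
      moreover have "mix_density n r * ((pi / (1 + r)) powr (real n / 2) * phi (sqsum n w / (1 + r))) =
          dcov_const n / sqrt pi * beta_weight n r * phi (sqsum n w / (1 + r))"
        by (simp only: mix_density_gaussian[OF True] mult.assoc[symmetric])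
      ultimately show ?thesis
        using mix_density_nonneg[of n r] by (simp only: ennreal_mult'[symmetric])
    qed (simp add: mix_density_def beta_weight_def)
  qed
  finally show ?thesis .
qed

section \<open>Distance covariance integrals of standardised Gaussian vectors\<close>

text \<open>
  Vectors are coordinate functions here because integrals over them are taken with respect to
  product measures.
\<close>

definition linapp :: "nat \<Rightarrow> (nat \<Rightarrow> nat \<Rightarrow> real) \<Rightarrow> (nat \<Rightarrow> real) \<Rightarrow> nat \<Rightarrow> real" where
  "linapp q L t = (\<lambda>i. \<Sum>j<q. L i j * t j)"

lemma linapp_measurable [measurable]: "(\<lambda>t. linapp q L t i) \<in> borel_measurable (lborel_fun q)"
  unfolding linapp_def by measurable

definition dcov_kernel :: "nat \<Rightarrow> nat \<Rightarrow> (nat \<Rightarrow> nat \<Rightarrow> real) \<Rightarrow> (nat \<Rightarrow> real) \<Rightarrow> (nat \<Rightarrow> real) \<Rightarrow> real" where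
  "dcov_kernel p q L s t = exp (- sqsum p s - sqsum q t) *
      (1 - exp (- (\<Sum>i<p. linapp q L t i * s i)))\<^sup>2 /
      (sqrt (sqsum p s) ^ (p + 1) * sqrt (sqsum q t) ^ (q + 1))"

text \<open>
  The squared distance covariance, up to the factor \<open>1 / (dcov_const p * dcov_const q)\<close>, of
  Gaussian vectors with identity covariance matrices and cross-covariance matrix \<open>L\<close>.
\<close>

definition gauss_dcov :: "nat \<Rightarrow> nat \<Rightarrow> (nat \<Rightarrow> nat \<Rightarrow> real) \<Rightarrow> ennreal" where
  "gauss_dcov p q L = (\<integral>\<^sup>+t. \<integral>\<^sup>+s. ennreal (dcov_kernel p q L s t) \<partial>lborel_fun p \<partial>lborel_fun q)"

text \<open>
  The \<open>t\<close>-integral that remains after the \<open>s\<close>-integral has been evaluated, at \<open>b = 1 / (1 + r)\<close>.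
\<close>

definition radial_phi :: "nat \<Rightarrow> nat \<Rightarrow> (nat \<Rightarrow> nat \<Rightarrow> real) \<Rightarrow> real \<Rightarrow> ennreal" where
  "radial_phi p q L b = (\<integral>\<^sup>+t. ennreal (phi (b * sqsum p (linapp q L t)) * exp (- sqsum q t)
      / sqrt (sqsum q t) ^ (q + 1)) \<partial>lborel_fun q)"

lemma gauss_dcov_eq:
  assumes "p \<ge> 1"
  shows "gauss_dcov p q L = (\<integral>\<^sup>+r. ennreal (dcov_const p / sqrt pi * beta_weight p r)
           * radial_phi p q L (1 / (1 + r)) \<partial>lborel)"
proof -
  interpret pair_sigma_finite "lborel_fun q" "lborel :: real measure"
    by (intro pair_sigma_finite.intro sigma_finite_lborel_fun lborel.sigma_finite_measure_axioms)
  let ?c = "\<lambda>r. dcov_const p / sqrt pi * beta_weight p r"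
  let ?W = "\<lambda>t. exp (- sqsum q t) / sqrt (sqsum q t) ^ (q + 1)"
  have c0: "?c r \<ge> 0" for r using dcov_const_pos[of p] beta_weight_nonneg by simp
  have W0: "?W t \<ge> 0" for t by (simp add: sum_nonneg)
  have "gauss_dcov p q L = (\<integral>\<^sup>+t. \<integral>\<^sup>+r. ennreal (?W t) *
      ennreal (?c r * phi (sqsum p (linapp q L t) / (1 + r))) \<partial>lborel \<partial>lborel_fun q)"
    unfolding gauss_dcov_def
  proof (rule nn_integral_cong)
    fix t
    let ?h = "\<lambda>s. (1 - exp (- (\<Sum>i<p. linapp q L t i * s i)))\<^sup>2 * exp (- sqsum p s) / sqrt (sqsum p s) ^ (p + 1)"
    have "(\<integral>\<^sup>+s. ennreal (dcov_kernel p q L s t) \<partial>lborel_fun p) =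
      (\<integral>\<^sup>+s. ennreal (?W t) * ennreal (?h s) \<partial>lborel_fun p)"
      using W0[of t] by (intro nn_integral_cong)
        (simp add: dcov_kernel_def exp_diff exp_minus divide_inverse mult_ac flip: ennreal_mult')
    also have "\<dots> = ennreal (?W t) * (\<integral>\<^sup>+s. ennreal (?h s) \<partial>lborel_fun p)"
      by (rule nn_integral_cmult) measurable
    also have "\<dots> = ennreal (?W t) * (\<integral>\<^sup>+r. ennreal (?c r * phi (sqsum p (linapp q L t) / (1 + r))) \<partial>lborel)"
      by (simp only: nn_integral_weighted_square[OF assms])
    also have "\<dots> = (\<integral>\<^sup>+r. ennreal (?W t) * ennreal (?c r * phi (sqsum p (linapp q L t) / (1 + r))) \<partial>lborel)"
      by (rule nn_integral_cmult[symmetric]) measurable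
    finally show "(\<integral>\<^sup>+s. ennreal (dcov_kernel p q L s t) \<partial>lborel_fun p) =
      (\<integral>\<^sup>+r. ennreal (?W t) * ennreal (?c r * phi (sqsum p (linapp q L t) / (1 + r))) \<partial>lborel)" .
  qed
  also have "\<dots> = (\<integral>\<^sup>+r. \<integral>\<^sup>+t. ennreal (?W t) *
      ennreal (?c r * phi (sqsum p (linapp q L t) / (1 + r))) \<partial>lborel_fun q \<partial>lborel)"
    by (rule Fubini'[symmetric]) measurable
  also have "\<dots> = (\<integral>\<^sup>+r. \<integral>\<^sup>+t. ennreal (?c r) * ennreal (phi (1 / (1 + r) * sqsum p (linapp q L t)) * exp (- sqsum q t)
      / sqrt (sqsum q t) ^ (q + 1)) \<partial>lborel_fun q \<partial>lborel)"
  proof (intro nn_integral_cong)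
    fix r t
    have "?W t * (?c r * phi (sqsum p (linapp q L t) / (1 + r))) =
       ?c r * (phi (1 / (1 + r) * sqsum p (linapp q L t)) * exp (- sqsum q t) / sqrt (sqsum q t) ^ (q + 1))"
      by (simp add: mult_ac)
    then show "ennreal (?W t) * ennreal (?c r * phi (sqsum p (linapp q L t) / (1 + r))) =
       ennreal (?c r) * ennreal (phi (1 / (1 + r) * sqsum p (linapp q L t)) * exp (- sqsum q t)
      / sqrt (sqsum q t) ^ (q + 1))"
      by (simp only: ennreal_mult'[OF W0, symmetric] ennreal_mult'[OF c0, symmetric])
  qed
  also have "\<dots> = (\<integral>\<^sup>+r. ennreal (?c r) * radial_phi p q L (1 / (1 + r)) \<partial>lborel)"
    unfolding radial_phi_def by (intro nn_integral_cong nn_integral_cmult) measurable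
  finally show ?thesis .
qed

text \<open>
  The value of \<open>\<integral> t\<^sub>1\<^sup>2 exp (- |t|\<^sup>2) / |t|^(q+1) dt\<close> on \<open>q\<close>-dimensional space.
\<close>

definition quad_const :: "nat \<Rightarrow> real" where
  "quad_const q = dcov_const q / (2 * sqrt pi) * Beta (1/2) ((real q + 1) / 2)"

lemma Beta_pos: "x > 0 \<Longrightarrow> y > 0 \<Longrightarrow> Beta x y > (0::real)"
  unfolding Beta_def by (intro divide_pos_pos mult_pos_pos Gamma_real_pos) auto

lemma quad_const_pos: "quad_const q > 0"
  unfolding quad_const_def using dcov_const_pos[of q] by (intro mult_pos_pos divide_pos_pos Beta_pos) auto

text \<open>
  The integral is linear in the trace of \<open>L\<^sup>T L\<close>; the power \<open>\<delta>^(-1/2)\<close> is dictated by scaling.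
\<close>

lemma nn_integral_quadratic_weighted:
  fixes \<delta> :: real
  assumes "q \<ge> 1" "\<delta> > 0"
  shows "(\<integral>\<^sup>+t. ennreal (sqsum p (linapp q L t) * exp (- (\<delta> * sqsum q t)) / sqrt (sqsum q t) ^ (q + 1)) \<partial>lborel_fun q)
   = ennreal ((\<Sum>i<p. sqsum q (L i)) * quad_const q * \<delta> powr (- 1/2))"
proof -
  define T where "T = (\<Sum>i<p. sqsum q (L i))"
  have T: "T \<ge> 0" unfolding T_def by (intro sum_nonneg) auto
  have gpos: "Gamma ((real q + 1) / 2) > 0" by (intro Gamma_real_pos) auto
  define C where "C = T * (dcov_const q / (2 * sqrt pi))"
  have C: "C \<ge> 0" using T dcov_const_pos[of q] by (simp add: C_def)
  have "(\<integral>\<^sup>+t. ennreal (sqsum p (linapp q L t) * exp (- (\<delta> * sqsum q t)) / sqrt (sqsum q t) ^ (q + 1)) \<partial>lborel_fun q)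
    = (\<integral>\<^sup>+r. ennreal (mix_density q r) * (\<integral>\<^sup>+t. ennreal (sqsum p (linapp q L t) * exp (- (\<delta> * sqsum q t))
         * exp (- (r * sqsum q t))) \<partial>lborel_fun q) \<partial>lborel)"
    by (rule nn_integral_norm_weight[OF assms(1)]) (auto intro!: mult_nonneg_nonneg sum_nonneg)
  also have "\<dots> = (\<integral>\<^sup>+r. ennreal C *
      ennreal (indicator {0<..} r * (r powr ((real q + 1) / 2 - 1) * (\<delta> + r) powr (- (1 / 2 + (real q + 1) / 2)))) \<partial>lborel)"
  proof (rule nn_integral_cong)
    fix r :: real
    show "ennreal (mix_density q r) * (\<integral>\<^sup>+t. ennreal (sqsum p (linapp q L t) * exp (- (\<delta> * sqsum q t))
         * exp (- (r * sqsum q t))) \<partial>lborel_fun q) = ennreal C *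
      ennreal (indicator {0<..} r * (r powr ((real q + 1) / 2 - 1) * (\<delta> + r) powr (- (1 / 2 + (real q + 1) / 2))))"
    proof (cases "r > 0")
      case True
      have "exp (- (\<delta> * sqsum q t)) * exp (- (r * sqsum q t)) = exp (- ((\<delta> + r) * sqsum q t))" for t
        by (simp add: exp_add[symmetric] algebra_simps)
      then have "(\<integral>\<^sup>+t. ennreal (sqsum p (linapp q L t) * exp (- (\<delta> * sqsum q t))
         * exp (- (r * sqsum q t))) \<partial>lborel_fun q) = ennreal (T * (1 / (2 * (\<delta> + r)) * (pi / (\<delta> + r)) powr (real q / 2)))"
        using True assms nn_integral_gaussian_quadratic[where a="\<delta> + r" and p=p and q=q and L=L]
        unfolding linapp_def T_def by (simp add: mult.assoc)
      moreover have "mix_density q r * (T * (1 / (2 * (\<delta> + r)) * (pi / (\<delta> + r)) powr (real q / 2))) =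
        C * (r powr ((real q + 1) / 2 - 1) * (\<delta> + r) powr (- (1 / 2 + (real q + 1) / 2)))"
      proof -
        have 1: "pi powr ((real q + 1) / 2) = pi powr (real q / 2) * sqrt pi"
          by (simp add: add_divide_distrib powr_add powr_half_sqrt)
        have 2: "(\<delta> + r) powr (- (1 / 2 + (real q + 1) / 2)) = 1 / ((\<delta> + r) powr (real q / 2) * (\<delta> + r))"
        proof -
          have "- (1 / 2 + (real q + 1) / 2) = - (real q / 2 + 1)" by (simp add: field_simps)
          then show ?thesis using True assms by (simp only: powr_minus_divide powr_add) simp
        qed
        have 3: "(real q + 1) / 2 - 1 = (real q - 1) / 2" by (simp add: field_simps)
        show ?thesis unfolding 2 3 C_def mix_density_def dcov_const_def 1
          using True assms gpos by (simp add: powr_divide field_simps)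
      qed
      ultimately show ?thesis
        using True mix_density_nonneg[of q r] C
        by (simp add: ennreal_mult'[symmetric])
    qed (simp add: mix_density_def)
  qed
  also have "\<dots> = ennreal C * ennreal (\<delta> powr (- (1/2)) * Beta (1/2) ((real q + 1) / 2))"
    using assms by (subst nn_integral_cmult, measurable) (subst nn_integral_beta_prime, simp_all)
  also have "\<dots> = ennreal (T * quad_const q * \<delta> powr (- 1/2))"
    using C by (simp add: C_def quad_const_def mult_ac flip: ennreal_mult')
  finally show ?thesis unfolding T_def .
qed

lemma radial_phi_lower:
  assumes "q \<ge> 1" "b \<ge> 0"
  shows "radial_phi p q L b \<ge> ennreal ((\<Sum>i<p. sqsum q (L i)) * quad_const q * (b / 2))"
proof -
  define K where "K = (\<Sum>i<p. sqsum q (L i)) * quad_const q"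
  have "ennreal (K * (b / 2)) = ennreal (b / 2) * ennreal K"
    using assms by (subst ennreal_mult'[symmetric]) (auto simp: mult.commute)
  also have "ennreal K = (\<integral>\<^sup>+t. ennreal (sqsum p (linapp q L t) * exp (- sqsum q t) / sqrt (sqsum q t) ^ (q + 1)) \<partial>lborel_fun q)"
    using nn_integral_quadratic_weighted[OF assms(1), where \<delta>=1 and p=p and L=L] by (simp add: K_def)
  also have "ennreal (b / 2) * \<dots> = (\<integral>\<^sup>+t. ennreal (b / 2) * ennreal (sqsum p (linapp q L t) * exp (- sqsum q t) / sqrt (sqsum q t) ^ (q + 1)) \<partial>lborel_fun q)"
    by (rule nn_integral_cmult[symmetric]) measurable
  also have "\<dots> \<le> radial_phi p q L b"
    unfolding radial_phi_def
  proof (rule nn_integral_mono)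
    fix t
    have "b * sqsum p (linapp q L t) / 2 \<le> phi (b * sqsum p (linapp q L t))"
      using assms by (intro phi_lower mult_nonneg_nonneg sum_nonneg) auto
    then have "(b * sqsum p (linapp q L t) / 2) * exp (- sqsum q t) / sqrt (sqsum q t) ^ (q + 1) \<le>
       phi (b * sqsum p (linapp q L t)) * exp (- sqsum q t) / sqrt (sqsum q t) ^ (q + 1)"
      by (intro divide_right_mono mult_right_mono) (auto simp: sum_nonneg)
    from ennreal_leI[OF this] show "ennreal (b / 2) * ennreal (sqsum p (linapp q L t) * exp (- sqsum q t) / sqrt (sqsum q t) ^ (q + 1)) \<le>
       ennreal (phi (b * sqsum p (linapp q L t)) * exp (- sqsum q t) / sqrt (sqsum q t) ^ (q + 1))"
      using assms by (simp add: mult_ac flip: ennreal_mult')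
  qed
  finally show ?thesis unfolding K_def .
qed

text \<open>
  Here \<open>x\<close> and \<open>y\<close> stand for \<open>|t|\<^sup>2\<close> and \<open>|L t|\<^sup>2\<close>. In the quadratic remainder of \<open>phi\<close>, one factor
  \<open>y \<le> x\<close> is absorbed by half of the decay of \<open>exp (- (1 - b) x)\<close>, at the price of \<open>2 / (1 - b)\<close>. The
  other factor \<open>y\<close> is kept, so that the bound stays proportional to the trace of \<open>L\<^sup>T L\<close>.
\<close>

lemma phi_gaussian_bound:
  assumes "0 < b" "b < 1" "0 \<le> y" "y \<le> x"
  shows "phi (b * y) * exp (- x) \<le> b / 2 * (y * exp (- x)) + b\<^sup>2 / (1 - b) * (y * exp (- ((1 - b) / 2 * x)))"
proof -
  have "phi (b * y) * exp (- x) \<le> (b * y / 2 + (b * y)\<^sup>2 / 2 * exp (b * y)) * exp (- x)"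
    using assms by (intro mult_right_mono phi_upper) auto
  also have "\<dots> = b / 2 * (y * exp (- x)) + b\<^sup>2 / 2 * y * (y * exp (b * y - x))"
  proof -
    have e: "exp (b * y - x) = exp (b * y) * exp (- x)" by (simp add: exp_diff exp_minus divide_inverse)
    show ?thesis unfolding e by (simp add: algebra_simps power2_eq_square)
  qed
  also have "y * exp (b * y - x) \<le> 2 / (1 - b) * exp (- ((1 - b) / 2 * x))"
  proof -
    have "(1 - b) / 2 * x \<le> exp ((1 - b) / 2 * x)"
      using exp_ge_add_one_self[of "(1 - b) / 2 * x"] by linarith
    then have m: "x \<le> 2 / (1 - b) * exp ((1 - b) / 2 * x)"
      using assms by (simp add: field_simps)
    have "y * exp (b * y - x) \<le> x * exp (b * x - x)"
      using assms by (intro mult_mono) auto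
    also have "\<dots> \<le> 2 / (1 - b) * exp ((1 - b) / 2 * x) * exp (b * x - x)"
      by (rule mult_right_mono[OF m]) simp
    also have "\<dots> = 2 / (1 - b) * exp (- ((1 - b) / 2 * x))"
      by (simp add: mult.assoc exp_add[symmetric] field_simps)
    finally show ?thesis .
  qed
  also have "b\<^sup>2 / 2 * y * (2 / (1 - b) * exp (- ((1 - b) / 2 * x))) = b\<^sup>2 / (1 - b) * (y * exp (- ((1 - b) / 2 * x)))"
    by simp
  finally show ?thesis using assms by (simp add: mult_left_mono)
qed

lemma radial_phi_upper:
  assumes "q \<ge> 1" "0 < b" "b < 1" and contr: "\<And>t. sqsum p (linapp q L t) \<le> sqsum q t"
  shows "radial_phi p q L b \<le> ennreal ((\<Sum>i<p. sqsum q (L i)) * quad_const q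
           * (b / 2 + sqrt 2 * b\<^sup>2 * (1 - b) powr (- 3/2)))"
proof -
  define K where "K = (\<Sum>i<p. sqsum q (L i)) * quad_const q"
  have K: "K \<ge> 0" unfolding K_def
    by (intro mult_nonneg_nonneg sum_nonneg less_imp_le[OF quad_const_pos]) auto
  let ?g = "\<lambda>\<delta> t. sqsum p (linapp q L t) * exp (- (\<delta> * sqsum q t)) / sqrt (sqsum q t) ^ (q + 1)"
  have "radial_phi p q L b \<le> (\<integral>\<^sup>+t. ennreal (b / 2) * ennreal (?g 1 t) +
      ennreal (b\<^sup>2 / (1 - b)) * ennreal (?g ((1 - b) / 2) t) \<partial>lborel_fun q)"
    unfolding radial_phi_def
  proof (rule nn_integral_mono)
    fix t
    let ?y = "sqsum p (linapp q L t)" and ?x = "sqsum q t"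
    have "phi (b * ?y) * exp (- ?x) / sqrt ?x ^ (q + 1) \<le>
      (b / 2 * (?y * exp (- ?x)) + b\<^sup>2 / (1 - b) * (?y * exp (- ((1 - b) / 2 * ?x)))) / sqrt ?x ^ (q + 1)"
      using assms by (intro divide_right_mono phi_gaussian_bound) (auto simp: sum_nonneg)
    also have "\<dots> = b / 2 * ?g 1 t + b\<^sup>2 / (1 - b) * ?g ((1 - b) / 2) t"
      by (simp add: add_divide_distrib)
    finally have "ennreal (phi (b * ?y) * exp (- ?x) / sqrt ?x ^ (q + 1)) \<le> ennreal (b / 2 * ?g 1 t + b\<^sup>2 / (1 - b) * ?g ((1 - b) / 2) t)"
      by (rule ennreal_leI)
    also have "\<dots> = ennreal (b / 2 * ?g 1 t) + ennreal (b\<^sup>2 / (1 - b) * ?g ((1 - b) / 2) t)"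
      using assms by (intro ennreal_plus mult_nonneg_nonneg divide_nonneg_nonneg) (auto simp: sum_nonneg)
    also have "\<dots> = ennreal (b / 2) * ennreal (?g 1 t) + ennreal (b\<^sup>2 / (1 - b)) * ennreal (?g ((1 - b) / 2) t)"
      using assms by (subst (1 2) ennreal_mult') auto
    finally show "ennreal (phi (b * ?y) * exp (- ?x) / sqrt ?x ^ (q + 1)) \<le> 
       ennreal (b / 2) * ennreal (?g 1 t) + ennreal (b\<^sup>2 / (1 - b)) * ennreal (?g ((1 - b) / 2) t)" .
  qed
  also have "\<dots> = ennreal (b / 2) * (\<integral>\<^sup>+t. ennreal (?g 1 t) \<partial>lborel_fun q) +
      ennreal (b\<^sup>2 / (1 - b)) * (\<integral>\<^sup>+t. ennreal (?g ((1 - b) / 2) t) \<partial>lborel_fun q)"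
    by (subst nn_integral_add, measurable) (subst (1 2) nn_integral_cmult, simp_all)
  also have "\<dots> = ennreal (b / 2) * ennreal (K * 1 powr (- 1 / 2)) +
      ennreal (b\<^sup>2 / (1 - b)) * ennreal (K * ((1 - b) / 2) powr (- 1 / 2))"
    using assms by (subst (1 2) nn_integral_quadratic_weighted) (simp_all add: K_def)
  also have "\<dots> = ennreal (b / 2 * K + b\<^sup>2 / (1 - b) * (K * ((1 - b) / 2) powr (- 1 / 2)))"
    using assms K by (simp only: ennreal_mult'[symmetric] ennreal_plus[symmetric]
        divide_nonneg_nonneg mult_nonneg_nonneg powr_ge_zero zero_le_power2) simp
  also have "b / 2 * K + b\<^sup>2 / (1 - b) * (K * ((1 - b) / 2) powr (- 1 / 2)) =
     K * (b / 2 + sqrt 2 * b\<^sup>2 * (1 - b) powr (- 3/2))"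
  proof -
    have "(1 - b) powr (- 3/2) = (1 - b) powr (- 1/2 + (- 1))" by simp
    also have "\<dots> = (1 - b) powr (- 1/2) / (1 - b)"
      using assms by (subst powr_add) (simp add: powr_minus_divide)
    finally have 1: "(1 - b) powr (- 3/2) = (1 - b) powr (- 1/2) / (1 - b)" .
    have 2: "((1 - b) / 2) powr (- 1 / 2) = sqrt 2 * (1 - b) powr (- 1/2)"
      using assms by (simp add: powr_divide powr_minus_divide powr_half_sqrt)
    show ?thesis unfolding 1 2 by (simp add: algebra_simps)
  qed
  finally show ?thesis unfolding K_def .
qed

section \<open>Gamma ratios and the hypergeometric series at one\<close>

definition gamma_ratio :: "real \<Rightarrow> real" where
  "gamma_ratio x = Gamma (x + 1/2) / Gamma x"

lemma Gamma_plus1_pos: "x > 0 \<Longrightarrow> Gamma (x + 1) = x * Gamma (x::real)"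
  by (intro Gamma_plus1) (auto elim!: nonpos_Ints_cases)

lemma Gamma_midpoint_le:
  fixes x :: real
  assumes "x > 0"
  shows "Gamma (x + 1/2) ^ 2 \<le> Gamma x * Gamma (x + 1)"
proof -
  have pos: "Gamma x > 0" "Gamma (x + 1) > 0" "Gamma (x + 1/2) > 0"
    using assms by (auto intro!: Gamma_real_pos)
  have "(ln \<circ> Gamma) ((1 - 1/2) *\<^sub>R x + (1/2) *\<^sub>R (x + 1)) \<le> (1 - 1/2) * (ln \<circ> Gamma) x + (1/2) * (ln \<circ> Gamma) (x + 1)"
    using assms by (intro convex_onD[OF log_convex_Gamma_real]) auto
  moreover have "(1 - 1/2) *\<^sub>R x + (1/2) *\<^sub>R (x + 1) = x + 1/2" by (simp add: field_simps)
  ultimately have "ln (Gamma (x + 1/2) ^ 2) \<le> ln (Gamma x * Gamma (x + 1))"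
    using pos by (simp add: ln_mult ln_realpow)
  then show ?thesis using pos by simp
qed

text \<open>
  Logarithmic convexity of the Gamma function at the midpoints of \<open>[x, x + 1]\<close> and
  \<open>[x - 1/2, x + 1/2]\<close>, combined with the functional equation.
\<close>

lemma gamma_ratio_bounds:
  assumes "x > 1/2"
  shows "x - 1/2 \<le> gamma_ratio x ^ 2" "gamma_ratio x ^ 2 \<le> x"
proof -
  have pos: "Gamma x > 0" "Gamma (x + 1/2) > 0" "Gamma (x - 1/2) > 0"
    using assms by (auto intro!: Gamma_real_pos)
  have g1: "Gamma (x + 1) = x * Gamma x"
    using assms by (intro Gamma_plus1_pos) auto
  have "Gamma (x - 1/2 + 1) = (x - 1/2) * Gamma (x - 1/2)"
    using assms by (intro Gamma_plus1_pos) auto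
  then have g2: "Gamma (x + 1/2) = (x - 1/2) * Gamma (x - 1/2)" by (simp add: field_simps)
  have "Gamma (x + 1/2) ^ 2 \<le> x * (Gamma x) ^ 2"
    using Gamma_midpoint_le[of x] assms g1 by (simp add: power2_eq_square mult_ac)
  then show "gamma_ratio x ^ 2 \<le> x"
    using pos by (simp add: gamma_ratio_def power_divide divide_le_eq)
  have "Gamma x ^ 2 \<le> Gamma (x - 1/2) * Gamma (x + 1/2)"
    using Gamma_midpoint_le[of "x - 1/2"] assms by (simp add: field_simps)
  then have "(x - 1/2) * Gamma x ^ 2 \<le> Gamma (x + 1/2) ^ 2"
    using assms mult_left_mono[of _ _ "x - 1/2"] by (fastforce simp: power2_eq_square g2 mult_ac)
  then show "x - 1/2 \<le> gamma_ratio x ^ 2"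
    using pos by (simp add: gamma_ratio_def power_divide le_divide_eq)
qed

lemma gamma_ratio_asymp: "((\<lambda>x. gamma_ratio x ^ 2 / x) \<longlongrightarrow> 1) at_top"
proof (rule real_tendsto_sandwich)
  show "\<forall>\<^sub>F x in at_top. (x - 1/2) / x \<le> gamma_ratio x ^ 2 / x"
    using eventually_gt_at_top[of "1::real"]
    by eventually_elim (intro divide_right_mono gamma_ratio_bounds, auto)
  show "\<forall>\<^sub>F x in at_top. gamma_ratio x ^ 2 / x \<le> 1"
    using eventually_gt_at_top[of "1::real"]
    by eventually_elim (use gamma_ratio_bounds(2) in \<open>auto simp: divide_le_eq\<close>)
  show "((\<lambda>x::real. (x - 1/2) / x) \<longlongrightarrow> 1) at_top" by real_asymp
qed simp

text \<open>
  Coefficients of the hypergeometric series with parameters \<open>- 1/2, - 1/2; c\<close>.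
\<close>

definition dcov_coeff :: "real \<Rightarrow> nat \<Rightarrow> real" where
  "dcov_coeff c k = (pochhammer (- 1/2) k)\<^sup>2 / (fact k * pochhammer c k)"

lemma dcov_coeff_0 [simp]: "dcov_coeff c 0 = 1"
  by (simp add: dcov_coeff_def)

lemma dcov_coeff_nonneg: "c > 0 \<Longrightarrow> dcov_coeff c k \<ge> 0"
  unfolding dcov_coeff_def by (intro divide_nonneg_pos mult_pos_pos pochhammer_pos) auto

lemma pochhammer_half_bound: "k \<ge> 1 \<Longrightarrow> \<bar>pochhammer (- 1/2 :: real) k\<bar> \<le> fact (k - 1) / 2"
proof (induction k rule: dec_induct)
  case (step k)
  have "\<bar>pochhammer (- 1/2 :: real) (Suc k)\<bar> = \<bar>pochhammer (- 1/2 :: real) k\<bar> * \<bar>- 1/2 + real k\<bar>"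
    by (simp add: pochhammer_Suc abs_mult)
  also have "\<dots> \<le> fact (k - 1) / 2 * real k"
    using step by (intro mult_mono) auto
  also have "\<dots> = fact k / 2" using step.hyps by (cases k) auto
  finally show ?case by simp
qed simp

lemma pochhammer_lower_bound:
  fixes c :: real
  assumes "c \<ge> 1" "k \<ge> 2"
  shows "pochhammer c k \<ge> c\<^sup>2 * fact k / 2"
  using assms(2)
proof (induction k rule: dec_induct)
  case base
  then show ?case using assms by (simp add: pochhammer_Suc numeral_2_eq_2 power2_eq_square algebra_simps)
next
  case (step k)
  have "c\<^sup>2 * fact (Suc k) / 2 = (c\<^sup>2 * fact k / 2) * (1 + real k)" by simp
  also have "\<dots> \<le> pochhammer c k * (c + real k)"
    using step assms by (intro mult_mono) (auto simp: pochhammer_nonneg)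
  finally show ?case by (simp add: pochhammer_Suc)
qed

text \<open>
  Quadratic decay in \<open>c\<close>, uniformly summable over \<open>k \<ge> 2\<close>: only the terms with \<open>k < 2\<close> matter for
  large \<open>c\<close>.
\<close>

lemma dcov_coeff_bound:
  assumes "c \<ge> 1" "k \<ge> 2"
  shows "dcov_coeff c k \<le> (1 / (2 * c\<^sup>2)) * (1 / real k ^ 2)"
proof -
  have p: "pochhammer c k > 0" using assms by (intro pochhammer_pos) auto
  have "(pochhammer (- 1/2 :: real) k)\<^sup>2 = \<bar>pochhammer (- 1/2 :: real) k\<bar> ^ 2" by simp
  also have "\<dots> \<le> (fact (k - 1) / 2) ^ 2"
    using assms pochhammer_half_bound[of k] by (intro power_mono) auto
  finally have "dcov_coeff c k \<le> (fact (k - 1) / 2) ^ 2 / (fact k * (c\<^sup>2 * fact k / 2))"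
    unfolding dcov_coeff_def using assms p pochhammer_lower_bound[OF assms]
    by (intro frac_le mult_left_mono) auto
  also have "fact k = real k * fact (k - 1)" using assms by (cases k) auto
  also have "(fact (k - 1) / 2)\<^sup>2 / (real k * fact (k - 1) * (c\<^sup>2 * (real k * fact (k - 1)) / 2)) =
     (1 / (2 * c\<^sup>2)) * (1 / real k ^ 2)"
    using assms by (simp add: field_simps power2_eq_square)
  finally show ?thesis .
qed

text \<open>
  A bound that also covers \<open>c = 1/2\<close>, the parameter of dimension one.
\<close>

lemma dcov_coeff_bound_half:
  assumes "c \<ge> 1/2" "k \<ge> 1"
  shows "dcov_coeff c k \<le> (1 / 2) * (1 / real k ^ 2)"
proof -
  obtain m where k: "k = Suc m" using assms by (cases k) auto
  have pm: "pochhammer (1/2 :: real) m > 0" by (intro pochhammer_pos) auto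
  have pk: "pochhammer (1/2 :: real) k = pochhammer (1/2) m * (1/2 + real m)"
    by (simp add: k pochhammer_Suc)
  have le1: "pochhammer (1/2 :: real) k \<le> pochhammer c k"
    using assms unfolding pochhammer_prod by (intro prod_mono) auto
  have le2: "pochhammer (1/2 :: real) m \<le> fact m"
    unfolding pochhammer_fact pochhammer_prod by (intro prod_mono) auto
  have "pochhammer (- 1/2 :: real) k = (- 1/2) * pochhammer (1/2) m"
    unfolding k pochhammer_rec by simp
  then have "dcov_coeff c k \<le> (pochhammer (1/2) m / 2)\<^sup>2 / (fact k * pochhammer (1/2) k)"
    unfolding dcov_coeff_def using assms le1 pm pk
    by (intro frac_le mult_left_mono) (auto simp: power_mult_distrib power_divide)
  also have "\<dots> = pochhammer (1/2) m / (4 * fact k * (1/2 + real m))"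
  proof -
    have "(P / 2)\<^sup>2 / (F * (P * D)) = P / (4 * F * D)" if "P > 0" for P F D :: real
      using that by (simp add: power2_eq_square)
    then show ?thesis unfolding pk using pm by blast
  qed
  also have "\<dots> \<le> fact m / (4 * fact k * (1/2 + real m))"
    using le2 by (intro divide_right_mono) auto
  also have "\<dots> = 1 / (4 * real k * (real k - 1/2))"
  proof -
    have "F / (4 * (K * F) * D) = 1 / (4 * K * D)" if "F > 0" for F K D :: real
      using that by simp
    from this[of "fact m" "real k" "1/2 + real m"] show ?thesis by (simp add: k)
  qed
  also have "\<dots> \<le> 1 / (2 * real k ^ 2)"
  proof (rule frac_le)
    show "2 * real k ^ 2 \<le> 4 * real k * (real k - 1/2)"
      by (simp add: k power2_eq_square algebra_simps)
  qed (auto simp: k)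
  finally show ?thesis by simp
qed

lemma summable_inverse_squares: "summable (\<lambda>k. C * (1 / real k ^ 2))"
  using inverse_power_summable[of 2, where ?'a=real] by (intro summable_mult) (simp add: divide_inverse)

lemma summable_dcov_coeff:
  assumes "c \<ge> 1/2"
  shows "summable (dcov_coeff c)"
proof (rule summable_comparison_test_ev[OF _ summable_inverse_squares[of "1/2"]])
  show "\<forall>\<^sub>F k in sequentially. norm (dcov_coeff c k) \<le> 1 / 2 * (1 / real k ^ 2)"
    using eventually_ge_at_top[of 1]
  proof eventually_elim
    case (elim k)
    then show ?case using dcov_coeff_bound_half[of c k] dcov_coeff_nonneg[of c k] assms by simp
  qed
qed

text \<open>
  A telescoping certificate for the contiguous relation between parameters \<open>c\<close> and \<open>c + 1\<close>: the
  combination of terms on the left is a difference of consecutive values of \<open>c k\<close> times the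
  \<open>k\<close>-th coefficient.
\<close>

lemma dcov_coeff_contiguous:
  assumes "c > 0"
  shows "c * (c + 1) * dcov_coeff c k - (c + 1/2)\<^sup>2 * dcov_coeff (c + 1) k =
           c * real k * dcov_coeff c k - c * real (Suc k) * dcov_coeff c (Suc k)"
proof -
  have p: "pochhammer c k > 0" using assms by (intro pochhammer_pos)
  have "pochhammer c k * (c + real k) = c * pochhammer (c + 1) k"
    by (metis pochhammer_Suc pochhammer_rec)
  then have pc: "pochhammer (c + 1) k = pochhammer c k * (c + real k) / c"
    using assms by (simp add: field_simps)
  define t where "t = dcov_coeff c k"
  have 1: "dcov_coeff (c + 1) k = t * (c / (c + real k))"
    using assms p unfolding dcov_coeff_def t_def pc by (simp add: field_simps)
  have 2: "real (Suc k) * dcov_coeff c (Suc k) = t * ((real k - 1/2)\<^sup>2 / (c + real k))"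
  proof -
    have "c + real k > 0" using assms by simp
    then show ?thesis using assms p
      unfolding dcov_coeff_def t_def pochhammer_Suc fact_Suc by (simp add: divide_simps power2_eq_square)
  qed
  have "c + real k \<noteq> 0" using assms by simp
  moreover have "(c + 1/2)\<^sup>2 * (c / (c + real k)) = c * ((c + 1/2)\<^sup>2 / (c + real k))" by simp
  moreover have "(c + 1) - (c + 1/2)\<^sup>2 / (c + real k) = real k - (real k - 1/2)\<^sup>2 / (c + real k)"
    using \<open>c + real k \<noteq> 0\<close> by (simp add: divide_simps power2_eq_square) (simp add: algebra_simps)
  ultimately have "t * c * ((c + 1) - (c + 1/2)\<^sup>2 / (c + real k)) = t * c * (real k - (real k - 1/2)\<^sup>2 / (c + real k))"
    by simp
  then show ?thesis
    unfolding 1 mult.assoc[of c "real (Suc k)"] 2 t_def[symmetric] by (simp add: algebra_simps)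
qed

lemma suminf_dcov_coeff_rec:
  assumes "c \<ge> 1/2"
  shows "c * (c + 1) * suminf (dcov_coeff c) = (c + 1/2)\<^sup>2 * suminf (dcov_coeff (c + 1))"
proof -
  have "(\<lambda>k. c * (c + 1) * dcov_coeff c k - (c + 1/2)\<^sup>2 * dcov_coeff (c + 1) k) sums
     (c * (c + 1) * suminf (dcov_coeff c) - (c + 1/2)\<^sup>2 * suminf (dcov_coeff (c + 1)))"
    using assms by (intro sums_diff sums_mult summable_sums summable_dcov_coeff) auto
  moreover have "(\<lambda>k. c * real k * dcov_coeff c k - c * real (Suc k) * dcov_coeff c (Suc k)) sums
     (c * real 0 * dcov_coeff c 0 - 0)"
  proof (rule telescope_sums')
    show "(\<lambda>k. c * real k * dcov_coeff c k) \<longlonglongrightarrow> 0"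
    proof (rule real_tendsto_sandwich)
      show "\<forall>\<^sub>F k in sequentially. 0 \<le> c * real k * dcov_coeff c k"
        using assms dcov_coeff_nonneg[of c] by (intro always_eventually) auto
      show "\<forall>\<^sub>F k in sequentially. c * real k * dcov_coeff c k \<le> c / 2 * (1 / real k)"
        using eventually_ge_at_top[of 1]
      proof eventually_elim
        case (elim k)
        have "c * real k * dcov_coeff c k \<le> c * real k * ((1 / 2) * (1 / real k ^ 2))"
          using assms elim by (intro mult_left_mono dcov_coeff_bound_half) auto
        also have "\<dots> = c / 2 * (1 / real k)" using elim by (simp add: power2_eq_square)
        finally show ?case .
      qed
      show "(\<lambda>k. c / 2 * (1 / real k)) \<longlonglongrightarrow> 0" by real_asymp
    qed simp
  qed
  ultimately have "c * (c + 1) * suminf (dcov_coeff c) - (c + 1/2)\<^sup>2 * suminf (dcov_coeff (c + 1)) = 0"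
    using assms by (simp only: dcov_coeff_contiguous) (auto dest: sums_unique2)
  then show ?thesis by simp
qed

definition tail_const :: real where "tail_const = (\<Sum>k. 1 / (real k)\<^sup>2)"

text \<open>
  Applied with all weights equal to \<open>1\<close> this controls the hypergeometric series itself, and with
  \<open>phi_weight\<close> it controls \<open>A_const\<close>.
\<close>

lemma weighted_suminf_bound:
  fixes d :: "nat \<Rightarrow> real"
  assumes c: "c \<ge> 1" and d: "\<And>k. 0 \<le> d k \<and> d k \<le> 1"
  shows "\<bar>(\<Sum>k. d k * dcov_coeff c k) - d 0 - d 1 / (4 * c)\<bar> \<le> tail_const / (2 * c\<^sup>2)"
proof -
  define e where "e k = (if k < 2 then 0 else d k * dcov_coeff c k)" for k
  have nn: "0 \<le> e k" for k using d[of k] dcov_coeff_nonneg[of c k] c by (simp add: e_def)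
  have le: "e k \<le> 1 / (2 * c\<^sup>2) * (1 / real k ^ 2)" for k
  proof (cases "k < 2")
    case False
    have "d k * dcov_coeff c k \<le> 1 * dcov_coeff c k"
      using d[of k] dcov_coeff_nonneg[of c k] c by (intro mult_right_mono) auto
    then show ?thesis using dcov_coeff_bound[OF c, of k] False by (simp add: e_def)
  qed (simp add: e_def)
  have se: "summable e"
    by (rule summable_comparison_test'[OF summable_inverse_squares[of "1 / (2 * c\<^sup>2)"], where N=0]) (use nn le in auto)
  have "e sums suminf e" using se by (rule summable_sums)
  then have "(\<lambda>k. (if k \<in> {0, 1} then d k * dcov_coeff c k else 0) + e k) sums ((\<Sum>k\<in>{0,1}. d k * dcov_coeff c k) + suminf e)"
    by (intro sums_add sums_If_finite_set) auto
  also have "(\<lambda>k. (if k \<in> {0, 1} then d k * dcov_coeff c k else 0) + e k) = (\<lambda>k. d k * dcov_coeff c k)"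
    by (auto simp: e_def fun_eq_iff)
  also have "(\<Sum>k\<in>{0,1}. d k * dcov_coeff c k) = d 0 + d 1 / (4 * c)"
    by (simp add: dcov_coeff_def power2_eq_square)
  finally have "(\<Sum>k. d k * dcov_coeff c k) = d 0 + d 1 / (4 * c) + suminf e" by (rule sums_unique[symmetric])
  moreover have "suminf e \<ge> 0" using se nn by (intro suminf_nonneg) auto
  moreover have "suminf e \<le> (\<Sum>k. 1 / (2 * c\<^sup>2) * (1 / real k ^ 2))"
    using se le by (intro suminf_le summable_inverse_squares) auto
  moreover have "(\<Sum>k. 1 / (2 * c\<^sup>2) * (1 / real k ^ 2)) = tail_const / (2 * c\<^sup>2)"
    using summable_inverse_squares[of 1] by (subst suminf_mult) (auto simp: tail_const_def)
  ultimately show ?thesis by simp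
qed

lemma suminf_dcov_coeff_limit: "((\<lambda>c. suminf (dcov_coeff c)) \<longlongrightarrow> 1) at_top"
proof -
  have "((\<lambda>c. suminf (dcov_coeff c) - (1 + 1 / (4 * c))) \<longlongrightarrow> 0) at_top"
  proof (rule Lim_null_comparison)
    show "\<forall>\<^sub>F c in at_top. norm (suminf (dcov_coeff c) - (1 + 1 / (4 * c))) \<le> tail_const / (2 * c\<^sup>2)"
      using eventually_ge_at_top[of 1]
    proof eventually_elim
      case (elim c)
      then show ?case using weighted_suminf_bound[of c "\<lambda>_. 1"] by (simp add: diff_diff_eq)
    qed
    show "((\<lambda>c. tail_const / (2 * c\<^sup>2)) \<longlongrightarrow> 0) at_top" by real_asymp
  qed
  moreover have "((\<lambda>c::real. 1 + 1 / (4 * c)) \<longlongrightarrow> 1) at_top" by real_asymp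
  ultimately show ?thesis using tendsto_add by fastforce
qed

text \<open>
  Gauss's summation theorem for the parameters \<open>- 1/2, - 1/2; c\<close>. Both sides obey the same
  recurrence from \<open>c\<close> to \<open>c + 1\<close>, so that their quotient \<open>Q\<close> is constant along \<open>c + n\<close>, and both
  tend to \<open>1\<close>.
\<close>

lemma gauss_sum:
  assumes "c \<ge> 1/2"
  shows "suminf (dcov_coeff c) = Gamma c * Gamma (c + 1) / (Gamma (c + 1/2))\<^sup>2"
proof -
  define R where "R c = Gamma c * Gamma (c + 1) / (Gamma (c + 1/2))\<^sup>2" for c :: real
  define Q where "Q c = suminf (dcov_coeff c) / R c" for c :: real
  have Rpos: "R c > 0" if "c > 0" for c
    unfolding R_def using that by (intro divide_pos_pos mult_pos_pos zero_less_power Gamma_real_pos) auto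
  have R_gr: "R c = c / gamma_ratio c ^ 2" if "c > 0" for c
  proof -
    have "Gamma c > 0" "Gamma (c + 1/2) > 0" using that by (auto intro!: Gamma_real_pos)
    moreover have "Gamma (c + 1) = c * Gamma c"
      using that by (intro Gamma_plus1_pos) auto
    ultimately show ?thesis by (simp add: R_def gamma_ratio_def field_simps power2_eq_square)
  qed
  have Qrec: "Q (c + 1) = Q c" if c: "c \<ge> 1/2" for c
  proof -
    have g: "Gamma (c + 1) = c * Gamma c" "Gamma (c + 1 + 1) = (c + 1) * Gamma (c + 1)"
       "Gamma (c + 1/2 + 1) = (c + 1/2) * Gamma (c + 1/2)"
      using that by (intro Gamma_plus1_pos; simp)+
    have pos: "Gamma c > 0" "Gamma (c + 1/2) > 0" using that by (auto intro!: Gamma_real_pos)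
    have "c + 1 + 1/2 = c + 1/2 + 1" by simp
    then have R1: "R (c + 1) * (c + 1/2)\<^sup>2 = R c * (c * (c + 1))"
      unfolding R_def using g pos c by (simp add: power2_eq_square)
    have R0: "R c > 0" "R (c + 1) > 0" using Rpos c by auto
    have "Q (c + 1) * (R (c + 1) * (c + 1/2)\<^sup>2) = (c + 1/2)\<^sup>2 * suminf (dcov_coeff (c + 1))"
      using R0 by (simp add: Q_def)
    also have "\<dots> = c * (c + 1) * suminf (dcov_coeff c)" using suminf_dcov_coeff_rec[OF c] by simp
    also have "\<dots> = Q c * (R c * (c * (c + 1)))" using R0 by (simp add: Q_def)
    finally show ?thesis unfolding R1 using R0 c by simp
  qed
  have Qn: "Q (c + real n) = Q c" for n
  proof (induction n)
    case (Suc n)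
    have "Q (c + real n + 1) = Q (c + real n)" using assms by (intro Qrec) auto
    then show ?case using Suc by (simp add: add_ac)
  qed simp
  have "((\<lambda>c. suminf (dcov_coeff c) * (gamma_ratio c ^ 2 / c)) \<longlongrightarrow> 1 * 1) at_top"
    by (intro tendsto_mult suminf_dcov_coeff_limit gamma_ratio_asymp)
  moreover have "\<forall>\<^sub>F c in at_top. suminf (dcov_coeff c) * (gamma_ratio c ^ 2 / c) = Q c"
    using eventually_gt_at_top[of 0] by eventually_elim (simp add: Q_def R_gr)
  ultimately have "(Q \<longlongrightarrow> 1) at_top" by (subst (asm) tendsto_cong) auto
  moreover have "filterlim (\<lambda>n. c + real n) at_top sequentially" by real_asymp
  ultimately have "(\<lambda>n. Q (c + real n)) \<longlonglongrightarrow> 1" by (rule filterlim_compose)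
  then have "Q c = 1" unfolding Qn by (simp add: LIMSEQ_const_iff)
  then have "suminf (dcov_coeff c) = R c" by (simp add: Q_def)
  then show ?thesis by (simp add: R_def)
qed

text \<open>
  These are the Taylor coefficients of \<open>phi\<close> at \<open>0\<close>, multiplied by \<open>fact k\<close>.
\<close>

definition phi_weight :: "nat \<Rightarrow> real" where
  "phi_weight k = (if k = 0 then 0 else 1 - 2 / 4 ^ k)"

lemma phi_weight_bounds: "0 \<le> phi_weight k \<and> phi_weight k \<le> 1"
proof (cases "k = 0")
  case False
  then have "(4::real) ^ 1 \<le> 4 ^ k" by (intro power_increasing) auto
  then show ?thesis by (simp add: phi_weight_def)
qed (simp add: phi_weight_def)

lemma hyp2F1_eq:
  "hyp2F1 (- 1/2) (- 1/2) c z = (\<Sum>k. dcov_coeff c k * z ^ k)"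
  unfolding hyp2F1_def eval_fps_def
  by (simp add: fps_hypergeo_nth dcov_coeff_def power2_eq_square mult_ac)

text \<open>
  The value of the series at \<open>1\<close>, minus twice its value at \<open>1/4\<close>, plus \<open>1\<close>, is the series with the
  coefficients weighted by \<open>1 - 2 / 4\<^sup>k\<close>; the added \<open>1\<close> cancels the term at \<open>k = 0\<close>.
\<close>

lemma A_const_series:
  assumes "n \<ge> 1"
  shows "(\<lambda>k. phi_weight k * dcov_coeff (real n / 2) k) sums A_const n"
proof -
  define c where "c = real n / 2"
  have c: "c \<ge> 1/2" using assms by (simp add: c_def)
  have s: "summable (dcov_coeff c)" using c by (rule summable_dcov_coeff)
  have s4: "summable (\<lambda>k. dcov_coeff c k * (1/4) ^ k)"
  proof (rule summable_comparison_test'[OF s, where N=0])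
    fix k :: nat
    show "norm (dcov_coeff c k * (1/4) ^ k) \<le> dcov_coeff c k"
      using dcov_coeff_nonneg[of c k] c by (auto simp: abs_mult intro!: mult_left_le power_le_one)
  qed
  have "(\<lambda>k. dcov_coeff c k - 2 * (dcov_coeff c k * (1/4) ^ k) + (if k = 0 then 1 else 0)) sums
     (suminf (dcov_coeff c) - 2 * (\<Sum>k. dcov_coeff c k * (1/4) ^ k) + 1)"
    by (intro sums_add sums_diff sums_mult summable_sums s s4 sums_single)
  also have "(\<lambda>k. dcov_coeff c k - 2 * (dcov_coeff c k * (1/4) ^ k) + (if k = 0 then 1 else 0)) =
     (\<lambda>k. phi_weight k * dcov_coeff c k)"
    by (auto simp: phi_weight_def fun_eq_iff field_simps)
  also have "suminf (dcov_coeff c) - 2 * (\<Sum>k. dcov_coeff c k * (1/4) ^ k) + 1 = A_const n"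
    using hyp2F1_eq[of c "1/4"] unfolding A_const_def gauss_sum[OF c]
    by (simp add: c_def add_divide_distrib)
  finally show ?thesis unfolding c_def .
qed

lemma A_const_pos:
  assumes "n \<ge> 1"
  shows "A_const n > 0"
proof -
  let ?f = "\<lambda>k. phi_weight k * dcov_coeff (real n / 2) k"
  have s: "summable ?f" and A: "A_const n = suminf ?f"
    using A_const_series[OF assms] by (auto simp: sums_iff)
  have "0 < ?f 1" using assms by (simp add: phi_weight_def dcov_coeff_def)
  then show ?thesis unfolding A using assms phi_weight_bounds dcov_coeff_nonneg[of "real n / 2"]
    by (intro suminf_pos2[OF s, of 1]) auto
qed

text \<open>
  The term at \<open>k = 1\<close> of the series for \<open>A_const n\<close> is \<open>1 / (4 n)\<close>, the others sum to
  \<open>O(1 / n\<^sup>2)\<close>, and the squared Gamma ratio is asymptotic to \<open>n / 2\<close>.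
\<close>

lemma A_const_asymp: "(\<lambda>n. gamma_ratio (real n / 2) ^ 2 * A_const n) \<longlonglongrightarrow> 1 / 8"
proof -
  have ev: "\<forall>\<^sub>F n in sequentially. norm ((real n / 2) * A_const n - 1 / 8) \<le> tail_const / real n"
    using eventually_ge_at_top[of 2]
  proof eventually_elim
    case (elim n)
    define c where "c = real n / 2"
    have c: "c \<ge> 1" using elim by (simp add: c_def)
    have "\<bar>A_const n - 1 / (8 * c)\<bar> \<le> tail_const / (2 * c\<^sup>2)"
      using weighted_suminf_bound[where d=phi_weight, OF c phi_weight_bounds] A_const_series[of n] elim
      by (simp add: sums_iff c_def[symmetric] phi_weight_def)
    then have "c * \<bar>A_const n - 1 / (8 * c)\<bar> \<le> c * (tail_const / (2 * c\<^sup>2))"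
      using c by (intro mult_left_mono) auto
    also have "c * \<bar>A_const n - 1 / (8 * c)\<bar> = \<bar>c * A_const n - 1 / 8\<bar>"
    proof -
      have "c * A_const n - 1 / 8 = c * (A_const n - 1 / (8 * c))" using c by (simp add: field_simps)
      then show ?thesis using c by (simp add: abs_mult)
    qed
    also have "c * (tail_const / (2 * c\<^sup>2)) = tail_const / real n"
      using c by (simp add: power2_eq_square c_def)
    finally show ?case by (simp add: c_def)
  qed
  have "(\<lambda>n. (real n / 2) * A_const n - 1 / 8) \<longlonglongrightarrow> 0"
    by (rule Lim_null_comparison[OF ev]) real_asymp
  then have 1: "(\<lambda>n. (real n / 2) * A_const n) \<longlonglongrightarrow> 1 / 8"
    by (simp add: LIM_zero_iff)
  have "filterlim (\<lambda>n. real n / 2) at_top sequentially" by real_asymp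
  from filterlim_compose[OF gamma_ratio_asymp this]
  have 2: "(\<lambda>n. gamma_ratio (real n / 2) ^ 2 / (real n / 2)) \<longlonglongrightarrow> 1" .
  have "(\<lambda>n. gamma_ratio (real n / 2) ^ 2 / (real n / 2) * ((real n / 2) * A_const n)) \<longlonglongrightarrow> 1 * (1 / 8)"
    by (intro tendsto_mult 1 2)
  moreover have "\<forall>\<^sub>F n in sequentially. gamma_ratio (real n / 2) ^ 2 / (real n / 2) * ((real n / 2) * A_const n)
     = gamma_ratio (real n / 2) ^ 2 * A_const n"
    using eventually_gt_at_top[of 0] by eventually_elim simp
  ultimately show ?thesis by (subst (asm) tendsto_cong) auto
qed

section \<open>Bounds for the covariance, exact value for the variance\<close>

text \<open>
  The lower bound comes from the linear part of \<open>phi\<close>. The upper bound adds the Beta integral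
  of the remainder, whose second argument \<open>(p - 2) / 2\<close> records the loss of the factor
  \<open>(1 - b)^(-3/2)\<close> near \<open>r = 0\<close> and forces \<open>p \<ge> 3\<close>.
\<close>

lemma gauss_dcov_bounds:
  fixes p q :: nat and L :: "nat \<Rightarrow> nat \<Rightarrow> real"
  defines "T \<equiv> (\<Sum>i<p. sqsum q (L i))"
  assumes p: "p \<ge> 3" and q: "q \<ge> 1"
    and contr: "\<And>t. sqsum p (linapp q L t) \<le> sqsum q t"
  defines "V \<equiv> enn2real (gauss_dcov p q L) / (dcov_const p * dcov_const q)"
  defines "B \<equiv> Beta (1/2) ((real q + 1) / 2) / (4 * pi)"
  shows "T * B * Beta (1/2) ((real p + 1) / 2) \<le> V"
    and "V \<le> T * B * (Beta (1/2) ((real p + 1) / 2) + 2 * sqrt 2 * Beta (3/2) ((real p - 2) / 2))"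
proof -
  define c where "c = dcov_const p / sqrt pi"
  define K where "K = T * quad_const q"
  \<comment> \<open>with \<open>b = 1 / (1 + r)\<close>, the functions \<open>u\<close> and \<open>v\<close> are \<open>beta_weight p r\<close> times \<open>b\<close> and times
    \<open>b\<^sup>2 (1 - b)^(-3/2)\<close>, in the form of Beta integrands\<close>
  define u where "u r = indicator {0<..} r * (r powr ((real p + 1) / 2 - 1) * (1 + r) powr (- (1 / 2 + (real p + 1) / 2)))" for r :: real
  define v where "v r = indicator {0<..} r * (r powr ((real p - 2) / 2 - 1) * (1 + r) powr (- (3 / 2 + (real p - 2) / 2)))" for r :: real
  define B1 where "B1 = Beta (1/2) ((real p + 1) / 2)"
  define B2 where "B2 = Beta (3/2) ((real p - 2) / 2)"
  have [measurable]: "u \<in> borel_measurable borel" "v \<in> borel_measurable borel"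
    unfolding u_def v_def by measurable
  have T: "T \<ge> 0" unfolding T_def by (intro sum_nonneg) auto
  have dp: "dcov_const p > 0" and dq: "dcov_const q > 0" by (rule dcov_const_pos)+
  have c: "c > 0" using dp by (simp add: c_def)
  have K: "K \<ge> 0" unfolding K_def using T quad_const_pos[of q] by simp
  have uv: "u r \<ge> 0" "v r \<ge> 0" for r by (simp_all add: u_def v_def)
  have B12: "B1 \<ge> 0" "B2 \<ge> 0" unfolding B1_def B2_def using p by (intro less_imp_le Beta_pos; simp)+
  have iu: "(\<integral>\<^sup>+r. ennreal (u r) \<partial>lborel) = ennreal B1"
    unfolding u_def B1_def by (subst nn_integral_beta_prime) auto
  have iv: "(\<integral>\<^sup>+r. ennreal (v r) \<partial>lborel) = ennreal B2"
    unfolding v_def B2_def using p by (subst nn_integral_beta_prime) auto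
  have bu: "beta_weight p r * (1 / (1 + r)) = u r" for r
  proof (cases "r > 0")
    case True
    have e: "- (1 / 2 + (real p + 1) / 2) = - (real p / 2) + (- 1)" by (simp add: field_simps)
    have "(1 + r) powr (- (1 / 2 + (real p + 1) / 2)) = (1 + r) powr (- (real p / 2) + (- 1))"
      unfolding e ..
    also have "\<dots> = (1 + r) powr (- (real p / 2)) * (1 / (1 + r))"
      using True unfolding powr_add by (simp add: powr_minus_divide)
    finally show ?thesis using True by (simp add: beta_weight_def u_def diff_divide_distrib add_divide_distrib)
  qed (simp add: beta_weight_def u_def)
  have bv: "beta_weight p r * ((1 / (1 + r))\<^sup>2 * (1 - 1 / (1 + r)) powr (- 3/2)) = v r" for r
  proof (cases "r > 0")
    case True
    have 1: "1 - 1 / (1 + r) = r / (1 + r)" using True by (simp add: field_simps)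
    have h1: "(1 / (1 + r))\<^sup>2 * (r / (1 + r)) powr (- 3/2) = (1 + r) powr (- 2) * (r powr (- 3/2) * (1 + r) powr (3/2))"
      using True by (simp add: powr_divide powr_minus_divide powr_numeral power_divide)
    have h2: "(1 + r) powr (- (real p / 2)) * ((1 + r) powr (- 2) * (1 + r) powr (3/2)) =
       (1 + r) powr (- (3 / 2 + (real p - 2) / 2))"
    proof -
      have "- (real p / 2) + (- 2 + 3/2) = - (3 / 2 + (real p - 2) / 2)" by (simp add: field_simps)
      then show ?thesis by (simp only: powr_add[symmetric])
    qed
    have h3: "r powr ((real p - 1) / 2) * r powr (- 3/2) = r powr ((real p - 2) / 2 - 1)"
    proof -
      have "(real p - 1) / 2 + (- 3/2) = (real p - 2) / 2 - 1" by (simp add: field_simps)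
      then show ?thesis by (simp only: powr_add[symmetric])
    qed
    have alg: "(a * b) * (c * (d * e)) = (a * d) * (b * (c * e))" for a b c d e :: real by simp
    have "beta_weight p r * ((1 / (1 + r))\<^sup>2 * (1 - 1 / (1 + r)) powr (- 3/2)) =
      (r powr ((real p - 1) / 2) * (1 + r) powr (- (real p / 2))) *
      ((1 + r) powr (- 2) * (r powr (- 3/2) * (1 + r) powr (3/2)))"
      unfolding 1 h1 using True by (simp add: beta_weight_def)
    also have "\<dots> = r powr ((real p - 2) / 2 - 1) * (1 + r) powr (- (3 / 2 + (real p - 2) / 2))"
      unfolding alg h2 h3 ..
    also have "\<dots> = v r" using True by (simp add: v_def)
    finally show ?thesis .
  qed (simp add: beta_weight_def v_def)
  have G: "gauss_dcov p q L = (\<integral>\<^sup>+r. ennreal (c * beta_weight p r) * radial_phi p q L (1 / (1 + r)) \<partial>lborel)"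
    using p unfolding c_def by (intro gauss_dcov_eq) auto
  have "ennreal (c * K / 2 * B1) = (\<integral>\<^sup>+r. ennreal (c * K / 2) * ennreal (u r) \<partial>lborel)"
    using c K by (subst nn_integral_cmult) (simp_all add: iu ennreal_mult'[symmetric])
  also have "\<dots> \<le> gauss_dcov p q L"
    unfolding G
  proof (rule nn_integral_mono)
    fix r :: real
    show "ennreal (c * K / 2) * ennreal (u r) \<le> ennreal (c * beta_weight p r) * radial_phi p q L (1 / (1 + r))"
    proof (cases "r > 0")
      case True
      have "ennreal (c * K / 2) * ennreal (u r) = ennreal (c * beta_weight p r) * ennreal (K * (1 / (1 + r) / 2))"
        using c K beta_weight_nonneg[of p r] by (subst (1 2) ennreal_mult'[symmetric]) (simp_all add: bu[symmetric] mult_ac)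
      also have "\<dots> \<le> ennreal (c * beta_weight p r) * radial_phi p q L (1 / (1 + r))"
        using True q unfolding K_def T_def by (intro mult_left_mono radial_phi_lower) auto
      finally show ?thesis .
    qed (simp add: u_def)
  qed
  finally have lower: "ennreal (c * K / 2 * B1) \<le> gauss_dcov p q L" .
  have "gauss_dcov p q L \<le> (\<integral>\<^sup>+r. ennreal (c * K / 2) * ennreal (u r) + ennreal (c * K * sqrt 2) * ennreal (v r) \<partial>lborel)"
    unfolding G
  proof (rule nn_integral_mono)
    fix r :: real
    show "ennreal (c * beta_weight p r) * radial_phi p q L (1 / (1 + r)) \<le>
      ennreal (c * K / 2) * ennreal (u r) + ennreal (c * K * sqrt 2) * ennreal (v r)"
    proof (cases "r > 0")
      case True
      let ?b = "1 / (1 + r)"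
      have "ennreal (c * beta_weight p r) * radial_phi p q L ?b \<le>
         ennreal (c * beta_weight p r) * ennreal (K * (?b / 2 + sqrt 2 * ?b\<^sup>2 * (1 - ?b) powr (- 3/2)))"
        using True q contr unfolding K_def T_def by (intro mult_left_mono radial_phi_upper) auto
      also have "\<dots> = ennreal (c * beta_weight p r * (K * (?b / 2 + sqrt 2 * ?b\<^sup>2 * (1 - ?b) powr (- 3/2))))"
        using c beta_weight_nonneg[of p r] by (subst ennreal_mult') auto
      also have "c * beta_weight p r * (K * (?b / 2 + sqrt 2 * ?b\<^sup>2 * (1 - ?b) powr (- 3/2))) =
         c * K / 2 * (beta_weight p r * ?b) + c * K * sqrt 2 * (beta_weight p r * (?b\<^sup>2 * (1 - ?b) powr (- 3/2)))"
        by (simp add: distrib_left mult_ac)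
      also have "\<dots> = c * K / 2 * u r + c * K * sqrt 2 * v r"
        unfolding bu bv ..
      also have "ennreal \<dots> = ennreal (c * K / 2 * u r) + ennreal (c * K * sqrt 2 * v r)"
        using c K uv by (intro ennreal_plus) auto
      also have "\<dots> = ennreal (c * K / 2) * ennreal (u r) + ennreal (c * K * sqrt 2) * ennreal (v r)"
        using c K by (subst (1 2) ennreal_mult') auto
      finally show ?thesis .
    qed (simp add: beta_weight_def)
  qed
  also have "\<dots> = ennreal (c * K / 2) * ennreal B1 + ennreal (c * K * sqrt 2) * ennreal B2"
    by (subst nn_integral_add, measurable) (subst (1 2) nn_integral_cmult, simp_all add: iu iv)
  also have "\<dots> = ennreal (c * K / 2 * B1) + ennreal (c * K * sqrt 2 * B2)"
    using c K by (subst (1 2) ennreal_mult'[symmetric]) auto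
  also have "\<dots> = ennreal (c * K / 2 * B1 + c * K * sqrt 2 * B2)"
    using c K B12 by (intro ennreal_plus[symmetric]) auto
  finally have upper: "gauss_dcov p q L \<le> ennreal (c * K / 2 * B1 + c * K * sqrt 2 * B2)" .
  define x where "x = enn2real (gauss_dcov p q L)"
  have gx: "gauss_dcov p q L = ennreal x"
    using upper unfolding x_def by (intro ennreal_enn2real[symmetric]) (auto simp: top_unique less_top[symmetric])
  have x0: "x \<ge> 0" unfolding x_def by simp
  have u0: "c * K / 2 * B1 + c * K * sqrt 2 * B2 \<ge> 0"
    using c K B12 by (intro add_nonneg_nonneg mult_nonneg_nonneg) auto
  have lu: "c * K / 2 * B1 \<le> x" "x \<le> c * K / 2 * B1 + c * K * sqrt 2 * B2"
    using lower upper unfolding gx by (simp_all only: ennreal_le_iff[OF x0] ennreal_le_iff[OF u0])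
  have cK: "c * K / (dcov_const p * dcov_const q) = T * B * 2"
    using dp dq by (simp add: c_def K_def B_def quad_const_def)
  have "c * K / 2 * B1 / (dcov_const p * dcov_const q) \<le> V"
    unfolding V_def x_def[symmetric] using dp dq lu by (intro divide_right_mono) auto
  also have "c * K / 2 * B1 / (dcov_const p * dcov_const q) = c * K / (dcov_const p * dcov_const q) / 2 * B1" by simp
  finally show "T * B * Beta (1/2) ((real p + 1) / 2) \<le> V" unfolding cK B1_def by simp
  have "V \<le> (c * K / 2 * B1 + c * K * sqrt 2 * B2) / (dcov_const p * dcov_const q)"
    unfolding V_def x_def[symmetric] using dp dq lu by (intro divide_right_mono) auto
  also have "\<dots> = c * K / (dcov_const p * dcov_const q) * (B1 / 2 + sqrt 2 * B2)"
    by (simp add: add_divide_distrib distrib_left)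
  finally show "V \<le> T * B * (Beta (1/2) ((real p + 1) / 2) + 2 * sqrt 2 * Beta (3/2) ((real p - 2) / 2))"
    unfolding cK B1_def B2_def by (simp add: algebra_simps)
qed

definition id_coeffs :: "nat \<Rightarrow> nat \<Rightarrow> real" where
  "id_coeffs i j = (if i = j then 1 else 0)"

lemma linapp_id: "i < n \<Longrightarrow> linapp n id_coeffs t i = t i"
  by (simp add: linapp_def id_coeffs_def if_distrib[of "\<lambda>x. x * _"] cong: if_cong)

text \<open>
  What \<open>phi\<close> becomes when its argument is \<open>b |t|\<^sup>2\<close> and \<open>t\<close> is integrated against a Gaussian: each
  exponential contributes a negative binomial factor.
\<close>

definition psi :: "nat \<Rightarrow> real \<Rightarrow> real" where
  "psi n z = 1 - 2 * (1 - z / 4) powr (- (real n / 2)) + (1 - z) powr (- (real n / 2))"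

definition psi_coeff :: "nat \<Rightarrow> nat \<Rightarrow> real" where
  "psi_coeff n k = phi_weight k * (pochhammer (real n / 2) k / fact k)"

lemma psi_coeff_nonneg: "psi_coeff n k \<ge> 0"
  using phi_weight_bounds[of k] unfolding psi_coeff_def
  by (intro mult_nonneg_nonneg divide_nonneg_pos) (auto simp: pochhammer_prod intro!: prod_nonneg)

lemma negative_binomial_series:
  fixes z c :: real
  assumes "\<bar>z\<bar> < 1"
  shows "(\<lambda>k. pochhammer c k / fact k * z ^ k) sums (1 - z) powr (- c)"
proof -
  have "(\<lambda>k. ((- c) gchoose k) * (- z) ^ k) sums (1 + (- z)) powr (- c)"
    using assms by (intro gen_binomial_real) auto
  moreover have "((- c) gchoose k) * (- z) ^ k = pochhammer c k / fact k * z ^ k" for k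
    by (simp add: gbinomial_pochhammer power_mult_distrib[symmetric] mult_ac flip: power_mult_distrib)
  ultimately show ?thesis by simp
qed

lemma psi_series:
  assumes "0 < z" "z < 1"
  shows "(\<lambda>k. psi_coeff n k * z ^ k) sums psi n z"
proof -
  let ?c = "\<lambda>k. pochhammer (real n / 2) k / fact k"
  have "(\<lambda>k. (if k = 0 then 1 else 0) - 2 * (?c k * (z / 4) ^ k) + ?c k * z ^ k) sums psi n z"
    unfolding psi_def using assms
    by (intro sums_add sums_diff sums_mult negative_binomial_series sums_single) auto
  also have "(\<lambda>k. (if k = 0 then 1 else 0) - 2 * (?c k * (z / 4) ^ k) + ?c k * z ^ k) = (\<lambda>k. psi_coeff n k * z ^ k)"
    by (auto simp: psi_coeff_def phi_weight_def fun_eq_iff power_divide field_simps)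
  finally show ?thesis .
qed

lemma nn_integral_phi_gaussian:
  assumes "0 < b" "b < a"
  shows "(\<integral>\<^sup>+t. ennreal (phi (b * sqsum n t) * exp (- (a * sqsum n t))) \<partial>lborel_fun n)
    = ennreal ((pi / a) powr (real n / 2) * psi n (b / a))"
proof -
  have g: "has_bochner_integral (lborel_fun n) (\<lambda>x. exp (- (a * sqsum n x))) ((pi / a) powr (real n / 2))"
    if "a > 0" for a :: real
    using gaussian_integral_linear_lborel_fun[OF that, of n "\<lambda>_. 0"] by simp
  have "has_bochner_integral (lborel_fun n) (\<lambda>t. exp (- (a * sqsum n t)) - 2 * exp (- ((a - b / 4) * sqsum n t))
       + exp (- ((a - b) * sqsum n t)))
     ((pi / a) powr (real n / 2) - 2 * (pi / (a - b / 4)) powr (real n / 2) + (pi / (a - b)) powr (real n / 2))"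
    using assms by (intro has_bochner_integral_add has_bochner_integral_diff has_bochner_integral_mult_right g) auto
  moreover have "exp (- (a * sqsum n t)) - 2 * exp (- ((a - b / 4) * sqsum n t)) + exp (- ((a - b) * sqsum n t))
     = phi (b * sqsum n t) * exp (- (a * sqsum n t))" for t
  proof -
    have "exp (- ((a - e) * sqsum n t)) = exp (e * sqsum n t) * exp (- (a * sqsum n t))" for e
      by (simp add: exp_add[symmetric] left_diff_distrib)
    from this[of b] this[of "b / 4"] show ?thesis by (simp add: phi_def algebra_simps)
  qed
  moreover have "(pi / a) powr (real n / 2) - 2 * (pi / (a - b / 4)) powr (real n / 2) + (pi / (a - b)) powr (real n / 2)
     = (pi / a) powr (real n / 2) * psi n (b / a)"
  proof -
    have "(pi / (a - e)) powr (real n / 2) = (pi / a) powr (real n / 2) * (1 - e / a) powr (- (real n / 2))"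
      if "e < a" for e
    proof -
      have h: "1 - e / a > 0" "a > 0" using that assms by auto
      have eq: "pi / (a - e) = (pi / a) / (1 - e / a)" using h that by (simp add: field_simps)
      show ?thesis unfolding eq by (subst powr_divide) (use h in \<open>auto simp: powr_minus_divide\<close>)
    qed
    from this[of b] this[of "b / 4"] show ?thesis using assms by (simp add: psi_def algebra_simps)
  qed
  ultimately have "has_bochner_integral (lborel_fun n) (\<lambda>t. phi (b * sqsum n t) * exp (- (a * sqsum n t)))
     ((pi / a) powr (real n / 2) * psi n (b / a))" by simp
  then show ?thesis using assms
    by (subst nn_integral_eq_integral) (auto simp: has_bochner_integral_iff sum_nonneg intro!: phi_nonneg mult_nonneg_nonneg)
qed

text \<open>
  For the identity matrix the weight in \<open>t\<close> can be resolved by the same mixture as the weight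
  in \<open>s\<close>, which gives a second \<open>beta_weight\<close>.
\<close>

lemma radial_phi_id:
  assumes "n \<ge> 1" "0 < b" "b < 1"
  shows "radial_phi n n id_coeffs b = (\<integral>\<^sup>+r. ennreal (dcov_const n / sqrt pi * beta_weight n r * psi n (b / (1 + r))) \<partial>lborel)"
proof -
  have "radial_phi n n id_coeffs b = (\<integral>\<^sup>+t. ennreal (phi (b * sqsum n t) * exp (- sqsum n t) / sqrt (sqsum n t) ^ (n + 1)) \<partial>lborel_fun n)"
    unfolding radial_phi_def by (simp add: linapp_id cong: sum.cong_simp)
  also have "\<dots> = (\<integral>\<^sup>+r. ennreal (mix_density n r) * (\<integral>\<^sup>+t. ennreal (phi (b * sqsum n t) * exp (- sqsum n t)
         * exp (- (r * sqsum n t))) \<partial>lborel_fun n) \<partial>lborel)"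
    using assms by (intro nn_integral_norm_weight) (auto intro!: mult_nonneg_nonneg phi_nonneg sum_nonneg)
  also have "\<dots> = (\<integral>\<^sup>+r. ennreal (dcov_const n / sqrt pi * beta_weight n r * psi n (b / (1 + r))) \<partial>lborel)"
  proof (rule nn_integral_cong)
    fix r :: real
    show "ennreal (mix_density n r) * (\<integral>\<^sup>+t. ennreal (phi (b * sqsum n t) * exp (- sqsum n t)
         * exp (- (r * sqsum n t))) \<partial>lborel_fun n) = ennreal (dcov_const n / sqrt pi * beta_weight n r * psi n (b / (1 + r)))"
    proof (cases "r > 0")
      case True
      have "exp (- sqsum n t) * exp (- (r * sqsum n t)) = exp (- ((1 + r) * sqsum n t))" for t
        by (simp add: exp_add[symmetric] algebra_simps)
      then have "(\<integral>\<^sup>+t. ennreal (phi (b * sqsum n t) * exp (- sqsum n t) * exp (- (r * sqsum n t))) \<partial>lborel_fun n)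
        = ennreal ((pi / (1 + r)) powr (real n / 2) * psi n (b / (1 + r)))"
        using True assms by (simp add: mult.assoc nn_integral_phi_gaussian)
      moreover have "mix_density n r * ((pi / (1 + r)) powr (real n / 2) * psi n (b / (1 + r))) =
          dcov_const n / sqrt pi * beta_weight n r * psi n (b / (1 + r))"
        by (simp only: mix_density_gaussian[OF True] mult.assoc[symmetric])
      ultimately show ?thesis
        using mix_density_nonneg[of n r] by (simp only: ennreal_mult'[symmetric])
    qed (simp add: mix_density_def beta_weight_def)
  qed
  finally show ?thesis .
qed

lemma nn_integral_beta_weight_power:
  assumes "k \<ge> 1"
  shows "(\<integral>\<^sup>+r. ennreal (beta_weight n r * (1 / (1 + r)) ^ k) \<partial>lborel) = ennreal (Beta (real k - 1/2) ((real n + 1) / 2))"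
proof -
  have "beta_weight n r * (1 / (1 + r)) ^ k = indicator {0<..} r * (r powr ((real n + 1) / 2 - 1) *
     (1 + r) powr (- ((real k - 1/2) + (real n + 1) / 2)))" for r :: real
  proof (cases "r > 0")
    case True
    have e: "- ((real k - 1/2) + (real n + 1) / 2) = - (real n / 2) + (- real k)" by (simp add: field_simps)
    have "(1 + r) powr (- ((real k - 1/2) + (real n + 1) / 2)) = (1 + r) powr (- (real n / 2) + (- real k))"
      unfolding e ..
    also have "\<dots> = (1 + r) powr (- (real n / 2)) * (1 / (1 + r)) ^ k"
      using True unfolding powr_add by (simp add: powr_minus_divide powr_realpow power_one_over)
    finally show ?thesis using True by (simp add: beta_weight_def diff_divide_distrib add_divide_distrib)
  qed (simp add: beta_weight_def)
  then show ?thesis using assms nn_integral_beta_prime[of "real k - 1/2" "(real n + 1) / 2" 1] by simp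
qed

text \<open>
  The Beta integral contributes \<open>\<Gamma>(k - 1/2)\<close> and \<open>1 / \<Gamma>(n / 2 + k)\<close>, which are Pochhammer symbols
  up to factors independent of \<open>k\<close>. The factor \<open>4 \<pi>\<close> is the square of \<open>\<Gamma>(- 1/2)\<close>.
\<close>

lemma psi_coeff_Beta:
  assumes "n \<ge> 1"
  shows "psi_coeff n k * (Beta (real k - 1/2) ((real n + 1) / 2))\<^sup>2 / pi
     = 4 * gamma_ratio (real n / 2) ^ 2 * (phi_weight k * dcov_coeff (real n / 2) k)"
proof (cases "k = 0")
  case False
  define P where "P = pochhammer (real n / 2) k"
  define m where "m = pochhammer (- 1/2 :: real) k"
  have P: "P > 0" unfolding P_def using assms by (intro pochhammer_pos) auto
  have G: "Gamma (real n / 2) > 0" using assms by (intro Gamma_real_pos) auto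
  have "- 1/2 \<notin> (\<int>\<^sub>\<le>\<^sub>0 :: real set)"
  proof
    assume "- 1/2 \<in> (\<int>\<^sub>\<le>\<^sub>0 :: real set)"
    then obtain j :: int where "- 1/2 = real_of_int j" by (auto elim!: nonpos_Ints_cases)
    then have "real_of_int (- 1) = real_of_int (2 * j)" by simp
    then have "- 1 = 2 * j" by (simp only: of_int_eq_iff)
    then show False by presburger
  qed
  then have m: "m = Gamma (- 1/2 + real k) / Gamma (- 1/2)" and "Gamma (- 1/2 + 1 :: real) = - 1/2 * Gamma (- 1/2)"
    unfolding m_def by (intro pochhammer_Gamma Gamma_plus1, assumption)+
  then have Gm: "Gamma (- 1/2) = - 2 * sqrt pi" by (simp add: Gamma_one_half_real)
  have "P = Gamma (real n / 2 + real k) / Gamma (real n / 2)"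
    unfolding P_def using assms by (intro pochhammer_Gamma) (auto elim!: nonpos_Ints_cases)
  then have 1: "Gamma (real k - 1/2 + (real n + 1) / 2) = P * Gamma (real n / 2)"
    using G by (simp add: add_divide_distrib add_ac)
  have 2: "Gamma (real k - 1/2) = - 2 * sqrt pi * m" using m unfolding Gm by simp
  have 3: "Beta (real k - 1/2) ((real n + 1) / 2) = - 2 * sqrt pi * m * gamma_ratio (real n / 2) / P"
    unfolding Beta_def 1 2 gamma_ratio_def by (simp add: add_divide_distrib mult_ac)
  show ?thesis unfolding 3 psi_coeff_def dcov_coeff_def P_def[symmetric] m_def[symmetric]
    using P by (simp add: power2_eq_square field_simps)
qed (simp add: psi_coeff_def phi_weight_def)

text \<open>
  Expanding \<open>psi\<close> in powers of \<open>1 / ((1 + r) (1 + r'))\<close> separates the two mixture variables, and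
  nonnegative coefficients allow termwise integration.
\<close>

lemma gauss_dcov_id:
  assumes n: "n \<ge> 1"
  shows "gauss_dcov n n id_coeffs = ennreal ((dcov_const n)\<^sup>2 * (4 * gamma_ratio (real n / 2) ^ 2 * A_const n))"
proof -
  define c where "c = dcov_const n / sqrt pi"
  have c: "c > 0" using dcov_const_pos[of n] by (simp add: c_def)
  let ?w = "\<lambda>k r. ennreal (beta_weight n r * (1 / (1 + r)) ^ k)"
  let ?e = "\<lambda>k. ennreal (c\<^sup>2 * psi_coeff n k)"
  have "gauss_dcov n n id_coeffs = (\<integral>\<^sup>+r. (\<integral>\<^sup>+r'. (\<Sum>k. ?e k * (?w k r * ?w k r')) \<partial>lborel) \<partial>lborel)"
    unfolding gauss_dcov_eq[OF n]
  proof (rule nn_integral_cong)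
    fix r :: real
    show "ennreal (dcov_const n / sqrt pi * beta_weight n r) * radial_phi n n id_coeffs (1 / (1 + r)) =
       (\<integral>\<^sup>+r'. (\<Sum>k. ?e k * (?w k r * ?w k r')) \<partial>lborel)"
    proof (cases "r > 0")
      case True
      have "ennreal (dcov_const n / sqrt pi * beta_weight n r) * radial_phi n n id_coeffs (1 / (1 + r)) =
        (\<integral>\<^sup>+r'. ennreal (c * beta_weight n r) * ennreal (c * beta_weight n r' * psi n (1 / (1 + r) / (1 + r'))) \<partial>lborel)"
        using True n unfolding c_def 
        by (subst radial_phi_id, simp, simp, simp, subst nn_integral_cmult) (auto simp: psi_def)
      also have "\<dots> = (\<integral>\<^sup>+r'. (\<Sum>k. ?e k * (?w k r * ?w k r')) \<partial>lborel)"
      proof (rule nn_integral_cong)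
        fix r' :: real
        show "ennreal (c * beta_weight n r) * ennreal (c * beta_weight n r' * psi n (1 / (1 + r) / (1 + r'))) =
           (\<Sum>k. ?e k * (?w k r * ?w k r'))"
        proof (cases "r' > 0")
          case True': True
          define z where "z = 1 / (1 + r) / (1 + r')"
          have "0 < r * r'" using True True' by simp
          then have "1 < (1 + r) * (1 + r')" using True True' by (simp add: algebra_simps add_pos_pos)
          then have z: "0 < z" "z < 1" using True True' by (simp_all add: z_def)
          define W where "W = c\<^sup>2 * beta_weight n r * beta_weight n r'"
          have W: "W \<ge> 0" using c beta_weight_nonneg unfolding W_def by simp
          have s: "(\<lambda>k. W * (psi_coeff n k * z ^ k)) sums (W * psi n z)"
            by (intro sums_mult psi_series z)
          have "(\<Sum>k. ?e k * (?w k r * ?w k r')) = (\<Sum>k. ennreal (W * (psi_coeff n k * z ^ k)))"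
          proof (rule suminf_cong)
            fix k
            have "c\<^sup>2 * psi_coeff n k * ((beta_weight n r * (1 / (1 + r)) ^ k) * (beta_weight n r' * (1 / (1 + r')) ^ k))
              = W * (psi_coeff n k * z ^ k)"
              by (simp add: W_def z_def power_mult_distrib power_divide)
            then show "?e k * (?w k r * ?w k r') = ennreal (W * (psi_coeff n k * z ^ k))"
              using True True' psi_coeff_nonneg[of n k] beta_weight_nonneg[of n r] beta_weight_nonneg[of n r']
              by (metis (no_types, lifting) ennreal_mult' mult_nonneg_nonneg zero_le_power2 zero_le_power
                 zero_le_divide_1_iff add_nonneg_nonneg less_imp_le zero_le_one)
          qed
          also have "\<dots> = ennreal (W * psi n z)"
            using s W z psi_coeff_nonneg[of n] by (subst suminf_ennreal2) (auto simp: sums_iff)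
          also have "\<dots> = ennreal (c * beta_weight n r) * ennreal (c * beta_weight n r' * psi n z)"
            using c beta_weight_nonneg[of n r]
            by (subst ennreal_mult'[symmetric]) (auto simp: W_def power2_eq_square mult_ac)
          finally show ?thesis by (simp add: z_def)
        qed (simp add: beta_weight_def)
      qed
      finally show ?thesis .
    qed (simp add: beta_weight_def)
  qed
  also have "\<dots> = (\<Sum>k. ?e k * ((\<integral>\<^sup>+r. ?w k r \<partial>lborel) * (\<integral>\<^sup>+r. ?w k r \<partial>lborel)))"
    by (simp add: nn_integral_suminf nn_integral_cmult nn_integral_multc)
  also have "\<dots> = (\<Sum>k. ennreal ((dcov_const n)\<^sup>2 * (4 * gamma_ratio (real n / 2) ^ 2) *
       (phi_weight k * dcov_coeff (real n / 2) k)))"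
  proof (rule suminf_cong)
    fix k
    show "?e k * ((\<integral>\<^sup>+r. ?w k r \<partial>lborel) * (\<integral>\<^sup>+r. ?w k r \<partial>lborel)) = ennreal ((dcov_const n)\<^sup>2 *
      (4 * gamma_ratio (real n / 2) ^ 2) * (phi_weight k * dcov_coeff (real n / 2) k))"
    proof (cases "k = 0")
      case False
      let ?B = "Beta (real k - 1/2) ((real n + 1) / 2)"
      have B: "?B > 0" using False by (intro Beta_pos) auto
      have "(dcov_const n)\<^sup>2 * (4 * gamma_ratio (real n / 2) ^ 2) * (phi_weight k * dcov_coeff (real n / 2) k)
         = c\<^sup>2 * psi_coeff n k * (?B * ?B)"
        unfolding mult.assoc psi_coeff_Beta[OF n, symmetric, unfolded mult.assoc]
        by (simp add: c_def power_divide power2_eq_square)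
      then show ?thesis using False B psi_coeff_nonneg[of n k]
        by (simp add: nn_integral_beta_weight_power ennreal_mult')
    qed (simp add: psi_coeff_def phi_weight_def)
  qed
  also have "\<dots> = ennreal ((dcov_const n)\<^sup>2 * (4 * gamma_ratio (real n / 2) ^ 2) * A_const n)"
  proof -
    have "(\<lambda>k. (dcov_const n)\<^sup>2 * (4 * gamma_ratio (real n / 2) ^ 2) * (phi_weight k * dcov_coeff (real n / 2) k))
       sums ((dcov_const n)\<^sup>2 * (4 * gamma_ratio (real n / 2) ^ 2) * A_const n)"
      using A_const_series[OF n] by (rule sums_mult)
    then show ?thesis using phi_weight_bounds dcov_coeff_nonneg[of "real n / 2"] n
      by (subst suminf_ennreal2) (auto simp: sums_iff intro!: mult_nonneg_nonneg)
  qed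
  finally show ?thesis by (simp add: mult.assoc)
qed

section \<open>Positive semidefinite matrices and real eigenvectors\<close>

lemma psd_carrier: "pos_semidef_mat n A \<Longrightarrow> A \<in> carrier_mat n n"
  and psd_symmetric: "pos_semidef_mat n A \<Longrightarrow> transpose_mat A = A"
  and psd_nonneg: "pos_semidef_mat n A \<Longrightarrow> v \<in> carrier_vec n \<Longrightarrow> v \<bullet> (A *\<^sub>v v) \<ge> 0"
  by (auto simp: pos_semidef_mat_def)

lemma symmetric_scalar_prod:
  fixes A :: "real mat"
  assumes "A \<in> carrier_mat n n" "transpose_mat A = A" "x \<in> carrier_vec n" "y \<in> carrier_vec n"
  shows "(A *\<^sub>v x) \<bullet> y = x \<bullet> (A *\<^sub>v y)"
  using transpose_vec_mult_scalar[of A n n y x] assms by simp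

lemma scalar_prod_self_nonneg: "(v :: real vec) \<bullet> v \<ge> 0"
  by (auto simp: scalar_prod_def intro!: sum_nonneg)

lemma scalar_prod_self_eq_0: 
  assumes "(v :: real vec) \<in> carrier_vec n" "v \<bullet> v = 0"
  shows "v = 0\<^sub>v n"
proof -
  have "\<forall>i\<in>{0..<n}. v $ i * v $ i = 0"
    using assms by (subst sum_nonneg_eq_0_iff[symmetric]) (auto simp: scalar_prod_def)
  then show ?thesis using assms by (intro eq_vecI) auto
qed

lemma smult_smult_scalar_prod:
  fixes y z :: "real vec"
  assumes "y \<in> carrier_vec n" "z \<in> carrier_vec n"
  shows "(t \<cdot>\<^sub>v y) \<bullet> (t \<cdot>\<^sub>v z) = t * (t * (y \<bullet> z))"
  using assms by (simp add: scalar_prod_def sum_distrib_left mult_ac)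

text \<open>
  For a semidefinite form, the value at \<open>x + t (S x)\<close> is a quadratic polynomial in \<open>t\<close> without
  constant term and with linear coefficient \<open>2 |S x|\<^sup>2\<close>; it can only be nonnegative for all \<open>t\<close> if
  that coefficient vanishes.
\<close>

lemma psd_null_vector:
  assumes S: "pos_semidef_mat n S" and x: "x \<in> carrier_vec n" and 0: "x \<bullet> (S *\<^sub>v x) = 0"
  shows "S *\<^sub>v x = 0\<^sub>v n"
proof (rule scalar_prod_self_eq_0)
  note c[simp] = psd_carrier[OF S]
  define y where "y = S *\<^sub>v x"
  have y[simp]: "y \<in> carrier_vec n" unfolding y_def by (rule mult_mat_vec_carrier[OF c x])
  have x'[simp]: "S *\<^sub>v y \<in> carrier_vec n" by (rule mult_mat_vec_carrier[OF c y])
  show "S *\<^sub>v x \<in> carrier_vec n" using y unfolding y_def .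
  define a where "a = y \<bullet> (S *\<^sub>v y)"
  have smult2: "(t \<cdot>\<^sub>v y) \<bullet> (t \<cdot>\<^sub>v (S *\<^sub>v y)) = t * (t * a)" for t
    unfolding a_def by (rule smult_smult_scalar_prod[OF y x'])
  have ineq: "0 \<le> 2 * t * (y \<bullet> y) + t\<^sup>2 * a" for t
  proof -
    have "0 \<le> (x + t \<cdot>\<^sub>v y) \<bullet> (S *\<^sub>v (x + t \<cdot>\<^sub>v y))" using x by (intro psd_nonneg[OF S]) auto
    also have "S *\<^sub>v (x + t \<cdot>\<^sub>v y) = y + t \<cdot>\<^sub>v (S *\<^sub>v y)"
      using x mult_add_distrib_mat_vec[OF c x, of "t \<cdot>\<^sub>v y"] mult_mat_vec[OF c y, of t] y by (simp add: y_def)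
    also have "(x + t \<cdot>\<^sub>v y) \<bullet> (y + t \<cdot>\<^sub>v (S *\<^sub>v y)) = x \<bullet> y + t * (x \<bullet> (S *\<^sub>v y)) + (t * (y \<bullet> y) + t * (t * a))"
      using x by (simp add: scalar_prod_add_distrib[of _ n] add_scalar_prod_distrib[of _ n] smult2 algebra_simps)
    also have "x \<bullet> y = 0" using 0 by (simp add: y_def)
    also have "x \<bullet> (S *\<^sub>v y) = y \<bullet> y"
      using symmetric_scalar_prod[OF c psd_symmetric[OF S] x y] by (simp add: y_def)
    finally show ?thesis by (simp add: power2_eq_square algebra_simps)
  qed
  have yy: "y \<bullet> y \<ge> 0" by (rule scalar_prod_self_nonneg)
  have a: "a \<ge> 0" unfolding a_def by (intro psd_nonneg[OF S] y)
  have "y \<bullet> y \<le> 0"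
  proof (cases "a = 0")
    case True
    then show ?thesis using ineq[of "-1"] by simp
  next
    case False
    with a have "a > 0" by simp
    then have "2 * (- (y \<bullet> y) / a) * (y \<bullet> y) + (- (y \<bullet> y) / a)\<^sup>2 * a = - ((y \<bullet> y)\<^sup>2 / a)"
      by (simp add: power2_eq_square field_simps)
    \<comment> \<open>the minimiser of the quadratic polynomial\<close>
    with ineq[of "- (y \<bullet> y) / a"] have "(y \<bullet> y)\<^sup>2 / a \<le> 0" by simp
    with \<open>a > 0\<close> have "(y \<bullet> y)\<^sup>2 \<le> 0" by (simp add: divide_le_0_iff)
    then show ?thesis by simp
  qed
  with yy show "(S *\<^sub>v x) \<bullet> (S *\<^sub>v x) = 0" unfolding y_def[symmetric] by linarith
qed

lemma trace_comm_sum: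
  fixes A B :: "real mat"
  assumes "A \<in> carrier_mat n n" "B \<in> carrier_mat n n"
  shows "(\<Sum>i<n. (A * B) $$ (i, i)) = (\<Sum>i<n. (B * A) $$ (i, i))"
proof -
  have "(\<Sum>i<n. (A * B) $$ (i, i)) = (\<Sum>i<n. \<Sum>k<n. A $$ (i, k) * B $$ (k, i))"
    using assms by (simp add: scalar_prod_def atLeast0LessThan)
  also have "\<dots> = (\<Sum>i<n. \<Sum>k<n. B $$ (i, k) * A $$ (k, i))"
    by (subst sum.swap) (simp add: mult.commute)
  also have "\<dots> = (\<Sum>i<n. (B * A) $$ (i, i))"
    using assms by (simp add: scalar_prod_def atLeast0LessThan)
  finally show ?thesis .
qed

lemma mult_unit_vec_eq_col:
  fixes A :: "real mat"
  shows "A \<in> carrier_mat m n \<Longrightarrow> i < n \<Longrightarrow> A *\<^sub>v unit_vec n i = col A i"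
  by (intro eq_vecI) auto

text \<open>
  With \<open>D = S - T\<close>, equal squares mean \<open>S D + D T = 0\<close>. Multiplying by \<open>D\<close> and taking traces shows
  that the nonnegative numbers \<open>tr (D S D)\<close> and \<open>tr (D T D)\<close> add up to zero. Hence the diagonals of
  both products vanish, so that \<open>S D = T D = 0\<close> and \<open>D\<^sup>2 = 0\<close>.
\<close>

lemma psd_sqrt_unique:
  assumes S: "pos_semidef_mat n S" and T: "pos_semidef_mat n T" and eq: "S * S = T * T"
  shows "S = T"
proof -
  note cS = psd_carrier[OF S] and cT = psd_carrier[OF T]
  define D where "D = S - T"
  have cD: "D \<in> carrier_mat n n" using cS cT by (simp add: D_def minus_carrier_mat)
  have symD: "transpose_mat D = D"
    unfolding D_def using cS cT psd_symmetric[OF S] psd_symmetric[OF T] by (simp add: transpose_minus)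
  have SD: "S * D = S * S - S * T" and DT: "D * T = S * T - T * T"
    unfolding D_def using cS cT by (auto simp: mult_minus_distrib_mat minus_mult_distrib_mat)
  have quad: "(D * (R * D)) $$ (i, i) = (D *\<^sub>v unit_vec n i) \<bullet> (R *\<^sub>v (D *\<^sub>v unit_vec n i))"
    if R: "R \<in> carrier_mat n n" and i: "i < n" for R i
  proof -
    have "D *\<^sub>v unit_vec n i = col D i" using cD i by (simp add: mult_unit_vec_eq_col[of _ n n])
    moreover have "row D i = col D i" using symD cD i by (metis carrier_matD(1) carrier_matD(2) row_transpose)
    moreover have "col (R * D) i = R *\<^sub>v col D i" using cD R i by (simp add: col_mult2)
    ultimately show ?thesis using cD R i by simp
  qed
  have nn: "(D * (R * D)) $$ (i, i) \<ge> 0" if "pos_semidef_mat n R" "i < n" for R i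
    using quad[OF psd_carrier[OF that(1)] that(2)] cD that
    by (auto intro!: psd_nonneg mult_mat_vec_carrier)
  have "(\<Sum>i<n. (D * (S * D)) $$ (i, i)) + (\<Sum>i<n. (D * (T * D)) $$ (i, i)) = 0"
  proof -
    have "(\<Sum>i<n. (D * (T * D)) $$ (i, i)) = (\<Sum>i<n. ((T * D) * D) $$ (i, i))"
      using cD cT by (intro trace_comm_sum) auto
    also have "\<dots> = (\<Sum>i<n. (D * (D * T)) $$ (i, i))"
      using trace_comm_sum[of "D * D" n T] cD cT by (simp add: assoc_mult_mat[of _ n n _ n _ n])
    finally have "(\<Sum>i<n. (D * (S * D)) $$ (i, i)) + (\<Sum>i<n. (D * (T * D)) $$ (i, i)) =
      (\<Sum>i<n. (D * (S * D) + D * (D * T)) $$ (i, i))"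
      using cD cS cT by (simp add: sum.distrib)
    also have "D * (S * D) + D * (D * T) = D * (S * D + D * T)"
      using cD cS cT by (intro mult_add_distrib_mat[symmetric, of _ n n _ n]) auto
    also have "S * D + D * T = 0\<^sub>m n n"
      unfolding SD DT eq using cS cT by (intro eq_matI) auto
    finally show ?thesis using cD by simp
  qed
  moreover have "(\<Sum>i<n. (D * (S * D)) $$ (i, i)) \<ge> 0" "(\<Sum>i<n. (D * (T * D)) $$ (i, i)) \<ge> 0"
    using nn[OF S] nn[OF T] by (auto intro!: sum_nonneg)
  ultimately have "(\<Sum>i<n. (D * (S * D)) $$ (i, i)) = 0" "(\<Sum>i<n. (D * (T * D)) $$ (i, i)) = 0"
    by linarith+
  then have "\<forall>i\<in>{..<n}. (D * (S * D)) $$ (i, i) = 0" "\<forall>i\<in>{..<n}. (D * (T * D)) $$ (i, i) = 0"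
    using nn[OF S] nn[OF T] by (subst (asm) (1 2) sum_nonneg_eq_0_iff; force)+
  then have z: "(D * (S * D)) $$ (i, i) = 0" "(D * (T * D)) $$ (i, i) = 0" if "i < n" for i
    using that by auto
  have De: "D *\<^sub>v unit_vec n i = 0\<^sub>v n" if i: "i < n" for i
  proof -
    define x where "x = D *\<^sub>v unit_vec n i"
    have x: "x \<in> carrier_vec n" using cD by (simp add: x_def mult_mat_vec_carrier)
    have Sx: "S *\<^sub>v x = 0\<^sub>v n" using z(1)[OF i] quad[OF cS i] by (intro psd_null_vector[OF S x]) (simp add: x_def)
    have Tx: "T *\<^sub>v x = 0\<^sub>v n" using z(2)[OF i] quad[OF cT i] by (intro psd_null_vector[OF T x]) (simp add: x_def)
    have "D *\<^sub>v x = 0\<^sub>v n"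
      unfolding D_def using cS cT x Sx Tx by (simp add: minus_mult_distrib_mat_vec)
    then have "unit_vec n i \<bullet> (D *\<^sub>v x) = 0" by simp
    then have "x \<bullet> x = 0"
      using symmetric_scalar_prod[OF cD symD unit_vec_carrier x] by (simp add: x_def)
    then show ?thesis using scalar_prod_self_eq_0[OF x] by (simp add: x_def)
  qed
  have "D = 0\<^sub>m n n"
  proof (rule eq_matI)
    fix i j assume ij: "i < dim_row (0\<^sub>m n n :: real mat)" "j < dim_col (0\<^sub>m n n :: real mat)"
    have "D $$ (i, j) = (D *\<^sub>v unit_vec n j) $ i"
      using ij cD by (simp add: mult_unit_vec_eq_col[of _ n n])
    then show "D $$ (i, j) = 0\<^sub>m n n $$ (i, j)" using De[of j] ij by simp
  qed (use cD in auto)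
  then show ?thesis unfolding D_def
    by (metis D_def cS cT carrier_matD eq_matI index_minus_mat(1) index_zero_mat(1) right_minus_eq)
qed

text \<open>
  A complex eigenvalue exists by the fundamental theorem of algebra. Symmetry makes it real, and
  the real or the imaginary part of the eigenvector is then a real eigenvector.
\<close>

lemma symmetric_real_eigenvector:
  fixes A :: "real mat"
  assumes A: "A \<in> carrier_mat n n" and sym: "transpose_mat A = A" and n: "n \<ge> 1"
  shows "\<exists>v l. v \<in> carrier_vec n \<and> v \<bullet> v = 1 \<and> A *\<^sub>v v = l \<cdot>\<^sub>v v"
proof -
  define C where "C = map_mat complex_of_real A"
  have C: "C \<in> carrier_mat n n" using A by (simp add: C_def)
  obtain as where as: "char_poly C = (\<Prod>a\<leftarrow>as. [:- a, 1:])" "length as = n"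
    using char_poly_factorized[OF C] by blast
  then obtain z where "z \<in> set as" using n by (cases as) auto
  then have "poly (char_poly C) z = 0" unfolding as(1) poly_prod_list by (auto simp: prod_list_zero_iff)
  then have "eigenvalue C z" using eigenvalue_root_char_poly[OF C] by simp
  then obtain w where w: "w \<in> carrier_vec n" "w \<noteq> 0\<^sub>v n" "C *\<^sub>v w = z \<cdot>\<^sub>v w"
    unfolding eigenvalue_def eigenvector_def using C by auto
  define x y where "x = map_vec Re w" and "y = map_vec Im w"
  have x: "x \<in> carrier_vec n" and y: "y \<in> carrier_vec n" using w by (auto simp: x_def y_def)
  have comp: "(\<Sum>j<n. complex_of_real (A $$ (i, j)) * w $ j) = z * w $ i" if "i < n" for i
  proof -
    have "(C *\<^sub>v w) $ i = (z \<cdot>\<^sub>v w) $ i" using w(3) by simp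
    then show ?thesis using that C A w(1) by (simp add: C_def scalar_prod_def atLeast0LessThan)
  qed
  have Ax: "A *\<^sub>v x = Re z \<cdot>\<^sub>v x - Im z \<cdot>\<^sub>v y"
  proof (rule eq_vecI)
    fix i assume "i < dim_vec (Re z \<cdot>\<^sub>v x - Im z \<cdot>\<^sub>v y)"
    then have i: "i < n" using y by simp
    from arg_cong[OF comp[OF i], of Re] show "(A *\<^sub>v x) $ i = (Re z \<cdot>\<^sub>v x - Im z \<cdot>\<^sub>v y) $ i"
      using i A w(1) x y by (simp add: scalar_prod_def atLeast0LessThan x_def y_def)
  qed (use A x y in auto)
  have Ay: "A *\<^sub>v y = Re z \<cdot>\<^sub>v y + Im z \<cdot>\<^sub>v x"
  proof (rule eq_vecI)
    fix i assume "i < dim_vec (Re z \<cdot>\<^sub>v y + Im z \<cdot>\<^sub>v x)"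
    then have i: "i < n" using x by simp
    from arg_cong[OF comp[OF i], of Im] show "(A *\<^sub>v y) $ i = (Re z \<cdot>\<^sub>v y + Im z \<cdot>\<^sub>v x) $ i"
      using i A w(1) x y by (simp add: scalar_prod_def atLeast0LessThan x_def y_def)
  qed (use A x y in auto)
  have xy: "x \<noteq> 0\<^sub>v n \<or> y \<noteq> 0\<^sub>v n"
  proof (rule ccontr)
    assume "\<not> ?thesis"
    then have "\<forall>i<n. Re (w $ i) = 0 \<and> Im (w $ i) = 0"
      using w(1) by (metis carrier_vecD index_map_vec(1) index_zero_vec(1) x_def y_def)
    then have "w = 0\<^sub>v n" using w(1) by (intro eq_vecI) (auto simp: complex_eq_iff)
    with w(2) show False by simp
  qed
  have "(A *\<^sub>v x) \<bullet> y = x \<bullet> (A *\<^sub>v y)" by (rule symmetric_scalar_prod[OF A sym x y])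
  then have "Im z * (x \<bullet> x + y \<bullet> y) = 0"
    unfolding Ax Ay using x y
    by (simp add: minus_scalar_prod_distrib[of _ n] scalar_prod_add_distrib[of _ n] algebra_simps)
  moreover have "x \<bullet> x + y \<bullet> y \<noteq> 0"
  proof
    assume "x \<bullet> x + y \<bullet> y = 0"
    then have "x \<bullet> x = 0" "y \<bullet> y = 0"
      using add_nonneg_eq_0_iff[OF scalar_prod_self_nonneg[of x] scalar_prod_self_nonneg[of y]] by simp_all
    with xy show False using scalar_prod_self_eq_0[OF x] scalar_prod_self_eq_0[OF y] by blast
  qed
  ultimately have Im: "Im z = 0" by simp
  have "\<exists>u \<in> carrier_vec n. u \<noteq> 0\<^sub>v n \<and> A *\<^sub>v u = Re z \<cdot>\<^sub>v u"
  proof (cases "x = 0\<^sub>v n")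
    case False
    moreover have "A *\<^sub>v x = Re z \<cdot>\<^sub>v x" unfolding Ax Im using x y by (intro eq_vecI) auto
    ultimately show ?thesis using x by blast
  next
    case True
    moreover have "A *\<^sub>v y = Re z \<cdot>\<^sub>v y" unfolding Ay Im using x y by (intro eq_vecI) auto
    ultimately show ?thesis using y xy by blast
  qed
  then obtain u where u: "u \<in> carrier_vec n" "u \<noteq> 0\<^sub>v n" "A *\<^sub>v u = Re z \<cdot>\<^sub>v u" by blast
  have uu: "u \<bullet> u > 0"
    using scalar_prod_self_nonneg[of u] scalar_prod_self_eq_0[OF u(1)] u(2) by fastforce
  define v where "v = (1 / sqrt (u \<bullet> u)) \<cdot>\<^sub>v u"
  have "v \<in> carrier_vec n" using u by (simp add: v_def)
  moreover have "v \<bullet> v = 1" unfolding v_def using u uu by (simp add: real_sqrt_mult[symmetric])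
  moreover have "A *\<^sub>v v = Re z \<cdot>\<^sub>v v"
    unfolding v_def using u A by (simp add: mult_mat_vec[of _ n n] smult_smult_assoc mult.commute)
  ultimately show ?thesis by blast
qed

section \<open>Square roots of positive semidefinite matrices\<close>

lemma mat_eq_vecI:
  fixes A B :: "real mat"
  assumes "A \<in> carrier_mat m n" "B \<in> carrier_mat m n"
    and "\<And>x. x \<in> carrier_vec n \<Longrightarrow> A *\<^sub>v x = B *\<^sub>v x"
  shows "A = B"
proof (rule eq_matI)
  fix i j assume ij: "i < dim_row B" "j < dim_col B"
  then have "col A j = col B j"
    using assms(3)[of "unit_vec n j"] mult_unit_vec_eq_col[OF assms(1), of j] mult_unit_vec_eq_col[OF assms(2), of j] assms by auto
  then have "col A j $ i = col B j $ i" by simp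
  then show "A $$ (i, j) = B $$ (i, j)" using ij assms by simp
qed (use assms in auto)

text \<open>
  The reflection in the hyperplane orthogonal to \<open>v - e\<close>, which exchanges \<open>v\<close> with the first
  unit vector \<open>e\<close>. If \<open>v = e\<close>, the coefficient \<open>c = 2 / 0\<close> is \<open>0\<close> and the matrix is the identity.
\<close>

lemma householder_reflection:
  fixes v :: "real vec"
  assumes v: "v \<in> carrier_vec n" and v1: "v \<bullet> v = 1" and n: "n \<ge> 1"
  shows "\<exists>H \<in> carrier_mat n n. transpose_mat H = H \<and> H * H = 1\<^sub>m n \<and> H *\<^sub>v unit_vec n 0 = v"
proof -
  define e where "e = (unit_vec n 0 :: real vec)"
  define u where "u = v - e"
  define c where "c = 2 / (u \<bullet> u)"
  have e: "e \<in> carrier_vec n" by (simp add: e_def)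
  have u: "u \<in> carrier_vec n" using v e by (simp add: u_def)
  define H where "H = mat n n (\<lambda>(i, j). (if i = j then 1 else 0) - c * u $ i * u $ j)"
  have H: "H \<in> carrier_mat n n" by (simp add: H_def)
  have Hx: "H *\<^sub>v x = x - (c * (u \<bullet> x)) \<cdot>\<^sub>v u" if x: "x \<in> carrier_vec n" for x
  proof (rule eq_vecI)
    fix i assume "i < dim_vec (x - (c * (u \<bullet> x)) \<cdot>\<^sub>v u)"
    then have i: "i < n" using u by simp
    have "(H *\<^sub>v x) $ i = (\<Sum>j<n. ((if i = j then 1 else 0) - c * u $ i * u $ j) * x $ j)"
      using i x H by (simp add: scalar_prod_def atLeast0LessThan H_def)
    also have "\<dots> = (\<Sum>j<n. (if i = j then 1 else 0) * x $ j) - (\<Sum>j<n. c * u $ i * u $ j * x $ j)"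
      by (simp add: left_diff_distrib sum_subtractf)
    also have "(\<Sum>j<n. (if i = j then 1 else 0) * x $ j) = x $ i"
      using i by (simp add: if_distrib[of "\<lambda>y. y * _"] cong: if_cong)
    also have "(\<Sum>j<n. c * u $ i * u $ j * x $ j) = c * (u \<bullet> x) * u $ i"
      using x by (simp add: scalar_prod_def atLeast0LessThan sum_distrib_left sum_distrib_right mult_ac)
    finally show "(H *\<^sub>v x) $ i = (x - (c * (u \<bullet> x)) \<cdot>\<^sub>v u) $ i" using i x u by simp
  qed (use H u x in auto)
  have cuu: "c * (c * (u \<bullet> x) * (u \<bullet> u)) = 2 * (c * (u \<bullet> x))" for x
    by (cases "u \<bullet> u = 0") (simp_all add: c_def)
  have "H * H = 1\<^sub>m n"
  proof (rule mat_eq_vecI[of _ n n])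
    fix x :: "real vec" assume x: "x \<in> carrier_vec n"
    have "u \<bullet> (x - (c * (u \<bullet> x)) \<cdot>\<^sub>v u) = u \<bullet> x - c * (u \<bullet> x) * (u \<bullet> u)"
      using u x by (simp add: scalar_prod_minus_distrib[of _ n])
    then have *: "c * (u \<bullet> (x - (c * (u \<bullet> x)) \<cdot>\<^sub>v u)) = - (c * (u \<bullet> x))"
      using cuu[of x] by (simp add: right_diff_distrib)
    have "(H * H) *\<^sub>v x = H *\<^sub>v (H *\<^sub>v x)" using H x by simp
    also have "\<dots> = x" unfolding Hx[OF x]
      by (subst Hx) (use x u in \<open>auto simp: * intro!: eq_vecI\<close>)
    finally show "(H * H) *\<^sub>v x = 1\<^sub>m n *\<^sub>v x" using x by simp
  qed (use H in auto)
  moreover have "transpose_mat H = H" by (intro eq_matI) (auto simp: H_def)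
  moreover have "H *\<^sub>v e = v"
  proof (cases "u \<bullet> u = 0")
    case True
    then have "u = 0\<^sub>v n" by (rule scalar_prod_self_eq_0[OF u])
    then have eq: "\<And>i. i < n \<Longrightarrow> v $ i = e $ i" using v e unfolding u_def
      by (metis carrier_vecD index_minus_vec(1) index_zero_vec(1) right_minus_eq)
    show ?thesis unfolding Hx[OF e] using True e v u eq
      by (intro eq_vecI) (auto simp: c_def)
  next
    case False
    have ee: "e \<bullet> e = 1" using n by (simp add: e_def)
    have "u \<bullet> e = v \<bullet> e - 1" and "u \<bullet> u = 2 - 2 * (v \<bullet> e)"
      using v e v1 ee comm_scalar_prod[OF v e]
      by (auto simp: u_def minus_scalar_prod_distrib[of _ n] scalar_prod_minus_distrib[of _ n])
    then have "c * (u \<bullet> e) = - 1" using False by (simp add: c_def field_simps)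
    then show ?thesis unfolding Hx[OF e] using e v by (intro eq_vecI) (auto simp: u_def)
  qed
  ultimately show ?thesis using H by (auto simp: e_def)
qed

lemma psd_congruence:
  assumes A: "pos_semidef_mat n A" and H: "H \<in> carrier_mat n m"
  shows "pos_semidef_mat m (transpose_mat H * A * H)"
proof -
  note cA = psd_carrier[OF A]
  have HT: "transpose_mat H \<in> carrier_mat m n" using H by simp
  have "transpose_mat (transpose_mat H * A) = transpose_mat A * transpose_mat (transpose_mat H)"
    by (rule transpose_mult[OF HT cA])
  then have "transpose_mat (transpose_mat H * A * H) = transpose_mat H * (transpose_mat A * H)"
    using transpose_mult[OF mult_carrier_mat[OF HT cA] H] by simp
  also have "\<dots> = transpose_mat H * A * H"
    using H HT cA psd_symmetric[OF A] by simp
  finally have "transpose_mat (transpose_mat H * A * H) = transpose_mat H * A * H" .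
  moreover have "v \<bullet> ((transpose_mat H * A * H) *\<^sub>v v) \<ge> 0" if v: "v \<in> carrier_vec m" for v
  proof -
    have Hv: "H *\<^sub>v v \<in> carrier_vec n" by (rule mult_mat_vec_carrier[OF H v])
    have AHv: "A *\<^sub>v (H *\<^sub>v v) \<in> carrier_vec n" by (rule mult_mat_vec_carrier[OF cA Hv])
    have "(transpose_mat H * A * H) *\<^sub>v v = transpose_mat H *\<^sub>v (A *\<^sub>v (H *\<^sub>v v))"
      using H HT cA v Hv by (simp add: assoc_mult_mat_vec[of _ m n _ m] assoc_mult_mat_vec[of _ m n _ n])
    then have "v \<bullet> ((transpose_mat H * A * H) *\<^sub>v v) = (transpose_mat H *\<^sub>v (A *\<^sub>v (H *\<^sub>v v))) \<bullet> v"
      using comm_scalar_prod[OF v mult_mat_vec_carrier[OF HT AHv]] by simp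
    also have "\<dots> = (A *\<^sub>v (H *\<^sub>v v)) \<bullet> (H *\<^sub>v v)"
      by (rule transpose_vec_mult_scalar[OF H v AHv])
    also have "\<dots> = (H *\<^sub>v v) \<bullet> (A *\<^sub>v (H *\<^sub>v v))" by (rule comm_scalar_prod[OF AHv Hv])
    also have "\<dots> \<ge> 0" by (rule psd_nonneg[OF A Hv])
    finally show ?thesis .
  qed
  ultimately show ?thesis using H HT cA unfolding pos_semidef_mat_def by auto
qed

definition bordered :: "real \<Rightarrow> nat \<Rightarrow> real mat \<Rightarrow> real mat" where
  "bordered l n R = four_block_mat (l \<cdot>\<^sub>m 1\<^sub>m 1) (0\<^sub>m 1 n) (0\<^sub>m n 1) R"

lemma bordered_quadratic:
  assumes R: "R \<in> carrier_mat n n" and a: "a \<in> carrier_vec 1" and b: "b \<in> carrier_vec n"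
  shows "(a @\<^sub>v b) \<bullet> (bordered l n R *\<^sub>v (a @\<^sub>v b)) = l * (a \<bullet> a) + b \<bullet> (R *\<^sub>v b)"
proof -
  have Rb: "R *\<^sub>v b \<in> carrier_vec n" by (rule mult_mat_vec_carrier[OF R b])
  have 1: "(l \<cdot>\<^sub>m 1\<^sub>m 1) *\<^sub>v a + 0\<^sub>m 1 n *\<^sub>v b = l \<cdot>\<^sub>v a"
    using a b by (intro eq_vecI) (auto simp: scalar_prod_def)
  have 2: "0\<^sub>m n 1 *\<^sub>v a + R *\<^sub>v b = R *\<^sub>v b"
    using a b R by (intro eq_vecI) (auto simp: scalar_prod_def)
  have "bordered l n R *\<^sub>v (a @\<^sub>v b) = (l \<cdot>\<^sub>v a) @\<^sub>v (R *\<^sub>v b)"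
    unfolding bordered_def using a b R
    by (subst four_block_mat_mult_vec[of _ 1 1 _ n _ n]) (auto simp: 1 2)
  then show ?thesis using a b Rb
    by (simp add: scalar_prod_append[of _ 1 _ n])
qed

lemma bordered_psd_iff:
  assumes R: "R \<in> carrier_mat n n"
  shows "pos_semidef_mat (Suc n) (bordered l n R) \<longleftrightarrow> l \<ge> 0 \<and> pos_semidef_mat n R"
proof
  assume *: "pos_semidef_mat (Suc n) (bordered l n R)"
  have q: "l * (a \<bullet> a) + b \<bullet> (R *\<^sub>v b) \<ge> 0" if "a \<in> carrier_vec 1" "b \<in> carrier_vec n" for a b
  proof -
    have "a @\<^sub>v b \<in> carrier_vec (Suc n)" using append_carrier_vec[OF that] by simp
    then show ?thesis using psd_nonneg[OF *] bordered_quadratic[OF R that, of l] by metis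
  qed
  have "l \<ge> 0" using q[of "unit_vec 1 0" "0\<^sub>v n"] R by simp
  moreover have "transpose_mat R = R"
  proof (rule eq_matI)
    fix i j assume ij: "i < dim_row R" "j < dim_col R"
    have "transpose_mat (bordered l n R) $$ (Suc i, Suc j) = bordered l n R $$ (Suc i, Suc j)"
      using psd_symmetric[OF *] by simp
    then show "transpose_mat R $$ (i, j) = R $$ (i, j)" using ij R by (simp add: bordered_def)
  qed (use R in auto)
  moreover have "v \<bullet> (R *\<^sub>v v) \<ge> 0" if "v \<in> carrier_vec n" for v
    using q[of "0\<^sub>v 1" v] that by simp
  ultimately show "l \<ge> 0 \<and> pos_semidef_mat n R" using R by (simp add: pos_semidef_mat_def)
next
  assume *: "l \<ge> 0 \<and> pos_semidef_mat n R"
  have "transpose_mat (bordered l n R) = bordered l n R"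
    unfolding bordered_def using R psd_symmetric[of n R] *
    by (subst transpose_four_block_mat[of _ 1 1 _ n _ n]) (auto intro!: arg_cong2[of _ _ _ _ "\<lambda>x y. four_block_mat x _ _ y"] eq_matI)
  moreover have "v \<bullet> (bordered l n R *\<^sub>v v) \<ge> 0" if v: "v \<in> carrier_vec (Suc n)" for v
  proof -
    define a b where "a = vec_first v 1" and "b = vec_last v n"
    have "v = a @\<^sub>v b" unfolding a_def b_def using v by simp
    moreover have ab: "a \<in> carrier_vec 1" "b \<in> carrier_vec n" by (auto simp: a_def b_def)
    ultimately show ?thesis using bordered_quadratic[OF R ab, of l] * psd_nonneg[of n R b] scalar_prod_self_nonneg[of a] ab
      by simp
  qed
  moreover have "bordered l n R \<in> carrier_mat (Suc n) (Suc n)"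
    unfolding bordered_def using R four_block_carrier_mat[of "l \<cdot>\<^sub>m 1\<^sub>m 1" 1 1 R n n] by simp
  ultimately show "pos_semidef_mat (Suc n) (bordered l n R)" by (simp add: pos_semidef_mat_def)
qed

lemma bordered_mult:
  assumes R: "R \<in> carrier_mat n n"
  shows "bordered l n R * bordered l n R = bordered (l * l) n (R * R)"
  unfolding bordered_def using R
  by (subst mult_four_block_mat[of _ 1 1 _ n _ n _ _ 1 _ n])
     (auto intro!: arg_cong2[of _ _ _ _ "\<lambda>x y. four_block_mat x _ _ y"] eq_matI simp: scalar_prod_def)

lemma eigenvector_unit_bordered:
  assumes B: "B \<in> carrier_mat (Suc n) (Suc n)" and sym: "transpose_mat B = B"
    and ev: "B *\<^sub>v unit_vec (Suc n) 0 = l \<cdot>\<^sub>v unit_vec (Suc n) 0"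
  shows "\<exists>C \<in> carrier_mat n n. B = bordered l n C"
proof -
  define C where "C = mat n n (\<lambda>(i, j). B $$ (Suc i, Suc j))"
  have col0: "B $$ (i, 0) = (if i = 0 then l else 0)" if "i < Suc n" for i
  proof -
    have "B $$ (i, 0) = (B *\<^sub>v unit_vec (Suc n) 0) $ i"
      using B that mult_unit_vec_eq_col[OF B, of 0] by simp
    then show ?thesis unfolding ev using that by simp
  qed
  have row0: "B $$ (0, i) = (if i = 0 then l else 0)" if "i < Suc n" for i
    using col0[OF that] sym B that by (metis carrier_matD index_transpose_mat(1) zero_less_Suc)
  have "B = bordered l n C"
  proof (rule eq_matI)
    fix i j assume "i < dim_row (bordered l n C)" "j < dim_col (bordered l n C)"
    then have ij: "i < Suc n" "j < Suc n" by (auto simp: bordered_def C_def)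
    then show "B $$ (i, j) = bordered l n C $$ (i, j)"
      using col0[of i] row0[of j] by (auto simp: bordered_def C_def)
  qed (use B in \<open>auto simp: bordered_def C_def\<close>)
  moreover have "C \<in> carrier_mat n n" by (simp add: C_def)
  ultimately show ?thesis by blast
qed

text \<open>
  Induction on the dimension: a Householder reflection moves a unit eigenvector to the first
  coordinate axis, where the matrix splits off its eigenvalue as a \<open>1 \<times> 1\<close> block.
\<close>

lemma psd_sqrt_exists: "pos_semidef_mat n A \<Longrightarrow> \<exists>S. pos_semidef_mat n S \<and> S * S = A"
proof (induction n arbitrary: A)
  case 0
  then have "A * A = A" by (intro eq_matI) (auto simp: pos_semidef_mat_def)
  with 0 show ?case by blast
next
  case (Suc n)
  note cA = psd_carrier[OF Suc.prems]
  obtain v l where v: "v \<in> carrier_vec (Suc n)" "v \<bullet> v = 1" "A *\<^sub>v v = l \<cdot>\<^sub>v v"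
    using symmetric_real_eigenvector[OF cA psd_symmetric[OF Suc.prems]] by auto
  obtain H where H: "H \<in> carrier_mat (Suc n) (Suc n)" "transpose_mat H = H" "H * H = 1\<^sub>m (Suc n)"
      and Hv: "H *\<^sub>v unit_vec (Suc n) 0 = v"
    using householder_reflection[OF v(1,2)] by auto
  define B where "B = H * A * H"
  have B: "pos_semidef_mat (Suc n) B"
    using psd_congruence[OF Suc.prems H(1)] by (simp add: B_def H(2))
  have "B *\<^sub>v unit_vec (Suc n) 0 = H *\<^sub>v (A *\<^sub>v v)"
    unfolding B_def Hv[symmetric] using H(1) cA
    by (simp add: assoc_mult_mat_vec[of _ "Suc n" "Suc n" _ "Suc n"] mult_mat_vec_carrier[of _ "Suc n" "Suc n"])
  also have "\<dots> = l \<cdot>\<^sub>v (H *\<^sub>v v)" unfolding v(3) by (rule mult_mat_vec[OF H(1) v(1)])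
  also have "H *\<^sub>v v = unit_vec (Suc n) 0"
  proof -
    have "H *\<^sub>v v = (H * H) *\<^sub>v unit_vec (Suc n) 0"
      unfolding Hv[symmetric] by (rule assoc_mult_mat_vec[OF H(1) H(1), symmetric]) simp
    then show ?thesis by (simp add: H(3))
  qed
  finally obtain C where C: "C \<in> carrier_mat n n" "B = bordered l n C"
    using eigenvector_unit_bordered[OF psd_carrier[OF B] psd_symmetric[OF B]] by blast
  then have l: "l \<ge> 0" and "pos_semidef_mat n C" using B bordered_psd_iff[OF C(1), of l] by auto
  then obtain R where R: "pos_semidef_mat n R" "R * R = C" using Suc.IH by blast
  define S' where "S' = bordered (sqrt l) n R"
  have S': "pos_semidef_mat (Suc n) S'"
    unfolding S'_def using R l bordered_psd_iff[OF psd_carrier[OF R(1)]] by simp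
  have S'2: "S' * S' = B"
    unfolding S'_def bordered_mult[OF psd_carrier[OF R(1)]] using R l C by simp
  note cS' = psd_carrier[OF S']
  define S where "S = H * S' * H"
  have "pos_semidef_mat (Suc n) S"
    using psd_congruence[OF S' H(1)] by (simp add: S_def H(2))
  moreover have "S * S = A"
  proof -
    let ?N = "Suc n"
    have c: "H * S' \<in> carrier_mat ?N ?N" "H * A \<in> carrier_mat ?N ?N" "S' * H \<in> carrier_mat ?N ?N" "A * H \<in> carrier_mat ?N ?N"
      using H cS' cA by auto
    have "S * S = H * S' * (H * (H * (S' * H)))"
      unfolding S_def using H(1) cS' c by (simp add: assoc_mult_mat[of _ ?N ?N _ ?N _ ?N])
    also have "H * (H * (S' * H)) = (H * H) * (S' * H)"
      by (rule assoc_mult_mat[OF H(1) H(1) c(3), symmetric])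
    also have "\<dots> = S' * H" unfolding H(3) by (rule left_mult_one_mat[OF c(3)])
    also have "H * S' * (S' * H) = H * (S' * S') * H"
      using H(1) cS' c by (simp add: assoc_mult_mat[of _ ?N ?N _ ?N _ ?N])
    also have "\<dots> = (H * H) * A * (H * H)"
      unfolding S'2 B_def using H(1) cA c by (simp add: assoc_mult_mat[of _ ?N ?N _ ?N _ ?N])
    also have "\<dots> = A" using cA by (simp add: H(3))
    finally show ?thesis .
  qed
  ultimately show ?case by blast
qed

lemma mat_sqrt:
  assumes "pos_semidef_mat n A"
  shows "pos_semidef_mat n (mat_sqrt A)" "mat_sqrt A * mat_sqrt A = A"
proof -
  have "\<exists>!S. pos_semidef_mat (dim_row A) S \<and> S * S = A"
    using psd_sqrt_exists[OF assms] psd_sqrt_unique[of n] psd_carrier[OF assms] by (metis carrier_matD(1))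
  from theI'[OF this] show "pos_semidef_mat n (mat_sqrt A)" "mat_sqrt A * mat_sqrt A = A"
    using psd_carrier[OF assms] by (auto simp: mat_sqrt_def)
qed

lemma mat_inv_eqI:
  assumes A: "A \<in> carrier_mat n n" and B: "B \<in> carrier_mat n n" and "A * B = 1\<^sub>m n" "B * A = 1\<^sub>m n"
  shows "mat_inv A = B"
proof -
  have "A \<in> Units (ring_mat TYPE(real) n ())"
    using assms by (auto simp: Units_def ring_mat_simps)
  then obtain C where C: "mat_inverse A = Some C" using mat_inverse(1)[OF A, where b="()"] by (cases "mat_inverse A") auto
  from mat_inverse(2)[OF A this] have C': "A * C = 1\<^sub>m n" "C * A = 1\<^sub>m n" "C \<in> carrier_mat n n" by auto
  have "C = (B * A) * C" using C' assms by simp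
  also have "\<dots> = B" using A B C' by (simp add: assoc_mult_mat[of _ n n _ n _ n])
  finally show ?thesis by (simp add: mat_inv_def C)
qed

lemma pos_def_imp_psd: "pos_def_mat n A \<Longrightarrow> pos_semidef_mat n A"
  unfolding pos_def_mat_def pos_semidef_mat_def
proof (elim conjE, intro conjI ballI)
  fix v :: "real vec" assume *: "A \<in> carrier_mat n n" "\<forall>v\<in>carrier_vec n. v \<noteq> 0\<^sub>v n \<longrightarrow> 0 < v \<bullet> (A *\<^sub>v v)" "v \<in> carrier_vec n"
  show "0 \<le> v \<bullet> (A *\<^sub>v v)"
  proof (cases "v = 0\<^sub>v n")
    case True
    then show ?thesis using mult_mat_vec_carrier[OF *(1,3)] by simp
  next
    case False
    then show ?thesis using * by force
  qed
qed

text \<open>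
  The kernel of the square root \<open>S\<close> lies in that of \<open>A\<close>, so that \<open>S\<close> is invertible; its inverse
  \<open>W\<close> inherits symmetry, and the remaining claims follow from \<open>S * S = A\<close>.
\<close>

lemma mat_inv_sqrt:
  assumes A: "pos_def_mat n A"
  defines "W \<equiv> mat_inv_sqrt A"
  shows "W \<in> carrier_mat n n" "transpose_mat W = W" "W * A * W = 1\<^sub>m n" "mat_inv A = W * W"
proof -
  define S where "S = mat_sqrt A"
  have psd: "pos_semidef_mat n A" by (rule pos_def_imp_psd[OF A])
  have S: "pos_semidef_mat n S" "S * S = A" unfolding S_def using mat_sqrt[OF psd] by auto
  note cS = psd_carrier[OF S(1)] and cA = psd_carrier[OF psd]
  have "det S \<noteq> 0"
  proof
    assume "det S = 0"
    then obtain v where v: "v \<in> carrier_vec n" "v \<noteq> 0\<^sub>v n" "S *\<^sub>v v = 0\<^sub>v n"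
      using det_0_iff_vec_prod_zero[OF cS] by auto
    have "A *\<^sub>v v = S *\<^sub>v (S *\<^sub>v v)" using assoc_mult_mat_vec[OF cS cS v(1)] S(2) by simp
    also have "\<dots> = 0\<^sub>v n" using v cS by (intro eq_vecI) (auto simp: scalar_prod_def)
    finally have "v \<bullet> (A *\<^sub>v v) = 0" using v by simp
    moreover have "v \<bullet> (A *\<^sub>v v) > 0" using A v by (auto simp: pos_def_mat_def)
    ultimately show False by simp
  qed
  then have "S \<in> Units (ring_mat TYPE(real) n ())" by (rule det_non_zero_imp_unit[OF cS])
  then obtain C where C: "C \<in> carrier_mat n n" "S * C = 1\<^sub>m n" "C * S = 1\<^sub>m n"
    by (auto simp: Units_def ring_mat_simps)
  have W: "W = C" unfolding W_def mat_inv_sqrt_def S_def[symmetric]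
    by (rule mat_inv_eqI[OF cS C(1,2,3)])
  show cW: "W \<in> carrier_mat n n" using C W by simp
  have WS: "W * S = 1\<^sub>m n" "S * W = 1\<^sub>m n" using C W by auto
  have t: "transpose_mat W * S = 1\<^sub>m n"
    using transpose_mult[OF cS cW] WS psd_symmetric[OF S(1)] by simp
  have cWT: "transpose_mat W \<in> carrier_mat n n" using cW by simp
  have "transpose_mat W = transpose_mat W * (S * W)" using WS cWT by simp
  also have "\<dots> = W" using t cWT cS cW by (simp add: assoc_mult_mat[of _ n n _ n _ n, symmetric])
  finally show "transpose_mat W = W" .
  have "W * A * W = (W * S) * (S * W)"
    unfolding S(2)[symmetric] using cW cS by (simp add: assoc_mult_mat[of _ n n _ n _ n])
  then show "W * A * W = 1\<^sub>m n" using WS by simp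
  show "mat_inv A = W * W"
  proof (rule mat_inv_eqI[OF cA])
    have "A * (W * W) = S * ((S * W) * W)"
      unfolding S(2)[symmetric] using cW cS by (simp add: assoc_mult_mat[of _ n n _ n _ n])
    then show "A * (W * W) = 1\<^sub>m n" using WS cW by simp
    have "W * W * A = W * ((W * S) * S)"
      unfolding S(2)[symmetric] using cW cS by (simp add: assoc_mult_mat[of _ n n _ n _ n])
    then show "W * W * A = 1\<^sub>m n" using WS cS by simp
  qed (use cW in auto)
qed

section \<open>Lebesgue measure on vectors and multivariate normal laws\<close>

text \<open>
  Functions in the space of the product measure agree outside \<open>{..<n}\<close>, which is where \<open>vec n\<close>
  forgets their values.
\<close>

lemma inj_on_vec: "inj_on (vec n) (space (\<Pi>\<^sub>M i\<in>{..<n}. N))"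
proof (rule inj_onI)
  fix x y :: "nat \<Rightarrow> 'a" 
  assume x: "x \<in> space (\<Pi>\<^sub>M i\<in>{..<n}. N)" and y: "y \<in> space (\<Pi>\<^sub>M i\<in>{..<n}. N)" and eq: "vec n x = vec n y"
  show "x = y"
  proof
    fix i
    show "x i = y i"
    proof (cases "i < n")
      case True
      then show ?thesis using eq by (metis index_vec)
    next
      case False
      then show ?thesis using x y by (auto simp: space_PiM PiE_def extensional_def)
    qed
  qed
qed

lemma space_lborel_vec: "space (lborel_vec n) = carrier_vec n"
proof -
  have "vec n ` (PiE {..<n} (\<lambda>_. UNIV)) = (carrier_vec n :: real vec set)"
  proof (intro equalityI subsetI)
    fix v :: "real vec" assume v: "v \<in> carrier_vec n"
    then have "v = vec n (restrict (\<lambda>i. v $ i) {..<n})" by (intro eq_vecI) auto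
    moreover have "restrict (\<lambda>i. v $ i) {..<n} \<in> PiE {..<n} (\<lambda>_. UNIV)" by simp
    ultimately show "v \<in> vec n ` (PiE {..<n} (\<lambda>_. UNIV))" by blast
  next
    fix v :: "real vec" assume "v \<in> vec n ` (PiE {..<n} (\<lambda>_. UNIV))"
    then obtain x where "v = vec n x" by blast
    then show "v \<in> carrier_vec n" by simp
  qed
  then show ?thesis by (simp add: lborel_vec_def space_embed_measure space_PiM)
qed

lemma measurable_vec: "vec n \<in> lborel_fun n \<rightarrow>\<^sub>M lborel_vec n"
  unfolding lborel_vec_def by (rule measurable_embed_measure2'[OF inj_on_vec])

lemma measurable_coordinate: "i < n \<Longrightarrow> (\<lambda>v. v $ i) \<in> borel_measurable (lborel_vec n)"
  unfolding lborel_vec_def by (rule measurable_embed_measure1) simp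

lemma measurable_lborel_vecI:
  assumes "\<And>i. i < n \<Longrightarrow> (\<lambda>\<omega>. f \<omega> $ i) \<in> borel_measurable M"
    and "\<And>\<omega>. \<omega> \<in> space M \<Longrightarrow> f \<omega> \<in> carrier_vec n"
  shows "f \<in> M \<rightarrow>\<^sub>M lborel_vec n"
proof -
  have "(\<lambda>\<omega>. \<lambda>i\<in>{..<n}. f \<omega> $ i) \<in> M \<rightarrow>\<^sub>M lborel_fun n"
    using assms(1) by (intro measurable_restrict) auto
  from measurable_compose[OF this measurable_vec]
  have "(\<lambda>\<omega>. vec n (\<lambda>i\<in>{..<n}. f \<omega> $ i)) \<in> M \<rightarrow>\<^sub>M lborel_vec n" .
  also have "?this \<longleftrightarrow> ?thesis"
    using carrier_vecD[OF assms(2)] by (intro measurable_cong eq_vecI) auto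
  finally show ?thesis .
qed

lemma measurable_coordinate': 
  "f \<in> M \<rightarrow>\<^sub>M lborel_vec n \<Longrightarrow> i < n \<Longrightarrow> (\<lambda>\<omega>. f \<omega> $ i) \<in> borel_measurable M"
  by (rule measurable_compose[OF _ measurable_coordinate])

lemma measurable_carrier: "f \<in> M \<rightarrow>\<^sub>M lborel_vec n \<Longrightarrow> \<omega> \<in> space M \<Longrightarrow> f \<omega> \<in> carrier_vec n"
  using measurable_space[of f M "lborel_vec n" \<omega>] by (simp add: space_lborel_vec)

lemma measurable_append:
  assumes "X \<in> M \<rightarrow>\<^sub>M lborel_vec p" "Y \<in> M \<rightarrow>\<^sub>M lborel_vec q"
  shows "(\<lambda>\<omega>. X \<omega> @\<^sub>v Y \<omega>) \<in> M \<rightarrow>\<^sub>M lborel_vec (p + q)"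
proof (rule measurable_lborel_vecI)
  show "X \<omega> @\<^sub>v Y \<omega> \<in> carrier_vec (p + q)" if "\<omega> \<in> space M" for \<omega>
    using measurable_carrier[OF assms(1) that] measurable_carrier[OF assms(2) that] by simp
  fix i assume i: "i < p + q"
  have "(\<lambda>\<omega>. if i < p then X \<omega> $ i else Y \<omega> $ (i - p)) \<in> borel_measurable M"
    using measurable_coordinate'[OF assms(1), of i] measurable_coordinate'[OF assms(2), of "i - p"] i
    by (cases "i < p") auto
  also have "?this \<longleftrightarrow> (\<lambda>\<omega>. (X \<omega> @\<^sub>v Y \<omega>) $ i) \<in> borel_measurable M"
    using i carrier_vecD[OF measurable_carrier[OF assms(1)]] carrier_vecD[OF measurable_carrier[OF assms(2)]]
    by (intro measurable_cong) auto
  finally show "(\<lambda>\<omega>. (X \<omega> @\<^sub>v Y \<omega>) $ i) \<in> borel_measurable M" .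
qed

lemma measurable_affine:
  assumes "\<mu> \<in> carrier_vec n" "S \<in> carrier_mat n n"
  shows "(\<lambda>z. \<mu> + S *\<^sub>v z) \<in> lborel_vec n \<rightarrow>\<^sub>M lborel_vec n"
proof (rule measurable_lborel_vecI)
  show "\<mu> + S *\<^sub>v z \<in> carrier_vec n" if "z \<in> space (lborel_vec n)" for z
    using that assms by (simp add: space_lborel_vec mult_mat_vec_carrier[of _ n n])
  fix i assume i: "i < n"
  have "(\<lambda>z. \<mu> $ i + (\<Sum>k<n. S $$ (i, k) * z $ k)) \<in> borel_measurable (lborel_vec n)"
    by (intro borel_measurable_add borel_measurable_const borel_measurable_sum borel_measurable_times measurable_coordinate) auto
  also have "?this \<longleftrightarrow> (\<lambda>z. (\<mu> + S *\<^sub>v z) $ i) \<in> borel_measurable (lborel_vec n)"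
    using i assms by (intro measurable_cong) (auto simp: space_lborel_vec scalar_prod_def atLeast0LessThan)
  finally show "(\<lambda>z. (\<mu> + S *\<^sub>v z) $ i) \<in> borel_measurable (lborel_vec n)" .
qed

lemma nn_integral_lborel_vec:
  "f \<in> borel_measurable (lborel_vec n) \<Longrightarrow> (\<integral>\<^sup>+v. f v \<partial>lborel_vec n) = (\<integral>\<^sup>+x. f (vec n x) \<partial>lborel_fun n)"
  unfolding lborel_vec_def by (rule nn_integral_embed_measure'[OF inj_on_vec])

lemma sigma_finite_lborel_vec: "sigma_finite_measure (lborel_vec n)"
proof -
  interpret sigma_finite_measure "lborel_fun n" by (rule sigma_finite_lborel_fun)
  obtain A where A: "countable A" "A \<subseteq> sets (lborel_fun n)" "\<Union>A = space (lborel_fun n)"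
      "\<And>a. a \<in> A \<Longrightarrow> emeasure (lborel_fun n) a \<noteq> \<infinity>"
    using sigma_finite_countable by blast
  show ?thesis
  proof (intro sigma_finite_measure.intro exI[of _ "(`) (vec n) ` A"] conjI ballI)
    show "countable ((`) (vec n) ` A)" using A(1) by simp
    show "(`) (vec n) ` A \<subseteq> sets (lborel_vec n)"
      using A(2) unfolding lborel_vec_def by (auto intro!: in_sets_embed_measure)
    show "\<Union> ((`) (vec n) ` A) = space (lborel_vec n)"
      using A(3) unfolding lborel_vec_def space_embed_measure by blast
    show "emeasure (lborel_vec n) a \<noteq> \<infinity>" if a: "a \<in> (`) (vec n) ` A" for a
    proof -
      obtain b where b: "b \<in> A" "a = vec n ` b" using a by blast
      then have "emeasure (lborel_vec n) a = emeasure (lborel_fun n) b"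
        unfolding lborel_vec_def using A(2) emeasure_embed_measure_image'[OF inj_on_vec, of b n lborel] by blast
      then show ?thesis using A(4) b by simp
    qed
  qed
qed

lemma sets_std_normal_vec: "sets (std_normal_vec n) = sets (lborel_vec n)"
proof -
  have "sets (\<Pi>\<^sub>M i\<in>{..<n}. density lborel std_normal_density) = sets (lborel_fun n)"
    by (intro sets_PiM_cong) auto
  then show ?thesis
    unfolding std_normal_vec_def lborel_vec_def sets_embed_measure'[OF inj_on_vec] by simp
qed

abbreviation std_normal_fun :: "nat \<Rightarrow> (nat \<Rightarrow> real) measure" where
  "std_normal_fun n \<equiv> \<Pi>\<^sub>M i\<in>{..<n}. std_normal_distribution"

lemma has_bochner_integral_multivariate_normal:
  fixes g :: "real vec \<Rightarrow> 'b :: {banach, second_countable_topology}"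
  assumes g: "g \<in> borel_measurable (lborel_vec n)" and \<mu>: "\<mu> \<in> carrier_vec n" and \<Sigma>: "pos_semidef_mat n \<Sigma>"
    and h: "has_bochner_integral (std_normal_fun n) (\<lambda>x. g (\<mu> + mat_sqrt \<Sigma> *\<^sub>v vec n x)) I"
  shows "has_bochner_integral (multivariate_normal n \<mu> \<Sigma>) g I"
proof -
  let ?T = "\<lambda>z. \<mu> + mat_sqrt \<Sigma> *\<^sub>v z"
  have T: "?T \<in> std_normal_vec n \<rightarrow>\<^sub>M lborel_vec n"
    using measurable_affine[OF \<mu> psd_carrier[OF mat_sqrt(1)[OF \<Sigma>]]]
    by (simp add: measurable_cong_sets[OF sets_std_normal_vec refl])
  have gT: "(\<lambda>z. g (?T z)) \<in> borel_measurable (std_normal_vec n)"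
    by (rule measurable_compose[OF T g])
  have V: "vec n \<in> std_normal_fun n \<rightarrow>\<^sub>M std_normal_vec n"
    unfolding std_normal_vec_def by (rule measurable_embed_measure2'[OF inj_on_vec])
  have E: "std_normal_vec n = distr (std_normal_fun n) (std_normal_vec n) (vec n)"
    unfolding std_normal_vec_def by (rule embed_measure_eq_distr'[OF inj_on_vec])
  have "has_bochner_integral (distr (std_normal_fun n) (std_normal_vec n) (vec n)) (\<lambda>z. g (?T z)) I"
    using h integrable_distr_eq[OF V gT] integral_distr[OF V gT] by (simp add: has_bochner_integral_iff)
  then have "has_bochner_integral (std_normal_vec n) (\<lambda>z. g (?T z)) I"
    unfolding E[symmetric] .
  then show ?thesis
    unfolding multivariate_normal_def
    using integrable_distr_eq[OF T g] integral_distr[OF T g] by (simp add: has_bochner_integral_iff)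
qed

lemma std_normal_moments:
  "has_bochner_integral std_normal_distribution (\<lambda>_. 1) (1 :: real)"
  "has_bochner_integral std_normal_distribution (\<lambda>x. x) (0 :: real)"
  "has_bochner_integral std_normal_distribution (\<lambda>x. x\<^sup>2) (1 :: real)"
  using std_normal_moment_even[of 0] std_normal_moment_odd[of 0] std_normal_moment_even[of 1]
  by (simp_all add: has_bochner_integral_density)

lemma prob_space_std_normal: "prob_space std_normal_distribution"
  by (rule prob_space_normal_density) simp

lemma sigma_finite_std_normal: "sigma_finite_measure std_normal_distribution"
  using prob_space_std_normal by (simp add: prob_space_def finite_measure_def)

lemma product_sigma_finite_std_normal: "product_sigma_finite (\<lambda>i::nat. std_normal_distribution)"
  using sigma_finite_std_normal by (simp add: product_sigma_finite_def)

lemma std_normal_fun_second_moment: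
  assumes "k < n" "l < n"
  shows "has_bochner_integral (std_normal_fun n) (\<lambda>x. x k * x l) (if k = l then 1 else 0)"
  using has_bochner_integral_PiM_second_moment[OF sigma_finite_std_normal, of "\<lambda>_. 1" 1 1 k n l]
    std_normal_moments assms by (auto split: if_splits)

lemma std_normal_fun_first_moment:
  assumes "k < n"
  shows "has_bochner_integral (std_normal_fun n) (\<lambda>x. x k) 0"
proof -
  have "has_bochner_integral (std_normal_fun n) (\<lambda>x. \<Prod>i<n. if i = k then x i else 1) (\<Prod>i<n. if i = k then 0 else 1)"
    by (intro has_bochner_integral_PiM_prod product_sigma_finite_std_normal) (auto simp: std_normal_moments)
  then show ?thesis using assms by simp
qed

lemma std_normal_fun_const: "has_bochner_integral (std_normal_fun n) (\<lambda>x. c) (c :: real)"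
proof -
  interpret prob_space "std_normal_fun n"
    by (intro prob_space_PiM prob_space_std_normal)
  show ?thesis using prob_space by (simp add: has_bochner_integral_iff)
qed

lemma affine_coordinate:
  assumes "i < n" "\<mu> \<in> carrier_vec n" "S \<in> carrier_mat n n"
  shows "(\<mu> + S *\<^sub>v vec n x) $ i = \<mu> $ i + (\<Sum>k<n. S $$ (i, k) * x k)"
  using assms by (simp add: scalar_prod_def atLeast0LessThan)

lemma multivariate_normal_mean:
  assumes \<mu>: "\<mu> \<in> carrier_vec n" and \<Sigma>: "pos_semidef_mat n \<Sigma>" and i: "i < n"
  shows "has_bochner_integral (multivariate_normal n \<mu> \<Sigma>) (\<lambda>v. v $ i) (\<mu> $ i)"
proof (rule has_bochner_integral_multivariate_normal[OF measurable_coordinate[OF i] \<mu> \<Sigma>])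
  note S = psd_carrier[OF mat_sqrt(1)[OF \<Sigma>]]
  have "has_bochner_integral (std_normal_fun n) (\<lambda>x. \<mu> $ i + (\<Sum>k<n. mat_sqrt \<Sigma> $$ (i, k) * x k))
     (\<mu> $ i + (\<Sum>k<n. mat_sqrt \<Sigma> $$ (i, k) * 0))"
    by (intro has_bochner_integral_add has_bochner_integral_sum has_bochner_integral_mult_right
        std_normal_fun_first_moment std_normal_fun_const) auto
  then show "has_bochner_integral (std_normal_fun n) (\<lambda>x. (\<mu> + mat_sqrt \<Sigma> *\<^sub>v vec n x) $ i) (\<mu> $ i)"
    by (simp add: affine_coordinate[OF i \<mu> S])
qed

lemma multivariate_normal_covariance:
  assumes \<mu>: "\<mu> \<in> carrier_vec n" and \<Sigma>: "pos_semidef_mat n \<Sigma>" and i: "i < n" and j: "j < n"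
  shows "has_bochner_integral (multivariate_normal n \<mu> \<Sigma>) (\<lambda>v. (v $ i - \<mu> $ i) * (v $ j - \<mu> $ j)) (\<Sigma> $$ (i, j))"
proof (rule has_bochner_integral_multivariate_normal[OF _ \<mu> \<Sigma>])
  define S where "S = mat_sqrt \<Sigma>"
  have S: "S \<in> carrier_mat n n" "transpose_mat S = S" "S * S = \<Sigma>"
    using mat_sqrt[OF \<Sigma>] psd_carrier psd_symmetric unfolding S_def by auto
  show "(\<lambda>v. (v $ i - \<mu> $ i) * (v $ j - \<mu> $ j)) \<in> borel_measurable (lborel_vec n)"
    using i j by (intro borel_measurable_times borel_measurable_diff measurable_coordinate borel_measurable_const)
  have "has_bochner_integral (std_normal_fun n) (\<lambda>x. \<Sum>k<n. \<Sum>l<n. S $$ (i, k) * S $$ (j, l) * (x k * x l))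
     (\<Sum>k<n. \<Sum>l<n. S $$ (i, k) * S $$ (j, l) * (if k = l then 1 else 0))"
    by (intro has_bochner_integral_sum has_bochner_integral_mult_right std_normal_fun_second_moment) auto
  moreover have "(\<Sum>k<n. \<Sum>l<n. S $$ (i, k) * S $$ (j, l) * (if k = l then 1 else 0)) = \<Sigma> $$ (i, j)"
  proof -
    have "S $$ (l, j) = S $$ (j, l)" if "l < n" for l
      using S(1,2) j that by (metis carrier_matD index_transpose_mat(1))
    then have "\<Sigma> $$ (i, j) = (\<Sum>k<n. S $$ (i, k) * S $$ (j, k))"
      unfolding S(3)[symmetric] using S(1) i j by (simp add: scalar_prod_def atLeast0LessThan)
    then show ?thesis by (simp add: if_distrib cong: if_cong)
  qed
  moreover have "(\<Sum>k<n. \<Sum>l<n. S $$ (i, k) * S $$ (j, l) * (x k * x l)) =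
     ((\<mu> + S *\<^sub>v vec n x) $ i - \<mu> $ i) * ((\<mu> + S *\<^sub>v vec n x) $ j - \<mu> $ j)" for x
    by (simp add: affine_coordinate[OF i \<mu> S(1)] affine_coordinate[OF j \<mu> S(1)] sum_product mult_ac)
  ultimately show "has_bochner_integral (std_normal_fun n) (\<lambda>x. ((\<mu> + mat_sqrt \<Sigma> *\<^sub>v vec n x) $ i - \<mu> $ i) *
      ((\<mu> + mat_sqrt \<Sigma> *\<^sub>v vec n x) $ j - \<mu> $ j)) (\<Sigma> $$ (i, j))"
    unfolding S_def by simp
qed

lemma measurable_scalar_prod:
  assumes u: "u \<in> carrier_vec n"
  shows "(\<lambda>v. u \<bullet> v) \<in> borel_measurable (lborel_vec n)"
proof -
  have "(\<lambda>v. \<Sum>i<n. u $ i * v $ i) \<in> borel_measurable (lborel_vec n)"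
    by (intro borel_measurable_sum borel_measurable_times borel_measurable_const measurable_coordinate) auto
  also have "?this \<longleftrightarrow> ?thesis"
    using u by (intro measurable_cong) (auto simp: space_lborel_vec scalar_prod_def atLeast0LessThan)
  finally show ?thesis .
qed

lemma std_normal_iexp: "has_bochner_integral std_normal_distribution (\<lambda>x. iexp (a * x)) (complex_of_real (exp (- a\<^sup>2 / 2)))"
proof -
  interpret prob_space std_normal_distribution by (rule prob_space_std_normal)
  have "integrable std_normal_distribution (\<lambda>x. iexp (a * x))"
    by (rule integrable_const_bound[where B=1]) auto
  moreover have "(CLINT x|std_normal_distribution. iexp (a * x)) = complex_of_real (exp (- a\<^sup>2 / 2))"
    using fun_cong[OF char_std_normal_distribution, of a] by (simp add: char_def)
  ultimately show ?thesis by (simp add: has_bochner_integral_iff)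
qed

text \<open>
  The characteristic function of a standard normal vector is a product over coordinates, and
  \<open>|S u|\<^sup>2 = \<langle>u, \<Sigma> u\<rangle>\<close> for the symmetric square root \<open>S\<close> of \<open>\<Sigma>\<close>.
\<close>

lemma multivariate_normal_char:
  assumes \<mu>: "\<mu> \<in> carrier_vec n" and \<Sigma>: "pos_semidef_mat n \<Sigma>" and u: "u \<in> carrier_vec n"
  shows "has_bochner_integral (multivariate_normal n \<mu> \<Sigma>) (\<lambda>v. iexp (u \<bullet> v))
           (iexp (u \<bullet> \<mu>) * complex_of_real (exp (- (u \<bullet> (\<Sigma> *\<^sub>v u)) / 2)))"
proof (rule has_bochner_integral_multivariate_normal[OF _ \<mu> \<Sigma>])
  define S where "S = mat_sqrt \<Sigma>"
  have S: "S \<in> carrier_mat n n" "transpose_mat S = S" "S * S = \<Sigma>"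
    using mat_sqrt[OF \<Sigma>] psd_carrier psd_symmetric unfolding S_def by auto
  define a where "a = S *\<^sub>v u"
  have a: "a \<in> carrier_vec n" unfolding a_def by (rule mult_mat_vec_carrier[OF S(1) u])
  show "(\<lambda>v. iexp (u \<bullet> v)) \<in> borel_measurable (lborel_vec n)"
    using measurable_scalar_prod[OF u] by measurable
  have "has_bochner_integral (std_normal_fun n) (\<lambda>x. iexp (u \<bullet> \<mu>) * (\<Prod>i<n. iexp (a $ i * x i)))
      (iexp (u \<bullet> \<mu>) * (\<Prod>i<n. complex_of_real (exp (- (a $ i)\<^sup>2 / 2))))"
    by (intro has_bochner_integral_mult_right has_bochner_integral_PiM_prod product_sigma_finite_std_normal std_normal_iexp)
  moreover have "(\<Prod>i<n. complex_of_real (exp (- (a $ i)\<^sup>2 / 2))) = complex_of_real (exp (- (u \<bullet> (\<Sigma> *\<^sub>v u)) / 2))"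
  proof -
    have "u \<bullet> (\<Sigma> *\<^sub>v u) = u \<bullet> (S *\<^sub>v a)"
      unfolding S(3)[symmetric] a_def using S(1) u by simp
    also have "\<dots> = a \<bullet> a" unfolding a_def[symmetric]
      using symmetric_scalar_prod[OF S(1,2) u a] by (simp add: a_def)
    also have "\<dots> = (\<Sum>i<n. (a $ i)\<^sup>2)" using a by (simp add: scalar_prod_def atLeast0LessThan power2_eq_square)
    finally have "exp (- (u \<bullet> (\<Sigma> *\<^sub>v u)) / 2) = (\<Prod>i<n. exp (- (a $ i)\<^sup>2 / 2))"
      by (simp add: exp_sum[symmetric] sum_negf sum_divide_distrib)
    then show ?thesis by simp
  qed
  moreover have "iexp (u \<bullet> \<mu>) * (\<Prod>i<n. iexp (a $ i * x i)) = iexp (u \<bullet> (\<mu> + S *\<^sub>v vec n x))" for x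
  proof -
    have v: "vec n x \<in> carrier_vec n" by simp
    have Sv: "S *\<^sub>v vec n x \<in> carrier_vec n" by (rule mult_mat_vec_carrier[OF S(1) v])
    have "u \<bullet> (\<mu> + S *\<^sub>v vec n x) = u \<bullet> \<mu> + u \<bullet> (S *\<^sub>v vec n x)"
      by (rule scalar_prod_add_distrib[OF u \<mu> Sv])
    also have "u \<bullet> (S *\<^sub>v vec n x) = a \<bullet> vec n x"
      using symmetric_scalar_prod[OF S(1,2) u v] by (simp add: a_def)
    also have "\<dots> = (\<Sum>i<n. a $ i * x i)" by (simp add: scalar_prod_def atLeast0LessThan)
    finally show ?thesis
      by (simp add: exp_add[symmetric] exp_sum[symmetric] distrib_left sum_distrib_left)
  qed
  ultimately show "has_bochner_integral (std_normal_fun n) (\<lambda>x. iexp (u \<bullet> (\<mu> + mat_sqrt \<Sigma> *\<^sub>v vec n x)))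
     (iexp (u \<bullet> \<mu>) * complex_of_real (exp (- (u \<bullet> (\<Sigma> *\<^sub>v u)) / 2)))"
    unfolding S_def by simp
qed

section \<open>From random vectors to Gaussian integrals\<close>

lemma gauss_dcov_cong:
  assumes "\<And>i j. i < p \<Longrightarrow> j < q \<Longrightarrow> L i j = L' i j"
  shows "gauss_dcov p q L = gauss_dcov p q L'"
proof -
  have "linapp q L t i = linapp q L' t i" if "i < p" for t i
    using assms that by (simp add: linapp_def)
  then show ?thesis unfolding gauss_dcov_def dcov_kernel_def by simp
qed

lemma mult_zero_vec: "A \<in> carrier_mat m n \<Longrightarrow> A *\<^sub>v 0\<^sub>v n = (0\<^sub>v m :: real vec)"
  by (intro eq_vecI) auto

lemma dist_cov_nonneg: "dist_cov M p q X Y \<ge> 0"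
  unfolding dist_cov_def using dcov_const_pos[of p] dcov_const_pos[of q]
  by (intro real_sqrt_ge_zero mult_nonneg_nonneg Bochner_Integration.integral_nonneg)
     (auto split: prod.split simp: eucl_norm_def scalar_prod_self_nonneg)

text \<open>
  The mean enters the characteristic functions only through the phases \<open>\<alpha>\<close> and \<open>\<beta>\<close>, which split
  additively and disappear under the modulus. What is left is the square of
  \<open>exp (- (|s|\<^sup>2 + |t|\<^sup>2) / 2) (exp (- \<langle>s, L t\<rangle>) - 1)\<close>.
\<close>

lemma dist_cov_gaussian:
  fixes L :: "real mat"
  assumes L: "L \<in> carrier_mat p q"
    and J: "\<And>s t. s \<in> carrier_vec p \<Longrightarrow> t \<in> carrier_vec q \<Longrightarrow> joint_char M X Y s t =
        iexp (\<alpha> s + \<beta> t) * complex_of_real (exp (- (s \<bullet> s + 2 * (s \<bullet> (L *\<^sub>v t)) + t \<bullet> t) / 2))"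
    and \<alpha>: "\<alpha> (0\<^sub>v p) = 0" and \<beta>: "\<beta> (0\<^sub>v q) = (0 :: real)"
  shows "(dist_cov M p q X Y)\<^sup>2 = enn2real (gauss_dcov p q (\<lambda>i j. L $$ (i, j))) / (dcov_const p * dcov_const q)"
proof -
  define l where "l = (\<lambda>i j. L $$ (i, j))"
  define F where "F = (\<lambda>(s, t). dcov_kernel p q l (\<lambda>i. s $ i) (\<lambda>j. t $ j))"
  let ?d = "\<lambda>s t. joint_char M X Y s t - joint_char M X Y s (0\<^sub>v q) * joint_char M X Y (0\<^sub>v p) t"
  let ?P = "lborel_vec p \<Otimes>\<^sub>M lborel_vec q"
  interpret pair_sigma_finite "lborel_vec p" "lborel_vec q"
    by (intro pair_sigma_finite.intro sigma_finite_lborel_vec)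
  have sp: "v \<bullet> v = sqsum n (\<lambda>i. v $ i)" if "v \<in> carrier_vec n" for v n
    using that by (simp add: scalar_prod_def atLeast0LessThan power2_eq_square)
  have bil: "s \<bullet> (L *\<^sub>v t) = (\<Sum>i<p. linapp q l (\<lambda>j. t $ j) i * s $ i)"
    if "s \<in> carrier_vec p" "t \<in> carrier_vec q" for s t
    using that L by (simp add: scalar_prod_def atLeast0LessThan linapp_def l_def mult.commute)
  have integrand: "(cmod (?d s t))\<^sup>2
        / (eucl_norm s ^ (p + 1) * eucl_norm t ^ (q + 1)) = F (s, t)"
    if s: "s \<in> carrier_vec p" and t: "t \<in> carrier_vec q" for s t
  proof -
    define b where "b = s \<bullet> (L *\<^sub>v t)"
    have Lt: "L *\<^sub>v t \<in> carrier_vec p" by (rule mult_mat_vec_carrier[OF L t])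
    have J0: "joint_char M X Y s (0\<^sub>v q) = iexp (\<alpha> s) * complex_of_real (exp (- (s \<bullet> s) / 2))"
      using J[OF s, of "0\<^sub>v q"] s \<beta> by (simp add: mult_zero_vec[OF L])
    have J1: "joint_char M X Y (0\<^sub>v p) t = iexp (\<beta> t) * complex_of_real (exp (- (t \<bullet> t) / 2))"
      using J[OF _ t, of "0\<^sub>v p"] t Lt \<alpha> by simp
    have "exp (- (s \<bullet> s + 2 * b + t \<bullet> t) / 2) = exp (- (s \<bullet> s) / 2 + - (t \<bullet> t) / 2 + - b)"
      by (simp add: field_simps)
    then have E: "exp (- (s \<bullet> s + 2 * b + t \<bullet> t) / 2) = exp (- (s \<bullet> s) / 2) * exp (- (t \<bullet> t) / 2) * exp (- b)"
      by (simp only: exp_add)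
    have iexp2: "iexp (\<alpha> s + \<beta> t) = iexp (\<alpha> s) * iexp (\<beta> t)"
      by (simp add: exp_add[symmetric] distrib_left)
    have "?d s t =
      iexp (\<alpha> s) * iexp (\<beta> t) * complex_of_real (exp (- (s \<bullet> s) / 2) * exp (- (t \<bullet> t) / 2) * (exp (- b) - 1))"
      unfolding J[OF s t] J0 J1 b_def[symmetric] E iexp2 of_real_mult of_real_diff of_real_1 by (simp only: ring_distribs) (simp add: mult_ac)
    then have "(cmod (?d s t))\<^sup>2 =
       (exp (- (s \<bullet> s) / 2))\<^sup>2 * (exp (- (t \<bullet> t) / 2))\<^sup>2 * (1 - exp (- b))\<^sup>2"
      by (simp add: norm_mult power_mult_distrib power2_commute del: of_real_mult of_real_diff of_real_exp of_real_divide of_real_minus)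
    also have "(exp (- (s \<bullet> s) / 2))\<^sup>2 * (exp (- (t \<bullet> t) / 2))\<^sup>2 = exp (- (s \<bullet> s) - t \<bullet> t)"
      by (simp add: power2_eq_square exp_add[symmetric])
    finally show ?thesis
      using s t unfolding F_def dcov_kernel_def b_def bil[OF s t] eucl_norm_def by (simp add: sp)
  qed
  have F_meas: "F \<in> borel_measurable ?P"
  proof -
    have ms: "(\<lambda>z. fst z $ i) \<in> borel_measurable ?P" if "i < p" for i
      by (rule measurable_compose[OF measurable_fst measurable_coordinate[OF that]])
    have mt: "(\<lambda>z. snd z $ j) \<in> borel_measurable ?P" if "j < q" for j
      by (rule measurable_compose[OF measurable_snd measurable_coordinate[OF that]])
    have 1: "(\<lambda>z. sqsum p (\<lambda>i. fst z $ i)) \<in> borel_measurable ?P"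
      by (intro borel_measurable_sum borel_measurable_power ms) auto
    have 2: "(\<lambda>z. sqsum q (\<lambda>i. snd z $ i)) \<in> borel_measurable ?P"
      by (intro borel_measurable_sum borel_measurable_power mt) auto
    have 3: "(\<lambda>z. \<Sum>i<p. linapp q l (\<lambda>j. snd z $ j) i * fst z $ i) \<in> borel_measurable ?P"
      unfolding linapp_def
      by (intro borel_measurable_sum borel_measurable_times borel_measurable_const ms mt) auto
    show ?thesis unfolding F_def dcov_kernel_def case_prod_beta using 1 2 3 by measurable
  qed
  have F_nonneg: "F z \<ge> 0" for z
    unfolding F_def dcov_kernel_def case_prod_beta
    by (intro divide_nonneg_nonneg mult_nonneg_nonneg) (auto simp: sum_nonneg)
  have "(LINT (s, t)|?P. (cmod (?d s t))\<^sup>2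
        / (eucl_norm s ^ (p + 1) * eucl_norm t ^ (q + 1))) = (LINT z|?P. F z)"
  proof (rule Bochner_Integration.integral_cong[OF refl])
    fix z assume "z \<in> space ?P"
    then obtain s t where z: "z = (s, t)" "s \<in> carrier_vec p" "t \<in> carrier_vec q"
      by (auto simp: space_pair_measure space_lborel_vec)
    show "(case z of (s, t) \<Rightarrow> (cmod (?d s t))\<^sup>2
        / (eucl_norm s ^ (p + 1) * eucl_norm t ^ (q + 1))) = F z"
      unfolding z(1) prod.case by (rule integrand[OF z(2,3)])
  qed
  also have "\<dots> = enn2real (\<integral>\<^sup>+z. ennreal (F z) \<partial>?P)"
    using F_nonneg by (intro integral_eq_nn_integral F_meas) auto
  also have "(\<integral>\<^sup>+z. ennreal (F z) \<partial>?P) = (\<integral>\<^sup>+t. \<integral>\<^sup>+s. ennreal (F (s, t)) \<partial>lborel_vec p \<partial>lborel_vec q)"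
    using F_meas by (intro nn_integral_snd[symmetric]) measurable
  also have "\<dots> = (\<integral>\<^sup>+y. \<integral>\<^sup>+s. ennreal (F (s, vec q y)) \<partial>lborel_vec p \<partial>lborel_fun q)"
  proof (rule nn_integral_lborel_vec)
    have "(\<lambda>z. (snd z, fst z)) \<in> lborel_vec q \<Otimes>\<^sub>M lborel_vec p \<rightarrow>\<^sub>M ?P"
      by (intro measurable_Pair measurable_snd measurable_fst)
    from measurable_compose[OF this F_meas]
    have "(\<lambda>(t, s). ennreal (F (s, t))) \<in> borel_measurable (lborel_vec q \<Otimes>\<^sub>M lborel_vec p)"
      unfolding case_prod_beta by measurable
    then show "(\<lambda>t. \<integral>\<^sup>+s. ennreal (F (s, t)) \<partial>lborel_vec p) \<in> borel_measurable (lborel_vec q)"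
      by (rule sigma_finite_measure.borel_measurable_nn_integral[OF sigma_finite_lborel_vec])
  qed
  also have "\<dots> = (\<integral>\<^sup>+y. \<integral>\<^sup>+x. ennreal (F (vec p x, vec q y)) \<partial>lborel_fun p \<partial>lborel_fun q)"
  proof (rule nn_integral_cong)
    fix y :: "nat \<Rightarrow> real"
    have "(\<lambda>s. (s, vec q y)) \<in> lborel_vec p \<rightarrow>\<^sub>M ?P"
      by (intro measurable_Pair measurable_const) (auto simp: space_lborel_vec)
    from measurable_compose[OF this F_meas]
    show "(\<integral>\<^sup>+s. ennreal (F (s, vec q y)) \<partial>lborel_vec p) = (\<integral>\<^sup>+x. ennreal (F (vec p x, vec q y)) \<partial>lborel_fun p)"
      by (intro nn_integral_lborel_vec) measurable
  qed
  also have "\<dots> = gauss_dcov p q l"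
  proof -
    have "F (vec p x, vec q y) = dcov_kernel p q l x y" for x y
      by (simp add: F_def dcov_kernel_def linapp_def)
    then show ?thesis unfolding gauss_dcov_def by simp
  qed
  finally have I: "(LINT (s, t)|?P. (cmod (?d s t))\<^sup>2
        / (eucl_norm s ^ (p + 1) * eucl_norm t ^ (q + 1))) = enn2real (gauss_dcov p q l)" .
  show ?thesis
    unfolding dist_cov_def I l_def[symmetric] using dcov_const_pos[of p] dcov_const_pos[of q] by simp
qed

lemma gauss_dcov_one: "n \<ge> 1 \<Longrightarrow>
  enn2real (gauss_dcov n n (\<lambda>i j. 1\<^sub>m n $$ (i, j))) / (dcov_const n * dcov_const n) = 4 * gamma_ratio (real n / 2) ^ 2 * A_const n"
proof -
  assume n: "n \<ge> 1"
  have "gauss_dcov n n (\<lambda>i j. 1\<^sub>m n $$ (i, j)) = gauss_dcov n n id_coeffs"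
    by (rule gauss_dcov_cong) (simp add: id_coeffs_def)
  then show ?thesis
    using gauss_dcov_id[OF n] A_const_pos[OF n] dcov_const_pos[of n] by (simp add: power2_eq_square)
qed

text \<open>
  The characteristic function of the pair \<open>(Z, Z)\<close> at \<open>(s, t)\<close> is that of \<open>Z\<close> at \<open>s + t\<close>, and the
  cross term of \<open>|s + t|\<^sup>2\<close> is the bilinear form of the identity matrix.
\<close>

lemma dist_cov_standard_gaussian:
  assumes n: "n \<ge> 1" and Z: "\<And>\<omega>. \<omega> \<in> space M \<Longrightarrow> Z \<omega> \<in> carrier_vec n" and m: "m \<in> carrier_vec n"
    and char: "\<And>u. u \<in> carrier_vec n \<Longrightarrow>
      (CLINT \<omega>|M. iexp (u \<bullet> Z \<omega>)) = iexp (u \<bullet> m) * complex_of_real (exp (- (u \<bullet> u) / 2))"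
  shows "(dist_cov M n n Z Z)\<^sup>2 = 4 * gamma_ratio (real n / 2) ^ 2 * A_const n"
  unfolding gauss_dcov_one[OF n, symmetric]
proof (rule dist_cov_gaussian[where \<alpha>="\<lambda>s. s \<bullet> m" and \<beta>="\<lambda>s. s \<bullet> m"])
  fix s t :: "real vec" assume s: "s \<in> carrier_vec n" and t: "t \<in> carrier_vec n"
  have "joint_char M Z Z s t = (CLINT \<omega>|M. iexp ((s + t) \<bullet> Z \<omega>))"
    unfolding joint_char_def using add_scalar_prod_distrib[OF s t Z]
    by (intro Bochner_Integration.integral_cong) auto
  also have "\<dots> = iexp ((s + t) \<bullet> m) * complex_of_real (exp (- ((s + t) \<bullet> (s + t)) / 2))"
    using s t by (intro char) simp
  also have "(s + t) \<bullet> (s + t) = s \<bullet> s + 2 * (s \<bullet> (1\<^sub>m n *\<^sub>v t)) + t \<bullet> t"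
    using s t comm_scalar_prod[OF s t]
    by (simp add: scalar_prod_add_distrib[of _ n] add_scalar_prod_distrib[of _ n])
  also have "(s + t) \<bullet> m = s \<bullet> m + t \<bullet> m" by (rule add_scalar_prod_distrib[OF s t m])
  finally show "joint_char M Z Z s t = iexp (s \<bullet> m + t \<bullet> m) *
      complex_of_real (exp (- (s \<bullet> s + 2 * (s \<bullet> (1\<^sub>m n *\<^sub>v t)) + t \<bullet> t) / 2))" .
qed (use m in simp_all)

locale gaussian_pair =
  fixes M :: "'a measure" and p q :: nat and X Y :: "'a \<Rightarrow> real vec" and \<mu> :: "real vec"
    and \<Sigma>X \<Sigma>XY \<Sigma>Y :: "real mat"
  assumes X: "X \<in> M \<rightarrow>\<^sub>M lborel_vec p" and Y: "Y \<in> M \<rightarrow>\<^sub>M lborel_vec q"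
    and \<mu>: "\<mu> \<in> carrier_vec (p + q)" and \<Sigma>XY: "\<Sigma>XY \<in> carrier_mat p q"
    and \<Sigma>: "pos_semidef_mat (p + q) (four_block_mat \<Sigma>X \<Sigma>XY (transpose_mat \<Sigma>XY) \<Sigma>Y)"
    and \<Sigma>X: "pos_def_mat p \<Sigma>X" and \<Sigma>Y: "pos_def_mat q \<Sigma>Y"
    and law: "distr M (lborel_vec (p + q)) (\<lambda>\<omega>. X \<omega> @\<^sub>v Y \<omega>) =
      multivariate_normal (p + q) \<mu> (four_block_mat \<Sigma>X \<Sigma>XY (transpose_mat \<Sigma>XY) \<Sigma>Y)"
begin

abbreviation "\<Sigma> \<equiv> four_block_mat \<Sigma>X \<Sigma>XY (transpose_mat \<Sigma>XY) \<Sigma>Y"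
abbreviation "WX \<equiv> mat_inv_sqrt \<Sigma>X"
abbreviation "WY \<equiv> mat_inv_sqrt \<Sigma>Y"
abbreviation "\<mu>X \<equiv> vec_first \<mu> p"
abbreviation "\<mu>Y \<equiv> vec_last \<mu> q"

text \<open>
  The cross-covariance matrix of the standardised vectors; its singular values are the canonical
  correlations.
\<close>

definition std_cross_cov :: "real mat" where "std_cross_cov = WX * \<Sigma>XY * WY"

lemma cX: "\<Sigma>X \<in> carrier_mat p p" and cY: "\<Sigma>Y \<in> carrier_mat q q" 
  using \<Sigma>X \<Sigma>Y by (auto simp: pos_def_mat_def)

lemmas WX = mat_inv_sqrt[OF \<Sigma>X] and WY = mat_inv_sqrt[OF \<Sigma>Y]

lemma std_cross_cov_carrier: "std_cross_cov \<in> carrier_mat p q"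
  unfolding std_cross_cov_def using WX(1) WY(1) \<Sigma>XY by simp

lemma expectation_law:
  fixes g :: "real vec \<Rightarrow> 'b :: {banach, second_countable_topology}"
  assumes "g \<in> borel_measurable (lborel_vec (p + q))" "has_bochner_integral (multivariate_normal (p + q) \<mu> \<Sigma>) g I"
  shows "(\<integral>\<omega>. g (X \<omega> @\<^sub>v Y \<omega>) \<partial>M) = I"
  using integral_distr[OF measurable_append[OF X Y] assms(1)] assms(2)
  unfolding law by (simp add: has_bochner_integral_iff)

lemma coordinate_append:
  assumes "\<omega> \<in> space M"
  shows "i < p \<Longrightarrow> X \<omega> $ i = (X \<omega> @\<^sub>v Y \<omega>) $ i" "j < q \<Longrightarrow> Y \<omega> $ j = (X \<omega> @\<^sub>v Y \<omega>) $ (p + j)"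
  using measurable_carrier[OF X assms] measurable_carrier[OF Y assms] by auto

lemma mean_law: "i < p + q \<Longrightarrow> (\<integral>\<omega>. (X \<omega> @\<^sub>v Y \<omega>) $ i \<partial>M) = \<mu> $ i"
  by (rule expectation_law[OF measurable_coordinate multivariate_normal_mean[OF \<mu> \<Sigma>]])

lemma covariance_law:
  assumes "i < p + q" "j < p + q"
  shows "(\<integral>\<omega>. ((X \<omega> @\<^sub>v Y \<omega>) $ i - \<mu> $ i) * ((X \<omega> @\<^sub>v Y \<omega>) $ j - \<mu> $ j) \<partial>M) = \<Sigma> $$ (i, j)"
  by (rule expectation_law[OF _ multivariate_normal_covariance[OF \<mu> \<Sigma> assms]])
     (intro borel_measurable_times borel_measurable_diff measurable_coordinate borel_measurable_const assms)

lemma covariance_X: "covariance_mat M p X = \<Sigma>X"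
proof (rule eq_matI)
  fix i j assume "i < dim_row \<Sigma>X" "j < dim_col \<Sigma>X"
  then have ij: "i < p" "j < p" using cX by auto
  have m: "(\<integral>\<omega>. X \<omega> $ k \<partial>M) = \<mu> $ k" if "k < p" for k
    using mean_law[of k] that coordinate_append(1)
    by (subst Bochner_Integration.integral_cong[OF refl, of M _ "\<lambda>\<omega>. (X \<omega> @\<^sub>v Y \<omega>) $ k"]) auto
  have "(\<integral>\<omega>. (X \<omega> $ i - \<mu> $ i) * (X \<omega> $ j - \<mu> $ j) \<partial>M) = \<Sigma> $$ (i, j)"
    using covariance_law[of i j] ij coordinate_append(1)
    by (subst Bochner_Integration.integral_cong[OF refl, of M _ "\<lambda>\<omega>. ((X \<omega> @\<^sub>v Y \<omega>) $ i - \<mu> $ i) * ((X \<omega> @\<^sub>v Y \<omega>) $ j - \<mu> $ j)"]) auto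
  then show "covariance_mat M p X $$ (i, j) = \<Sigma>X $$ (i, j)"
    using ij cX by (simp add: covariance_mat_def m)
qed (use cX in \<open>auto simp: covariance_mat_def\<close>)

lemma covariance_Y: "covariance_mat M q Y = \<Sigma>Y"
proof (rule eq_matI)
  fix i j assume "i < dim_row \<Sigma>Y" "j < dim_col \<Sigma>Y"
  then have ij: "i < q" "j < q" using cY by auto
  have m: "(\<integral>\<omega>. Y \<omega> $ k \<partial>M) = \<mu> $ (p + k)" if "k < q" for k
    using mean_law[of "p + k"] that coordinate_append(2)
    by (subst Bochner_Integration.integral_cong[OF refl, of M _ "\<lambda>\<omega>. (X \<omega> @\<^sub>v Y \<omega>) $ (p + k)"]) auto
  have "(\<integral>\<omega>. (Y \<omega> $ i - \<mu> $ (p + i)) * (Y \<omega> $ j - \<mu> $ (p + j)) \<partial>M) = \<Sigma> $$ (p + i, p + j)"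
    using covariance_law[of "p + i" "p + j"] ij coordinate_append(2)
    by (subst Bochner_Integration.integral_cong[OF refl, of M _ "\<lambda>\<omega>. ((X \<omega> @\<^sub>v Y \<omega>) $ (p + i) - \<mu> $ (p + i)) * ((X \<omega> @\<^sub>v Y \<omega>) $ (p + j) - \<mu> $ (p + j))"]) auto
  then show "covariance_mat M q Y $$ (i, j) = \<Sigma>Y $$ (i, j)"
    using ij cX cY by (simp add: covariance_mat_def m)
qed (use cY in \<open>auto simp: covariance_mat_def\<close>)

lemma quadratic_blocks:
  assumes a: "a \<in> carrier_vec p" and b: "b \<in> carrier_vec q"
  shows "(a @\<^sub>v b) \<bullet> (\<Sigma> *\<^sub>v (a @\<^sub>v b)) = a \<bullet> (\<Sigma>X *\<^sub>v a) + 2 * (a \<bullet> (\<Sigma>XY *\<^sub>v b)) + b \<bullet> (\<Sigma>Y *\<^sub>v b)"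
proof -
  have T: "transpose_mat \<Sigma>XY \<in> carrier_mat q p" using \<Sigma>XY by simp
  note c = mult_mat_vec_carrier[OF cX a] mult_mat_vec_carrier[OF \<Sigma>XY b] mult_mat_vec_carrier[OF T a] mult_mat_vec_carrier[OF cY b]
  have "(a @\<^sub>v b) \<bullet> (\<Sigma> *\<^sub>v (a @\<^sub>v b)) = a \<bullet> (\<Sigma>X *\<^sub>v a + \<Sigma>XY *\<^sub>v b) + b \<bullet> (transpose_mat \<Sigma>XY *\<^sub>v a + \<Sigma>Y *\<^sub>v b)"
    unfolding four_block_mat_mult_vec[OF cX \<Sigma>XY T cY a b] using a b c
    by (intro scalar_prod_append[of _ p _ q]) auto
  also have "\<dots> = a \<bullet> (\<Sigma>X *\<^sub>v a) + a \<bullet> (\<Sigma>XY *\<^sub>v b) + (b \<bullet> (transpose_mat \<Sigma>XY *\<^sub>v a) + b \<bullet> (\<Sigma>Y *\<^sub>v b))"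
    using scalar_prod_add_distrib[OF a c(1,2)] scalar_prod_add_distrib[OF b c(3,4)] by simp
  also have "b \<bullet> (transpose_mat \<Sigma>XY *\<^sub>v a) = a \<bullet> (\<Sigma>XY *\<^sub>v b)"
    using transpose_vec_mult_scalar[OF \<Sigma>XY b a] comm_scalar_prod[OF b c(3)] by simp
  finally show ?thesis by simp
qed

lemma quadratic_standardized:
  assumes s: "s \<in> carrier_vec p" and t: "t \<in> carrier_vec q"
  shows "((WX *\<^sub>v s) @\<^sub>v (WY *\<^sub>v t)) \<bullet> (\<Sigma> *\<^sub>v ((WX *\<^sub>v s) @\<^sub>v (WY *\<^sub>v t))) =
    s \<bullet> s + 2 * (s \<bullet> (std_cross_cov *\<^sub>v t)) + t \<bullet> t"
proof -
  have a: "WX *\<^sub>v s \<in> carrier_vec p" and b: "WY *\<^sub>v t \<in> carrier_vec q"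
    using mult_mat_vec_carrier[OF WX(1) s] mult_mat_vec_carrier[OF WY(1) t] by auto
  have std: "(W *\<^sub>v v) \<bullet> (A *\<^sub>v (W *\<^sub>v v)) = v \<bullet> v"
    if "W \<in> carrier_mat n n" "transpose_mat W = W" "W * A * W = 1\<^sub>m n" "A \<in> carrier_mat n n" "v \<in> carrier_vec n" for W A :: "real mat" and v n
  proof -
    have Wv: "W *\<^sub>v v \<in> carrier_vec n" by (rule mult_mat_vec_carrier[OF that(1,5)])
    have AWv: "A *\<^sub>v (W *\<^sub>v v) \<in> carrier_vec n" by (rule mult_mat_vec_carrier[OF that(4) Wv])
    have "(W *\<^sub>v v) \<bullet> (A *\<^sub>v (W *\<^sub>v v)) = v \<bullet> (W *\<^sub>v (A *\<^sub>v (W *\<^sub>v v)))"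
      by (rule symmetric_scalar_prod[OF that(1,2,5) AWv])
    also have "W *\<^sub>v (A *\<^sub>v (W *\<^sub>v v)) = (W * A * W) *\<^sub>v v"
      by (simp only: assoc_mult_mat_vec[OF mult_carrier_mat[OF that(1,4)] that(1,5)] assoc_mult_mat_vec[OF that(1,4) Wv])
    finally show ?thesis unfolding that(3) using that(5) by simp
  qed
  have c: "\<Sigma>XY *\<^sub>v (WY *\<^sub>v t) \<in> carrier_vec p" by (rule mult_mat_vec_carrier[OF \<Sigma>XY b])
  have "(WX *\<^sub>v s) \<bullet> (\<Sigma>XY *\<^sub>v (WY *\<^sub>v t)) = s \<bullet> (WX *\<^sub>v (\<Sigma>XY *\<^sub>v (WY *\<^sub>v t)))"
    by (rule symmetric_scalar_prod[OF WX(1,2) s c])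
  also have "WX *\<^sub>v (\<Sigma>XY *\<^sub>v (WY *\<^sub>v t)) = std_cross_cov *\<^sub>v t"
    unfolding std_cross_cov_def using WX(1) WY(1) \<Sigma>XY t b
    by (simp add: assoc_mult_mat_vec[of _ p q _ q] assoc_mult_mat_vec[of _ p p _ q])
  finally show ?thesis
    unfolding quadratic_blocks[OF a b] std[OF WX(1-3) cX s] std[OF WY(1-3) cY t] by simp
qed

text \<open>
  The standardised joint covariance matrix is positive semidefinite; evaluate its quadratic form
  at the pair \<open>(- L t, t)\<close>.
\<close>

lemma std_cross_cov_contraction: "sqsum p (linapp q (\<lambda>i j. std_cross_cov $$ (i, j)) t) \<le> sqsum q t"
proof -
  define v where "v = vec q t"
  define w where "w = std_cross_cov *\<^sub>v v"
  have v: "v \<in> carrier_vec q" by (simp add: v_def)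
  have w: "w \<in> carrier_vec p" unfolding w_def by (rule mult_mat_vec_carrier[OF std_cross_cov_carrier v])
  have mw: "- w \<in> carrier_vec p" using w by simp
  have "0 \<le> ((WX *\<^sub>v (- w)) @\<^sub>v (WY *\<^sub>v v)) \<bullet> (\<Sigma> *\<^sub>v ((WX *\<^sub>v (- w)) @\<^sub>v (WY *\<^sub>v v)))"
    by (intro psd_nonneg[OF \<Sigma>] append_carrier_vec mult_mat_vec_carrier[OF WX(1) mw] mult_mat_vec_carrier[OF WY(1) v])
  also have "\<dots> = - w \<bullet> - w + 2 * (- w \<bullet> w) + v \<bullet> v"
    unfolding quadratic_standardized[OF mw v] w_def[symmetric] ..
  also have "\<dots> = v \<bullet> v - w \<bullet> w" using w by simp
  finally have "w \<bullet> w \<le> v \<bullet> v" by simp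
  moreover have "v \<bullet> v = sqsum q t" by (simp add: v_def scalar_prod_def atLeast0LessThan power2_eq_square)
  moreover have "w \<bullet> w = sqsum p (linapp q (\<lambda>i j. std_cross_cov $$ (i, j)) t)"
    using std_cross_cov_carrier by (simp add: w_def v_def scalar_prod_def atLeast0LessThan power2_eq_square linapp_def)
  ultimately show ?thesis by simp
qed

lemma joint_char_law:
  assumes a: "a \<in> carrier_vec p" and b: "b \<in> carrier_vec q"
  shows "joint_char M X Y a b = iexp (a \<bullet> \<mu>X + b \<bullet> \<mu>Y) *
      complex_of_real (exp (- ((a @\<^sub>v b) \<bullet> (\<Sigma> *\<^sub>v (a @\<^sub>v b))) / 2))"
proof -
  have ab: "a @\<^sub>v b \<in> carrier_vec (p + q)" using a b by simp
  have "joint_char M X Y a b = (CLINT \<omega>|M. iexp ((a @\<^sub>v b) \<bullet> (X \<omega> @\<^sub>v Y \<omega>)))"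
    unfolding joint_char_def
  proof (rule Bochner_Integration.integral_cong)
    fix \<omega> assume "\<omega> \<in> space M"
    then show "iexp (a \<bullet> X \<omega> + b \<bullet> Y \<omega>) = iexp ((a @\<^sub>v b) \<bullet> (X \<omega> @\<^sub>v Y \<omega>))"
      using scalar_prod_append[OF a b measurable_carrier[OF X] measurable_carrier[OF Y]] by simp
  qed simp
  also have "\<dots> = iexp ((a @\<^sub>v b) \<bullet> \<mu>) * complex_of_real (exp (- ((a @\<^sub>v b) \<bullet> (\<Sigma> *\<^sub>v (a @\<^sub>v b))) / 2))"
    using measurable_scalar_prod[OF ab] by (intro expectation_law multivariate_normal_char[OF \<mu> \<Sigma> ab]) measurable
  also have "(a @\<^sub>v b) \<bullet> \<mu> = a \<bullet> \<mu>X + b \<bullet> \<mu>Y"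
  proof -
    have "\<mu> = \<mu>X @\<^sub>v \<mu>Y" using \<mu> by simp
    then have "(a @\<^sub>v b) \<bullet> \<mu> = (a @\<^sub>v b) \<bullet> (\<mu>X @\<^sub>v \<mu>Y)" by simp
    also have "\<dots> = a \<bullet> \<mu>X + b \<bullet> \<mu>Y" by (rule scalar_prod_append[OF a b]) auto
    finally show ?thesis .
  qed
  finally show ?thesis .
qed

abbreviation "XS \<equiv> \<lambda>\<omega>. WX *\<^sub>v X \<omega>"
abbreviation "YS \<equiv> \<lambda>\<omega>. WY *\<^sub>v Y \<omega>"

lemma joint_char_standardized:
  assumes s: "s \<in> carrier_vec p" and t: "t \<in> carrier_vec q"
  shows "joint_char M XS YS s t = iexp (s \<bullet> (WX *\<^sub>v \<mu>X) + t \<bullet> (WY *\<^sub>v \<mu>Y)) *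
     complex_of_real (exp (- (s \<bullet> s + 2 * (s \<bullet> (std_cross_cov *\<^sub>v t)) + t \<bullet> t) / 2))"
proof -
  have "joint_char M XS YS s t = joint_char M X Y (WX *\<^sub>v s) (WY *\<^sub>v t)"
    unfolding joint_char_def
    using symmetric_scalar_prod[OF WX(1,2) s measurable_carrier[OF X]]
      symmetric_scalar_prod[OF WY(1,2) t measurable_carrier[OF Y]]
    by (intro Bochner_Integration.integral_cong) auto
  also have "\<dots> = iexp ((WX *\<^sub>v s) \<bullet> \<mu>X + (WY *\<^sub>v t) \<bullet> \<mu>Y) *
     complex_of_real (exp (- (s \<bullet> s + 2 * (s \<bullet> (std_cross_cov *\<^sub>v t)) + t \<bullet> t) / 2))"
    using joint_char_law[OF mult_mat_vec_carrier[OF WX(1) s] mult_mat_vec_carrier[OF WY(1) t]]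
    unfolding quadratic_standardized[OF s t] .
  finally show ?thesis
    by (simp only: symmetric_scalar_prod[OF WX(1,2) s vec_first_carrier] symmetric_scalar_prod[OF WY(1,2) t vec_last_carrier])
qed

lemma ai_dist_cov_XY:
  "(ai_dist_cov M p q X Y)\<^sup>2 = enn2real (gauss_dcov p q (\<lambda>i j. std_cross_cov $$ (i, j))) / (dcov_const p * dcov_const q)"
  unfolding ai_dist_cov_def covariance_X covariance_Y
  using mult_mat_vec_carrier[OF WX(1) vec_first_carrier[of \<mu>]] mult_mat_vec_carrier[OF WY(1) vec_last_carrier[of \<mu>]]
  by (intro dist_cov_gaussian[OF std_cross_cov_carrier joint_char_standardized]) auto

lemma ai_dist_cov_XX:
  assumes "p \<ge> 1"
  shows "(ai_dist_cov M p p X X)\<^sup>2 = 4 * gamma_ratio (real p / 2) ^ 2 * A_const p"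
  unfolding ai_dist_cov_def covariance_X
proof (rule dist_cov_standard_gaussian[OF assms mult_mat_vec_carrier[OF WX(1) measurable_carrier[OF X]]
      mult_mat_vec_carrier[OF WX(1) vec_first_carrier]])
  fix u :: "real vec" assume u: "u \<in> carrier_vec p"
  have "(CLINT \<omega>|M. iexp (u \<bullet> XS \<omega>)) = joint_char M XS YS u (0\<^sub>v q)"
    unfolding joint_char_def using mult_mat_vec_carrier[OF WY(1) measurable_carrier[OF Y]]
    by (intro Bochner_Integration.integral_cong) auto
  also have "\<dots> = iexp (u \<bullet> (WX *\<^sub>v \<mu>X)) * complex_of_real (exp (- (u \<bullet> u) / 2))"
    unfolding joint_char_standardized[OF u zero_carrier_vec] mult_zero_vec[OF std_cross_cov_carrier]
    using u mult_mat_vec_carrier[OF WY(1) vec_last_carrier[of \<mu>]] by simp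
  finally show "(CLINT \<omega>|M. iexp (u \<bullet> XS \<omega>)) = iexp (u \<bullet> (WX *\<^sub>v \<mu>X)) * complex_of_real (exp (- (u \<bullet> u) / 2))" .
qed

lemma ai_dist_cov_YY:
  assumes "q \<ge> 1"
  shows "(ai_dist_cov M q q Y Y)\<^sup>2 = 4 * gamma_ratio (real q / 2) ^ 2 * A_const q"
  unfolding ai_dist_cov_def covariance_Y
proof (rule dist_cov_standard_gaussian[OF assms mult_mat_vec_carrier[OF WY(1) measurable_carrier[OF Y]]
      mult_mat_vec_carrier[OF WY(1) vec_last_carrier]])
  fix u :: "real vec" assume u: "u \<in> carrier_vec q"
  have "(CLINT \<omega>|M. iexp (u \<bullet> YS \<omega>)) = joint_char M XS YS (0\<^sub>v p) u"
    unfolding joint_char_def using mult_mat_vec_carrier[OF WX(1) measurable_carrier[OF X]]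
    by (intro Bochner_Integration.integral_cong) auto
  also have "\<dots> = iexp (u \<bullet> (WY *\<^sub>v \<mu>Y)) * complex_of_real (exp (- (u \<bullet> u) / 2))"
    unfolding joint_char_standardized[OF zero_carrier_vec u]
    using u mult_mat_vec_carrier[OF WX(1) vec_first_carrier[of \<mu>]] mult_mat_vec_carrier[OF std_cross_cov_carrier u] by simp
  finally show "(CLINT \<omega>|M. iexp (u \<bullet> YS \<omega>)) = iexp (u \<bullet> (WY *\<^sub>v \<mu>Y)) * complex_of_real (exp (- (u \<bullet> u) / 2))" .
qed

lemma std_cross_cov_gram: "WY * transpose_mat \<Sigma>XY * mat_inv \<Sigma>X * \<Sigma>XY * WY = transpose_mat std_cross_cov * std_cross_cov"
proof -
  let ?T = "transpose_mat \<Sigma>XY"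
  have T: "?T \<in> carrier_mat q p" using \<Sigma>XY by simp
  have "transpose_mat std_cross_cov = transpose_mat WY * transpose_mat (WX * \<Sigma>XY)"
    unfolding std_cross_cov_def using WX(1) WY(1) \<Sigma>XY by (intro transpose_mult[of _ p q _ q]) auto
  also have "transpose_mat (WX * \<Sigma>XY) = ?T * transpose_mat WX"
    by (rule transpose_mult[OF WX(1) \<Sigma>XY])
  finally have "transpose_mat std_cross_cov = WY * (?T * WX)" by (simp add: WX(2) WY(2))
  also have "\<dots> = WY * ?T * WX" by (rule assoc_mult_mat[OF WY(1) T WX(1), symmetric])
  finally have tc: "transpose_mat std_cross_cov = WY * ?T * WX" .
  have U: "WY * ?T \<in> carrier_mat q p" and UW: "WY * ?T * WX \<in> carrier_mat q p"
    and WS: "WX * \<Sigma>XY \<in> carrier_mat p q"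
    using WX(1) WY(1) T \<Sigma>XY by auto
  have "WY * ?T * (WX * WX) * \<Sigma>XY * WY = WY * ?T * WX * WX * \<Sigma>XY * WY"
    by (simp only: assoc_mult_mat[OF U WX(1) WX(1)])
  also have "\<dots> = WY * ?T * WX * (WX * \<Sigma>XY) * WY"
    by (simp only: assoc_mult_mat[OF UW WX(1) \<Sigma>XY])
  also have "\<dots> = WY * ?T * WX * (WX * \<Sigma>XY * WY)"
    by (rule assoc_mult_mat[OF UW WS WY(1)])
  finally show ?thesis unfolding WX(4) tc unfolding std_cross_cov_def .
qed

lemma trace_std_cross_cov:
  "mat_trace (WY * transpose_mat \<Sigma>XY * mat_inv \<Sigma>X * \<Sigma>XY * WY) = (\<Sum>i<p. sqsum q (\<lambda>j. std_cross_cov $$ (i, j)))"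
  unfolding std_cross_cov_gram mat_trace_def using std_cross_cov_carrier
  by (subst sum.swap) (simp add: scalar_prod_def atLeast0LessThan power2_eq_square)

lemma trace_std_cross_cov_pos:
  assumes "WY * transpose_mat \<Sigma>XY * mat_inv \<Sigma>X * \<Sigma>XY * WY \<noteq> 0\<^sub>m q q"
  shows "(\<Sum>i<p. sqsum q (\<lambda>j. std_cross_cov $$ (i, j))) > 0"
proof (rule ccontr)
  assume "\<not> ?thesis"
  moreover have "(\<Sum>i<p. sqsum q (\<lambda>j. std_cross_cov $$ (i, j))) \<ge> 0" by (intro sum_nonneg) auto
  ultimately have "(\<Sum>i<p. sqsum q (\<lambda>j. std_cross_cov $$ (i, j))) = 0" by simp
  then have "\<forall>i<p. \<forall>j<q. std_cross_cov $$ (i, j) = 0"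
    by (simp add: sum_nonneg_eq_0_iff sum_nonneg)
  then have "transpose_mat std_cross_cov * std_cross_cov = 0\<^sub>m q q"
    using std_cross_cov_carrier by (intro eq_matI) (auto simp: scalar_prod_def)
  with assms show False unfolding std_cross_cov_gram by simp
qed

end

section \<open>The limits\<close>

lemma Beta_half:
  assumes "x > 0"
  shows "Beta (1/2) (x + 1/2) = sqrt pi * gamma_ratio x / x"
proof -
  have "1/2 + (x + 1/2) = x + 1" by simp
  then show ?thesis
    unfolding Beta_def gamma_ratio_def by (simp only: Gamma_plus1_pos[OF assms] Gamma_one_half_real) simp
qed

lemma gamma_ratio_pos: "x > 0 \<Longrightarrow> gamma_ratio x > 0"
  unfolding gamma_ratio_def by (intro divide_pos_pos Gamma_real_pos) auto

lemma gamma_ratio_seq: "(\<lambda>p. gamma_ratio (real p / 2) ^ 2 / (real p / 2)) \<longlonglongrightarrow> 1"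
proof -
  have "filterlim (\<lambda>n. real n / 2) at_top sequentially" by real_asymp
  from filterlim_compose[OF gamma_ratio_asymp this] show ?thesis .
qed

lemma Beta_main_limit: "(\<lambda>p. sqrt (real p) * Beta (1/2) ((real p + 1) / 2)) \<longlonglongrightarrow> sqrt (2 * pi)"
proof -
  have "(\<lambda>p. sqrt (2 * pi * (gamma_ratio (real p / 2) ^ 2 / (real p / 2)))) \<longlonglongrightarrow> sqrt (2 * pi * 1)"
    by (intro tendsto_intros gamma_ratio_seq)
  moreover have "\<forall>\<^sub>F p in sequentially. sqrt (2 * pi * (gamma_ratio (real p / 2) ^ 2 / (real p / 2))) =
      sqrt (real p) * Beta (1/2) ((real p + 1) / 2)"
    using eventually_gt_at_top[of 0]
  proof eventually_elim
    case (elim p)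
    define x where "x = real p / 2"
    have x: "x > 0" "real p = 2 * x" using elim by (auto simp: x_def)
    have e: "(real p + 1) / 2 = x + 1/2" by (simp add: x_def)
    have B: "Beta (1/2) ((real p + 1) / 2) = sqrt pi * gamma_ratio x / x"
      unfolding e by (rule Beta_half[OF x(1)])
    have "sqrt (2 * pi * (gamma_ratio x ^ 2 / x)) = sqrt ((2 * x) * pi * (gamma_ratio x / x) ^ 2)"
      using x by (simp add: power2_eq_square)
    also have "\<dots> = sqrt (2 * x) * (sqrt pi * (gamma_ratio x / x))"
      using x gamma_ratio_pos[OF x(1)] by (simp add: real_sqrt_mult)
    finally show ?case unfolding x_def[symmetric] B unfolding x(2) by simp
  qed
  ultimately show ?thesis by (subst (asm) tendsto_cong) auto
qed

text \<open>
  The functional equation expresses the Beta value through \<open>1 / (x * gamma_ratio (x + 1))\<close> with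
  \<open>x = p / 2 - 1\<close>. The crude bound \<open>gamma_ratio (x + 1) \<ge> 1/2\<close> already suffices, since \<open>1 / x\<close> beats the
  square root of \<open>p\<close>.
\<close>

lemma Beta_error_limit: "(\<lambda>p. sqrt (real p) * Beta (3/2) ((real p - 2) / 2)) \<longlonglongrightarrow> 0"
proof (rule real_tendsto_sandwich)
  show "\<forall>\<^sub>F p in sequentially. 0 \<le> sqrt (real p) * Beta (3/2) ((real p - 2) / 2)"
    using eventually_ge_at_top[of 3]
    by eventually_elim (intro mult_nonneg_nonneg less_imp_le[OF Beta_pos], auto)
  show "\<forall>\<^sub>F p in sequentially. sqrt (real p) * Beta (3/2) ((real p - 2) / 2) \<le> sqrt (real p) * (sqrt pi / (real p / 2 - 1))"
    using eventually_ge_at_top[of 3]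
  proof eventually_elim
    case (elim p)
    define x where "x = real p / 2 - 1"
    have x: "x > 0" "x \<ge> 1/2" using elim by (auto simp: x_def)
    have G: "Gamma (3/2 :: real) = sqrt pi / 2"
      using Gamma_plus1_pos[of "1/2"] by (simp add: Gamma_one_half_real)
    have r: "gamma_ratio (x + 1) \<ge> 1/2"
    proof (rule power2_le_imp_le)
      show "(1/2)\<^sup>2 \<le> (gamma_ratio (x + 1))\<^sup>2"
        using gamma_ratio_bounds(1)[of "x + 1"] x by (simp add: power2_eq_square)
      show "0 \<le> gamma_ratio (x + 1)" using gamma_ratio_pos[of "x + 1"] x by simp
    qed
    have "Gamma x > 0" "Gamma (x + 1) = x * Gamma x" "Gamma (x + 3/2) > 0"
      using x by (auto intro!: Gamma_real_pos Gamma_plus1_pos)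
    moreover have "gamma_ratio (x + 1) = Gamma (x + 3/2) / Gamma (x + 1)"
    proof -
      have "x + 1 + 1/2 = x + 3/2" by simp
      then show ?thesis by (simp only: gamma_ratio_def)
    qed
    ultimately have "Gamma x / Gamma (x + 3/2) = 1 / (x * gamma_ratio (x + 1))"
      using x by (simp add: field_simps)
    moreover have "Beta (3/2) x = sqrt pi / 2 * (Gamma x / Gamma (x + 3/2))"
      by (simp add: Beta_def G add.commute)
    ultimately have "Beta (3/2) x = sqrt pi / 2 * (1 / (x * gamma_ratio (x + 1)))" by (simp only:)
    also have "\<dots> \<le> sqrt pi / 2 * (1 / (x * (1/2)))"
      using x r by (intro mult_left_mono divide_left_mono) auto
    also have "\<dots> = sqrt pi / x" by simp
    finally have "Beta (3/2) x \<le> sqrt pi / x" .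
    moreover have "(real p - 2) / 2 = x" by (simp add: x_def field_simps)
    ultimately show ?case unfolding x_def[symmetric] by (intro mult_left_mono) auto
  qed
  show "(\<lambda>p. sqrt (real p) * (sqrt pi / (real p / 2 - 1))) \<longlonglongrightarrow> 0" by real_asymp
qed simp

lemma dcov_const_ratio:
  assumes "q \<ge> 1"
  shows "dcov_const (q - 1) / dcov_const q = gamma_ratio (real q / 2) / sqrt pi"
proof -
  have e: "(real q + 1) / 2 = real q / 2 + 1/2" "(real (q - 1) + 1) / 2 = real q / 2"
    using assms by (simp_all add: add_divide_distrib of_nat_diff)
  have pw: "pi powr (real q / 2 + 1/2) = pi powr (real q / 2) * sqrt pi"
    by (simp add: powr_add powr_half_sqrt)
  have "Gamma (real q / 2) > 0" "Gamma (real q / 2 + 1/2) > 0"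
    using assms by (auto intro!: Gamma_real_pos)
  then show ?thesis unfolding dcov_const_def gamma_ratio_def e pw by simp
qed

theorem theorem4p4:
  fixes M :: "'a measure" and q :: nat
    and X :: "nat \<Rightarrow> 'a \<Rightarrow> real vec" and Y :: "'a \<Rightarrow> real vec"
    and \<mu> :: "nat \<Rightarrow> real vec"
    and \<Sigma> \<Sigma>X \<Sigma>XY \<Lambda> :: "nat \<Rightarrow> real mat" and \<Sigma>Y :: "real mat"
  assumes "prob_space M"
    and "q \<ge> 1"
    and "\<And>p. p \<ge> 1 \<Longrightarrow> X p \<in> M \<rightarrow>\<^sub>M lborel_vec p"
    and "Y \<in> M \<rightarrow>\<^sub>M lborel_vec q"
    and "\<And>p. p \<ge> 1 \<Longrightarrow> \<mu> p \<in> carrier_vec (p + q)"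
    and "\<And>p. p \<ge> 1 \<Longrightarrow> \<Sigma>XY p \<in> carrier_mat p q"
    and "\<And>p. p \<ge> 1 \<Longrightarrow>
           \<Sigma> p = four_block_mat (\<Sigma>X p) (\<Sigma>XY p) (transpose_mat (\<Sigma>XY p)) \<Sigma>Y"
    and "\<And>p. p \<ge> 1 \<Longrightarrow> pos_semidef_mat (p + q) (\<Sigma> p)"
    and "\<And>p. p \<ge> 1 \<Longrightarrow> pos_def_mat p (\<Sigma>X p)"
    and "pos_def_mat q \<Sigma>Y"
    and "\<And>p. p \<ge> 1 \<Longrightarrow>
           distr M (lborel_vec (p + q)) (\<lambda>\<omega>. X p \<omega> @\<^sub>v Y \<omega>)
             = multivariate_normal (p + q) (\<mu> p) (\<Sigma> p)"
    and "\<And>p. p \<ge> 1 \<Longrightarrow>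
           \<Lambda> p = mat_inv_sqrt \<Sigma>Y * transpose_mat (\<Sigma>XY p) * mat_inv (\<Sigma>X p) * \<Sigma>XY p
                   * mat_inv_sqrt \<Sigma>Y"
    and "\<And>p. p \<ge> 1 \<Longrightarrow> \<Lambda> p \<noteq> 0\<^sub>m q q"
  shows "(\<lambda>p. sqrt (real p) / mat_trace (\<Lambda> p) * (ai_dist_cov M p q (X p) Y)\<^sup>2)
           \<longlonglongrightarrow> sqrt (pi / 2) * (dcov_const (q - 1) / (real q * dcov_const q))
         \<and> (\<lambda>p. sqrt (real p) / mat_trace (\<Lambda> p) * (ai_dist_corr M p q (X p) Y)\<^sup>2)
           \<longlonglongrightarrow> 1 / (2 * real q * sqrt (A_const q))"
proof -
  have pair: "gaussian_pair M p q (X p) Y (\<mu> p) (\<Sigma>X p) (\<Sigma>XY p) \<Sigma>Y" if "p \<ge> 1" for p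
    unfolding gaussian_pair_def
    using assms(3)[OF that] assms(4) assms(5,6)[OF that] assms(8)[OF that] assms(9)[OF that] assms(10) assms(11)[OF that]
    unfolding assms(7)[OF that] by blast
  define g where "g = gamma_ratio (real q / 2)"
  define B where "B = Beta (1/2) ((real q + 1) / 2) / (4 * pi)"
  define V where "V p = (ai_dist_cov M p q (X p) Y)\<^sup>2" for p
  define b1 b2 where "b1 p = sqrt (real p) * Beta (1/2) ((real p + 1) / 2)"
    and "b2 p = sqrt (real p) * Beta (3/2) ((real p - 2) / 2)" for p
  define D where "D p = 2 * sqrt (gamma_ratio (real p / 2) ^ 2 * A_const p)" for p
  define VY where "VY = 2 * (g * sqrt (A_const q))"
  define r where "r p = sqrt (real p) / mat_trace (\<Lambda> p)" for p
  have g: "g > 0" unfolding g_def using assms(2) by (intro gamma_ratio_pos) auto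
  have A: "A_const q > 0" by (rule A_const_pos[OF assms(2)])
  have Bg: "B = g / (2 * sqrt pi * real q)"
  proof -
    have e: "(real q + 1) / 2 = real q / 2 + 1/2" by (simp add: add_divide_distrib)
    have "Beta (1/2) ((real q + 1) / 2) = sqrt pi * g / (real q / 2)"
      unfolding e g_def using assms(2) by (intro Beta_half) simp
    then have "B = (sqrt pi * g / (real q / 2)) / (4 * (sqrt pi * sqrt pi))"
      unfolding B_def by simp
    also have "\<dots> = g / (2 * sqrt pi * real q)"
      using assms(2) by (simp del: real_sqrt_mult_self)
    finally show ?thesis .
  qed
  have bounds: "B * b1 p \<le> r p * V p"
    "r p * V p \<le> B * (b1 p + 2 * sqrt 2 * b2 p)"
    if p: "p \<ge> 3" for p
  proof -
    have p1: "p \<ge> 1" using p by simp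
    interpret gaussian_pair M p q "X p" Y "\<mu> p" "\<Sigma>X p" "\<Sigma>XY p" \<Sigma>Y by (rule pair[OF p1])
    define T where "T = mat_trace (\<Lambda> p)"
    have T: "T = (\<Sum>i<p. sqsum q (\<lambda>j. std_cross_cov $$ (i, j)))"
      unfolding T_def assms(12)[OF p1] by (rule trace_std_cross_cov)
    have T0: "T > 0" unfolding T using assms(12,13)[OF p1] by (intro trace_std_cross_cov_pos) simp
    note b = gauss_dcov_bounds[OF p assms(2) std_cross_cov_contraction, folded ai_dist_cov_XY T B_def V_def]
    have c: "sqrt (real p) / T \<ge> 0" using T0 by simp
    show "B * b1 p \<le> r p * V p"
      using mult_left_mono[OF b(1) c] T0 unfolding r_def b1_def b2_def T_def[symmetric] by (simp add: mult_ac)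
    show "r p * V p \<le> B * (b1 p + 2 * sqrt 2 * b2 p)"
      using mult_left_mono[OF b(2) c] T0 unfolding r_def b1_def b2_def T_def[symmetric] by (simp add: field_simps)
  qed
  have lim1: "(\<lambda>p. r p * V p) \<longlonglongrightarrow> B * sqrt (2 * pi)"
  proof (rule real_tendsto_sandwich)
    show "\<forall>\<^sub>F p in sequentially. B * b1 p \<le> r p * V p"
      using eventually_ge_at_top[of 3] by eventually_elim (rule bounds(1))
    show "\<forall>\<^sub>F p in sequentially. r p * V p \<le> B * (b1 p + 2 * sqrt 2 * b2 p)"
      using eventually_ge_at_top[of 3] by eventually_elim (rule bounds(2))
    show "(\<lambda>p. B * b1 p) \<longlonglongrightarrow> B * sqrt (2 * pi)"
      unfolding b1_def by (intro tendsto_mult_left Beta_main_limit)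
    have "(\<lambda>p. B * (b1 p + 2 * sqrt 2 * b2 p))
       \<longlonglongrightarrow> B * (sqrt (2 * pi) + 2 * sqrt 2 * 0)"
      unfolding b1_def b2_def by (intro tendsto_mult_left tendsto_add Beta_main_limit Beta_error_limit)
    then show "(\<lambda>p. B * (b1 p + 2 * sqrt 2 * b2 p))
       \<longlonglongrightarrow> B * sqrt (2 * pi)" by simp
  qed
  have VX: "ai_dist_cov M p p (X p) (X p) = D p" if p: "p \<ge> 1" for p
  proof -
    interpret gaussian_pair M p q "X p" Y "\<mu> p" "\<Sigma>X p" "\<Sigma>XY p" \<Sigma>Y by (rule pair[OF p])
    have "ai_dist_cov M p p (X p) (X p) = sqrt ((ai_dist_cov M p p (X p) (X p))\<^sup>2)"
      by (simp add: ai_dist_cov_def dist_cov_nonneg)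
    also have "\<dots> = sqrt (4 * (gamma_ratio (real p / 2) ^ 2 * A_const p))"
      unfolding ai_dist_cov_XX[OF p] by (simp only: mult.assoc)
    finally show ?thesis unfolding D_def by (simp only: real_sqrt_mult real_sqrt_four)
  qed
  have VYY: "ai_dist_cov M q q Y Y = VY"
  proof -
    interpret gaussian_pair M 1 q "X 1" Y "\<mu> 1" "\<Sigma>X 1" "\<Sigma>XY 1" \<Sigma>Y by (rule pair) simp
    have "ai_dist_cov M q q Y Y = sqrt ((ai_dist_cov M q q Y Y)\<^sup>2)"
      by (simp add: ai_dist_cov_def dist_cov_nonneg)
    also have "\<dots> = VY"
      unfolding ai_dist_cov_YY[OF assms(2)] g_def[symmetric] VY_def using g by (simp add: real_sqrt_mult)
    finally show ?thesis .
  qed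
  have VXlim: "(\<lambda>p. D p) \<longlonglongrightarrow> 2 * sqrt (1 / 8)"
    unfolding D_def by (intro tendsto_mult_left tendsto_real_sqrt A_const_asymp)
  have corr: "(ai_dist_corr M p q (X p) Y)\<^sup>2 = V p / (D p * VY)"
    if p: "p \<ge> 1" for p
  proof -
    have 1: "ai_dist_cov M p p (X p) (X p) > 0"
      unfolding VX[OF p] D_def using A_const_pos[OF p] gamma_ratio_pos[of "real p / 2"] p by simp
    have 2: "ai_dist_cov M q q Y Y > 0" unfolding VYY VY_def using g A by simp
    show ?thesis using 1 2 unfolding ai_dist_corr_def VX[OF p, symmetric] VYY[symmetric] V_def
      by (simp add: power_divide)
  qed
  have "(\<lambda>p. r p * V p / (D p * VY))
     \<longlonglongrightarrow> B * sqrt (2 * pi) / (2 * sqrt (1 / 8) * VY)"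
    using g A unfolding VY_def by (intro tendsto_divide lim1 tendsto_mult_right VXlim) auto
  moreover have "\<forall>\<^sub>F p in sequentially. r p * V p / (D p * VY)
     = r p * (ai_dist_corr M p q (X p) Y)\<^sup>2"
    using eventually_ge_at_top[of 1] by eventually_elim (simp add: corr)
  ultimately have "(\<lambda>p. r p * (ai_dist_corr M p q (X p) Y)\<^sup>2)
     \<longlonglongrightarrow> B * sqrt (2 * pi) / (2 * sqrt (1 / 8) * VY)"
    by (subst (asm) tendsto_cong) auto
  moreover have "B * sqrt (2 * pi) / (2 * sqrt (1 / 8) * VY) = 1 / (2 * real q * sqrt (A_const q))"
  proof -
    have "sqrt (1 / 8) = sqrt 2 / 4"
    proof (rule real_sqrt_unique)
      show "(sqrt 2 / 4)\<^sup>2 = 1 / (8::real)" by (simp add: power_divide)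
    qed simp
    then show ?thesis unfolding Bg VY_def using g A assms(2) by (simp add: real_sqrt_mult field_simps)
  qed
  ultimately have lim2: "(\<lambda>p. r p * (ai_dist_corr M p q (X p) Y)\<^sup>2) \<longlonglongrightarrow> 1 / (2 * real q * sqrt (A_const q))"
    by simp
  have "B * sqrt (2 * pi) = sqrt (pi / 2) * (dcov_const (q - 1) / (real q * dcov_const q))"
  proof -
    have "dcov_const (q - 1) / (real q * dcov_const q) = dcov_const (q - 1) / dcov_const q / real q" by simp
    also have "\<dots> = g / sqrt pi / real q" unfolding dcov_const_ratio[OF assms(2)] g_def ..
    finally have c: "dcov_const (q - 1) / (real q * dcov_const q) = g / sqrt pi / real q" .
    have "sqrt (2 * pi) = 2 * sqrt (pi / 2)"
    proof (rule real_sqrt_unique)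
      show "(2 * sqrt (pi / 2))\<^sup>2 = 2 * pi" by (simp add: power_mult_distrib)
    qed simp
    then show ?thesis unfolding Bg c by simp
  qed
  with lim1 have "(\<lambda>p. r p * V p) \<longlonglongrightarrow> sqrt (pi / 2) * (dcov_const (q - 1) / (real q * dcov_const q))" by simp
  with lim2 show ?thesis unfolding r_def V_def by blast
qed

end
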